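(* Let $0<\alpha<2$, $r_0>0$, and let $\chi:[0,\infty)\to[0,1]$ be a smooth, compactly supported cutoff function with $\chi(r)=1$ for $r\in[0,r_0]$. Set $$v_s(x)=\chi(|x|)\,|x|^{-\alpha}x^\perp,\qquad c=\left(\frac{2\alpha}{4-\alpha}\right)^2,\qquad T=\frac{r_0^\alpha}{c}.$$ Then there exists a subsolution $(\bar v,\bar\sigma,\bar q)$ to the Euler equation on $[0,T]\times\mathbb{R}^2$ with initial datum $v^\circ=v_s$ which agrees with the steady solution $v_s$ outside $\{(t,x):|x|\le (ct)^{1/\alpha}\}$; that is, $\bar v=v_s$, $\bar\sigma=v_s\otimes v_s-\frac12|v_s|^2I_2$ and $\bar q=q_s$ there, where $q_s=q_s(x)$ is the Bernoulli pressure of the steady solution $v_s$. Furthermore, for $t\in(0,T]$ its energy dissipation rate equals $$\partial_t\bar E(t)=-\frac{\pi}{16}\,c^{\frac{8-\alpha}{2\alpha}}\,t^{\frac{4-3\alpha}{\alpha}}.$$ In particular, $\partial_t\bar E|_{t=0}=0$ if and only if $\alpha<\frac43$, or equivalently if and only if $\omega^\circ=\mathrm{rot}\,v_s\in L^{3/2}(\mathbb{R}^2)$.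
   Context: $x^\perp=(-x_2,x_1)$, $\mathrm{rot}\,v=\partial_1v_2-\partial_2v_1$, and $I_2$ is the $2\times2$ identity matrix. A subsolution with initial datum $v^\circ$ is a triple $(\bar v,\bar\sigma,\bar q)\in C([0,T];L^2\times L^1\times L^1)$, where $\bar v$ is $\mathbb{R}^2$-valued, $\bar\sigma$ takes values in symmetric traceless $2\times 2$ matrices and $\bar q$ is real-valued, such that $\bar v$ is weakly divergence-free and $$\int_0^T\int_{\mathbb{R}^2}(\bar v\cdot\partial_t\Phi+\bar\sigma:\nabla\Phi+\bar q\,\mathrm{div}\Phi)\,dx\,dt=-\int_{\mathbb{R}^2}v^\circ\cdot\Phi|_{t=0}\,dx$$ for every $\Phi\in C^1_c([0,T)\times\mathbb{R}^2;\mathbb{R}^2)$. The pair $(\bar v,\bar q)$ is a weak solution to the Euler equation, with Bernoulli pressure $\bar q$, if $(\bar v,\bar v\otimes\bar v-\frac12|\bar v|^2I_2,\bar q)$ is a subsolution; it is steady if it is time-independent. The energy of a subsolution is $\bar E(t)=\int_{\mathbb{R}^2}\bar e(t,x)\,dx$ with $$\bar e=\tfrac12|\bar v|^2+\lambda_{\max}\big(\bar v\otimes\bar v-\tfrac12|\bar v|^2I_2-\bar\sigma\big),$$ where $\lambda_{\max}$ denotes the largest eigenvalue. The value $\partial_t\bar E|_{t=0}$ is understood as the limit as $t\to0^+$ (possibly $-\infty$). *)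

theory Defs
  imports "HOL-Analysis.Analysis"
begin

definition perp :: "real^2 \<Rightarrow> real^2" where
  "perp x = vector [- (x $ 2), x $ 1]"

definition outer :: "real^'n \<Rightarrow> real^'m \<Rightarrow> real^'m^'n" where
  "outer v w = (\<chi> i j. v $ i * w $ j)"

(* v \<otimes> v - |v|^2/2 I *)
definition traceless_square :: "real^2 \<Rightarrow> real^2^2" where
  "traceless_square v = outer v v - ((norm v)\<^sup>2 / 2) *\<^sub>R mat 1"

definition lambda_max :: "real^'n^'n \<Rightarrow> real" where
  "lambda_max A = Max {l. \<exists>x. x \<noteq> 0 \<and> A *v x = l *\<^sub>R x}"

definition smooth_halfline :: "(real \<Rightarrow> real) \<Rightarrow> bool" where
  "smooth_halfline f \<longleftrightarrow>
     (\<exists>d. (\<forall>r\<ge>0. d 0 r = f r) \<and>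
          (\<forall>n::nat. \<forall>r\<ge>0. (d n has_real_derivative d (Suc n) r) (at r within {0..})))"

(* Elements of Lebesgue spaces are represented by Borel functions. *)
definition in_Lp :: "real \<Rightarrow> ('a::euclidean_space \<Rightarrow> 'b::euclidean_space) \<Rightarrow> bool" where
  "in_Lp p f \<longleftrightarrow> f \<in> borel_measurable lborel \<and> integrable lborel (\<lambda>x. norm (f x) powr p)"

definition Lp_norm :: "real \<Rightarrow> ('a::euclidean_space \<Rightarrow> 'b::euclidean_space) \<Rightarrow> real" where
  "Lp_norm p f = (LINT x|lborel. norm (f x) powr p) powr (1 / p)"

(* u \<in> C([0,T]; L^p) *)
definition continuous_into_Lp ::
    "real \<Rightarrow> real \<Rightarrow> (real \<Rightarrow> 'a::euclidean_space \<Rightarrow> 'b::euclidean_space) \<Rightarrow> bool" where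
  "continuous_into_Lp T p u \<longleftrightarrow>
     (\<forall>t\<in>{0..T}. in_Lp p (u t)) \<and>
     (\<forall>t\<in>{0..T}. ((\<lambda>s. Lp_norm p (\<lambda>x. u s x - u t x)) \<longlongrightarrow> 0) (at t within {0..T}))"

(* f \<in> C^1_c(S) with derivative D. The derivatives are relative to S, hence one-sided in time at
   t = 0 when S = [0,T) \<times> R^2; the support is compact in S, so it may meet {t = 0} but stays
   away from {t = T}. *)
definition C1_test ::
    "'a::real_normed_vector set \<Rightarrow> ('a \<Rightarrow> 'b::real_normed_vector) \<Rightarrow> ('a \<Rightarrow> 'a \<Rightarrow>\<^sub>L 'b) \<Rightarrow> bool" where
  "C1_test S f D \<longleftrightarrow>
     (\<forall>z\<in>S. (f has_derivative blinfun_apply (D z)) (at z within S)) \<and>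
     continuous_on S D \<and>
     (\<exists>K. compact K \<and> K \<subseteq> S \<and> (\<forall>z\<in>S - K. f z = 0))"

definition weakly_div_free :: "(real^2 \<Rightarrow> real^2) \<Rightarrow> bool" where
  "weakly_div_free v \<longleftrightarrow>
     (\<forall>(\<phi> :: real^2 \<Rightarrow> real) D. C1_test UNIV \<phi> D \<longrightarrow>
        (LINT x|lborel. (\<Sum>i\<in>UNIV. v x $ i * D x (axis i 1))) = 0)"

(* \<omega> = \<partial>_1 v_2 - \<partial>_2 v_1 in the sense of distributions *)
definition is_rot :: "(real^2 \<Rightarrow> real^2) \<Rightarrow> (real^2 \<Rightarrow> real) \<Rightarrow> bool" where
  "is_rot v \<omega> \<longleftrightarrow>
     \<omega> \<in> borel_measurable lborel \<and>
     (\<forall>K. compact K \<longrightarrow> set_integrable lborel K \<omega>) \<and>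
     (\<forall>(\<phi> :: real^2 \<Rightarrow> real) D. C1_test UNIV \<phi> D \<longrightarrow>
        (LINT x|lborel. \<omega> x * \<phi> x) =
        - (LINT x|lborel. v x $ 2 * D x (axis 1 1) - v x $ 1 * D x (axis 2 1)))"

(* For D = D\<Phi>(t,x): the partial derivatives are D (1, 0) in time and D (0, e_j) in space. *)
definition dt :: "((real \<times> (real^2)) \<Rightarrow>\<^sub>L (real^2)) \<Rightarrow> real^2" where
  "dt D = D (1, 0)"

definition grad :: "((real \<times> (real^2)) \<Rightarrow>\<^sub>L (real^2)) \<Rightarrow> real^2^2" where
  "grad D = (\<chi> i j. D (0, axis j 1) $ i)"

(* The inner product of real^2^2 is the Frobenius product A : B, and trace (grad D) is the
   spatial divergence. *)
definition subsolution ::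
    "real \<Rightarrow> (real^2 \<Rightarrow> real^2) \<Rightarrow> (real \<Rightarrow> real^2 \<Rightarrow> real^2) \<Rightarrow>
     (real \<Rightarrow> real^2 \<Rightarrow> real^2^2) \<Rightarrow> (real \<Rightarrow> real^2 \<Rightarrow> real) \<Rightarrow> bool" where
  "subsolution T v0 v \<sigma> q \<longleftrightarrow>
     in_Lp 2 v0 \<and>
     continuous_into_Lp T 2 v \<and> continuous_into_Lp T 1 \<sigma> \<and> continuous_into_Lp T 1 q \<and>
     (\<forall>t\<in>{0..T}. \<forall>x. transpose (\<sigma> t x) = \<sigma> t x \<and> trace (\<sigma> t x) = 0) \<and>
     (\<forall>t\<in>{0..T}. weakly_div_free (v t)) \<and>
     (\<forall>\<Phi> D. C1_test ({0..<T} \<times> UNIV) \<Phi> D \<longrightarrow>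
        (LINT t:{0..<T}|lborel. LINT x|lborel.
            v t x \<bullet> dt (D (t, x)) + \<sigma> t x \<bullet> grad (D (t, x)) + q t x * trace (grad (D (t, x))))
        = - (LINT x|lborel. v0 x \<bullet> \<Phi> (0, x)))"

definition euler_weak_solution ::
    "real \<Rightarrow> (real^2 \<Rightarrow> real^2) \<Rightarrow> (real \<Rightarrow> real^2 \<Rightarrow> real^2) \<Rightarrow>
     (real \<Rightarrow> real^2 \<Rightarrow> real) \<Rightarrow> bool" where
  "euler_weak_solution T v0 v q \<longleftrightarrow> subsolution T v0 v (\<lambda>t x. traceless_square (v t x)) q"

(* The integrability of q normalises the additive constant, so q is unique almost everywhere. *)
definition steady_euler_solution ::
    "real \<Rightarrow> (real^2 \<Rightarrow> real^2) \<Rightarrow> (real^2 \<Rightarrow> real) \<Rightarrow> bool" where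
  "steady_euler_solution T v q \<longleftrightarrow> euler_weak_solution T v (\<lambda>t. v) (\<lambda>t. q)"

definition energy_density :: "real^2 \<Rightarrow> real^2^2 \<Rightarrow> real" where
  "energy_density v \<sigma> = (norm v)\<^sup>2 / 2 + lambda_max (traceless_square v - \<sigma>)"

definition energy ::
    "(real \<Rightarrow> real^2 \<Rightarrow> real^2) \<Rightarrow> (real \<Rightarrow> real^2 \<Rightarrow> real^2^2) \<Rightarrow> real \<Rightarrow> real" where
  "energy v \<sigma> t = (LINT x|lborel. energy_density (v t x) (\<sigma> t x))"

(* Limits are taken in the extended reals, so that the initial rate may be infinite. *)
definition initial_energy_rate :: "(real \<Rightarrow> real) \<Rightarrow> ereal \<Rightarrow> bool" where
  "initial_energy_rate E L \<longleftrightarrow> ((\<lambda>t. ereal (deriv E t)) \<longlongrightarrow> L) (at_right 0)"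

end

theory Submission
  imports Defs "HOL-Real_Asymp.Real_Asymp"
begin

text \<open>
All fields are radial. With \<open>r = |x|\<close>, the subsolution is sought in the form
\<open>v = g(t,r) x\<^sup>\<bottom>\<close>,
\<open>\<sigma> = v \<otimes> v - |v|\<^sup>2/2 I + b(t,r) (x \<otimes> x\<^sup>\<bottom> + x\<^sup>\<bottom> \<otimes> x)\<close> and \<open>q = |v|\<^sup>2/2 + p(t,r)\<close>,
where \<open>x\<^sup>\<bottom>\<close> is the rotated vector \<open>perp x\<close>. The momentum flux \<open>\<sigma> + q I\<close> then equals
\<open>g\<^sup>2 x\<^sup>\<bottom> \<otimes> x\<^sup>\<bottom> + b (x \<otimes> x\<^sup>\<bottom> + x\<^sup>\<bottom> \<otimes> x) + p I\<close>, and its divergence is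
\<open>(r b' + 4 b) x\<^sup>\<bottom> + (p'/r - g\<^sup>2) x\<close>. Momentum balance thus reduces to the two scalar equations
\<open>p' = r g\<^sup>2\<close> and \<open>\<partial>\<^sub>t g = - (r b' + 4 b)\<close>. The steady vortex is the case \<open>b = 0\<close>,
\<open>g = \<chi> r powr (- \<alpha>)\<close>. The matrix in the energy density has the eigenvalues \<open>\<plusminus> b r\<^sup>2\<close>, so
that the density is \<open>g\<^sup>2 r\<^sup>2 / 2 + |b| r\<^sup>2\<close>.

Near the origin the datum is homogeneous, which suggests a self-similar relaxation inside a disc of
radius \<open>R(t)\<close> with \<open>R powr \<alpha> = c t\<close>. Among the self-similar profiles with the angular momentum
of the steady vortex in that disc, the energy is minimised by one of the form
\<open>g = (A - B ln (r/R)) / (c t)\<close>, with \<open>A\<close> and \<open>B\<close> depending on the speed \<open>c\<close>. The value of \<open>c\<close> in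
the theorem is the one for which \<open>A = 1\<close>, that is, for which \<open>g\<close> matches \<open>r powr (- \<alpha>)\<close> at \<open>r = R\<close>;
then \<open>B = 4 \<alpha> / (4 - \<alpha>)\<close>, and the balance law gives \<open>b = - B ln (r/R) / (4 c t\<^sup>2)\<close>. Hence \<open>g\<close>, \<open>b\<close>
and \<open>p\<close> are continuous across the front, which carries no jump condition. By scaling, the
excess energy over the steady state is a constant multiple of \<open>(c t) powr (4/\<alpha> - 2)\<close>, and
differentiating gives the dissipation rate (\<open>fan_energy_eq\<close>, \<open>energy_rate_const\<close>).

The difficulty is the origin, where \<open>v \<otimes> v\<close> has size \<open>r powr (2 - 2 \<alpha>)\<close> and its gradient is not
locally integrable once \<open>\<alpha> \<ge> 3/2\<close>. Since the momentum flux is even in \<open>x\<close>, only the odd part of a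
test function contributes; the odd part vanishes at \<open>0\<close> and this gains the missing power of \<open>r\<close>
(\<open>radial_stress_balance\<close>). Integration by parts itself is Fubini on the lines that avoid the origin:
along them the fields are continuous and, apart from finitely many points, differentiable
(\<open>integral_partial_derivative_eq_0\<close>). In time the estimate
\<open>|\<partial>\<^sub>t v| \<le> const r powr (- \<alpha>) t powr (-1/2)\<close> allows the order of integration to be exchanged
(\<open>weak_momentum\<close>). The locale \<open>radial_flow\<close> collects what the argument uses of the profiles, and
is instantiated twice: with the steady vortex and with the fan.

The vorticity of \<open>v\<^sub>s\<close> is \<open>(2 - \<alpha>) r powr (- \<alpha>)\<close> near \<open>0\<close>, so it lies in \<open>L\<^sup>3\<^sup>/\<^sup>2\<close> if \<open>\<alpha> < 4/3\<close>.
Conversely, a distributional vorticity in \<open>L\<^sup>3\<^sup>/\<^sup>2\<close> is tested against bumps of width \<open>l\<close> and height of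
order \<open>l powr (-2/3)\<close>: for \<open>\<alpha> \<ge> 4/3\<close> the circulation they measure stays above a bound that
Young's inequality and the vanishing of \<open>\<integral> |\<omega>|\<^sup>3\<^sup>/\<^sup>2\<close> over small discs rule out
(\<open>vorticity_not_in_L32\<close>).
\<close>

section \<open>Radial integrals and integration along lines in the plane\<close>

text \<open>
Polar coordinates for radial functions: \<open>|x|\<close> has density \<open>2 \<pi> r\<close>, because discs of radius \<open>a\<close>
have area \<open>\<pi> a\<^sup>2\<close> and the half-lines generate the Borel sets.
\<close>

lemma distr_norm_plane:
  "distr lborel borel (norm :: real^2 \<Rightarrow> real)
     = density lborel (\<lambda>r. ennreal (indicator {0<..} r * (2 * pi * r)))" (is "?M = ?N")
proof (rule measure_eqI_generator_eq[where E = "range (\<lambda>a::real. {..a})" and \<Omega> = UNIV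
      and A = "\<lambda>i::nat. {..real i}"])
  have M: "emeasure ?M {..a} = ennreal (if 0 \<le> a then pi * a\<^sup>2 else 0)" for a :: real
  proof -
    have *: "norm -` {..a} = (if 0 \<le> a then cball (0::real^2) a else {})"
      by (auto simp: order_trans[OF norm_ge_zero])
    show ?thesis
      by (auto simp: emeasure_distr * emeasure_cball unit_ball_vol_2)
  qed
  have N: "emeasure ?N {..a} = ennreal (if 0 \<le> a then pi * a\<^sup>2 else 0)" for a :: real
  proof (cases "0 \<le> a")
    case True
    have "emeasure ?N {..a} = (\<integral>\<^sup>+ r. ennreal (2 * pi * r) * indicator {0..a} r \<partial>lborel)"
      by (subst emeasure_density) (auto intro!: nn_integral_cong simp: indicator_def)
    also have "\<dots> = pi * a\<^sup>2 - pi * 0\<^sup>2"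
      using True
      by (intro nn_integral_FTC_Icc) (auto intro!: derivative_eq_intros simp: power2_eq_square)
    finally show ?thesis using True by simp
  next
    case False
    then have "ennreal (indicator {0<..} r * (2 * pi * r)) * indicator {..a} r = 0" for r
      by (auto simp: indicator_def)
    with False show ?thesis by (subst emeasure_density) (auto simp del: mult_eq_0_iff)
  qed
  show "emeasure ?M X = emeasure ?N X" if "X \<in> range (\<lambda>a::real. {..a})" for X
    using that by (auto simp: M N simp del: if_split)
  show "emeasure ?M {..real i} \<noteq> \<infinity>" for i :: nat
    by (simp add: M)
  show "Int_stable (range (\<lambda>a::real. {..a}))"
    by (auto simp: Int_stable_def)
  show "(\<Union>i::nat. {..real i}) = UNIV"
    by (auto intro: real_arch_simple)
  show "sets ?M = sigma_sets UNIV (range (\<lambda>a::real. {..a}))"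
    "sets ?N = sigma_sets UNIV (range (\<lambda>a::real. {..a}))"
    by (simp_all add: borel_eq_atMost)
qed auto

lemma integrable_radial_iff:
  fixes f :: "real \<Rightarrow> real"
  assumes [measurable]: "f \<in> borel_measurable borel"
  shows "integrable lborel (\<lambda>x::real^2. f (norm x)) \<longleftrightarrow>
    integrable lborel (\<lambda>r. indicator {0<..} r * (2 * pi * r * f r))"
proof -
  have "integrable lborel (\<lambda>x::real^2. f (norm x)) \<longleftrightarrow> integrable (distr lborel borel (norm :: real^2 \<Rightarrow> real)) f"
    by (simp add: integrable_distr_eq)
  also have "\<dots> \<longleftrightarrow> integrable lborel (\<lambda>r. (indicator {0<..} r * (2 * pi * r)) *\<^sub>R f r)"
    unfolding distr_norm_plane by (intro integrable_density) (auto simp: indicator_def)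
  finally show ?thesis by (simp add: mult_ac)
qed

lemma integral_radial:
  fixes f :: "real \<Rightarrow> real"
  assumes [measurable]: "f \<in> borel_measurable borel"
  shows "(LINT x|lborel. f (norm (x::real^2))) = (LINT r:{0<..}|lborel. 2 * pi * r * f r)"
proof -
  have "(LINT x|lborel. f (norm (x::real^2))) = integral\<^sup>L (distr lborel borel (norm :: real^2 \<Rightarrow> real)) f"
    by (simp add: integral_distr)
  also have "\<dots> = (LINT r|lborel. (indicator {0<..} r * (2 * pi * r)) *\<^sub>R f r)"
    unfolding distr_norm_plane by (intro integral_density) (auto simp: indicator_def)
  finally show ?thesis by (simp add: set_lebesgue_integral_def mult_ac)
qed

text \<open>
The antiderivative only needs one-sided limits at the end points, as is required for integrands such
as \<open>r ^ 3 (ln r)\<^sup>2\<close> near \<open>0\<close>.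
\<close>

lemma has_bochner_integral_FTC_nonneg_open:
  fixes f F :: "real \<Rightarrow> real"
  assumes ab: "a < b"
    and D: "\<And>x. a < x \<Longrightarrow> x < b \<Longrightarrow> DERIV F x :> f x"
    and C: "\<And>x. a < x \<Longrightarrow> x < b \<Longrightarrow> isCont f x"
    and N: "\<And>x. a < x \<Longrightarrow> x < b \<Longrightarrow> 0 \<le> f x"
    and A: "(F \<longlongrightarrow> A) (at_right a)" and B: "(F \<longlongrightarrow> B) (at_left b)"
  shows "has_bochner_integral lborel (\<lambda>x. indicator {a<..<b} x * f x) (B - A)"
proof -
  have AE: "AE x in lborel. ereal a < ereal x \<longrightarrow> ereal x < ereal b \<longrightarrow> 0 \<le> f x"
    using N by simp
  have A': "((F \<circ> real_of_ereal) \<longlongrightarrow> A) (at_right (ereal a))"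
    and B': "((F \<circ> real_of_ereal) \<longlongrightarrow> B) (at_left (ereal b))"
    using A B by (simp_all add: ereal_tendsto_simps)
  note FTC = interval_integral_FTC_nonneg[of "ereal a" "ereal b" F f, OF _ _ _ AE A' B']
  have "set_integrable lborel (einterval (ereal a) (ereal b)) f" "(LBINT x=ereal a..ereal b. f x) = B - A"
    using FTC ab D C by simp_all
  then show ?thesis
    using ab by (simp add: has_bochner_integral_iff set_integrable_def
        interval_lebesgue_integral_def set_lebesgue_integral_def)
qed

lemma has_bochner_integral_powr_near_0:
  fixes e M :: real
  assumes "-1 < e" "0 < M"
  shows "has_bochner_integral lborel (\<lambda>r. indicator {0<..<M} r * r powr e) (M powr (e + 1) / (e + 1))"
proof -
  let ?F = "\<lambda>r. r powr (e + 1) / (e + 1)"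
  have "has_bochner_integral lborel (\<lambda>r. indicator {0<..<M} r * r powr e) (?F M - 0)"
  proof (rule has_bochner_integral_FTC_nonneg_open[where F = ?F])
    show "DERIV ?F r :> r powr e" if "0 < r" for r
      using that assms by (auto intro!: derivative_eq_intros)
    show "isCont (\<lambda>r. r powr e) r" if "0 < r" for r
      using that by (auto intro!: continuous_intros)
    have "(?F \<longlongrightarrow> 0 powr (e + 1) / (e + 1)) (at_right 0)"
      using assms by (intro tendsto_intros) (auto simp: eventually_at_filter)
    then show "(?F \<longlongrightarrow> 0) (at_right 0)" by simp
    show "(?F \<longlongrightarrow> ?F M) (at_left M)"
      using assms by (intro tendsto_intros) auto
  qed (use assms in auto)
  then show ?thesis by simp
qed

lemma integrable_norm_powr:
  fixes a M :: real
  assumes "a < 2" "0 < M"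
  shows "integrable lborel (\<lambda>x::real^2. indicator {..M} (norm x) * norm x powr (- a))"
proof -
  have "integrable lborel (\<lambda>r. 2 * pi * (indicator {0<..<M} r *\<^sub>R r powr (1 - a)))"
    using integrable.intros[OF has_bochner_integral_powr_near_0[of "1 - a" M]] assms by (intro integrable_mult_right) simp
  moreover have "AE r in lborel. 2 * pi * (indicator {0<..<M} r *\<^sub>R r powr (1 - a)) =
     indicator {0<..} r * (2 * pi * r * (indicator {..M} r * r powr - a))"
  proof (rule AE_mp[OF AE_lborel_singleton[of M]], rule AE_I2, intro impI)
    fix r :: real assume "r \<noteq> M"
    have "r powr (1 - a) = r * r powr - a" if "0 < r"
      using that by (simp add: powr_diff powr_minus divide_inverse)
    then show "2 * pi * (indicator {0<..<M} r *\<^sub>R r powr (1 - a)) =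
     indicator {0<..} r * (2 * pi * r * (indicator {..M} r * r powr - a))"
      using \<open>r \<noteq> M\<close> by (auto simp: indicator_def)
  qed
  ultimately have "integrable lborel (\<lambda>r. indicator {0<..} r * (2 * pi * r * (indicator {..M} r * r powr - a)))"
    by (subst (asm) integrable_cong_AE) auto
  then show ?thesis
    by (subst integrable_radial_iff) auto
qed

text \<open>
Fubini's theorem in the plane with either coordinate as the inner variable.
\<close>

lemma distr_lborel_coordinates_plane:
  fixes j k :: 2
  assumes "j \<noteq> k"
  shows "distr (lborel \<Otimes>\<^sub>M lborel) borel (\<lambda>(s, y). s *\<^sub>R axis j 1 + y *\<^sub>R axis k (1::real))
    = (lborel :: (real^2) measure)"
proof (rule lborel_eqI[symmetric])
  have UNIV_jk: "UNIV = {j, k}"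
    using assms exhaust_2[of j] exhaust_2[of k] by (auto simp: UNIV_2)
  then have all_jk: "(\<forall>i. P i) \<longleftrightarrow> P j \<and> P k" for P
    by (metis UNIV_I empty_iff insert_iff)
  fix l u :: "real^2"
  assume lu: "\<And>b. b \<in> Basis \<Longrightarrow> l \<bullet> b \<le> u \<bullet> b"
  have le: "l $ i \<le> u $ i" for i
    using lu[of "axis i 1"] by (auto simp: inner_axis axis_in_Basis_iff)
  have *: "(\<lambda>(s, y). s *\<^sub>R axis j 1 + y *\<^sub>R axis k 1) -` box l u = {l $ j <..< u $ j} \<times> {l $ k <..< u $ k}"
    using assms by (auto simp: mem_box_cart axis_def all_jk)
  have [measurable]: "(\<lambda>(s, y). s *\<^sub>R axis j 1 + y *\<^sub>R axis k 1 :: real^2) \<in> borel_measurable (lborel \<Otimes>\<^sub>M lborel)"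
    by simp
  have "emeasure (distr (lborel \<Otimes>\<^sub>M lborel) borel (\<lambda>(s, y). s *\<^sub>R axis j 1 + y *\<^sub>R axis k (1::real))) (box l u)
     = ennreal (u $ j - l $ j) * ennreal (u $ k - l $ k)"
    using le by (simp add: emeasure_distr * space_pair_measure lborel.emeasure_pair_measure_Times)
  also have "\<dots> = ennreal (\<Prod>i\<in>UNIV. (u - l) $ i)"
    using assms le unfolding UNIV_jk by (simp add: ennreal_mult)
  also have "(\<Prod>i\<in>UNIV. (u - l) $ i) = (\<Prod>b\<in>Basis. (u - l) \<bullet> b)"
  proof -
    have B: "(Basis :: (real^2) set) = (\<lambda>i. axis i 1) ` UNIV"
      by (auto simp: Basis_vec_def)
    show ?thesis unfolding B
      by (subst prod.reindex) (auto simp: inj_on_def axis_eq_axis inner_axis)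
  qed
  finally show "emeasure (distr (lborel \<Otimes>\<^sub>M lborel) borel (\<lambda>(s, y). s *\<^sub>R axis j 1 + y *\<^sub>R axis k (1::real))) (box l u) = (\<Prod>b\<in>Basis. (u - l) \<bullet> b)" .
qed simp

text \<open>
On almost every line in direction \<open>j\<close>, namely on those that miss the origin, the fundamental theorem
of calculus applies with finitely many exceptional points, and \<open>F\<close> vanishes at both ends. So \<open>F\<close> may
be singular at the origin as long as the derivative is integrable.
\<close>

lemma integral_partial_derivative_eq_0:
  fixes F :: "real^2 \<Rightarrow> real" and F' :: "real^2 \<Rightarrow> real^2 \<Rightarrow> real" and j :: 2
  assumes cont: "continuous_on (- {0}) F"
    and supp: "\<And>x. norm x > M \<Longrightarrow> F x = 0"
    and der: "\<And>x. x \<notin> N \<Longrightarrow> x \<noteq> 0 \<Longrightarrow> (F has_derivative F' x) (at x)"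
    and thin: "\<And>x. finite {s. x + s *\<^sub>R axis j 1 \<in> N}"
    and int: "integrable lborel (\<lambda>x. F' x (axis j 1))"
  shows "(LINT x|lborel. F' x (axis j 1)) = 0"
proof -
  have "(1::2) \<noteq> 2" by simp
  then obtain k :: 2 where "j \<noteq> k" by metis
  define e where "e = (\<lambda>(s, y). s *\<^sub>R axis j 1 + y *\<^sub>R axis k 1 :: real^2)"
  define G where "G = (\<lambda>x. F' x (axis j 1))"
  have e: "distr (lborel \<Otimes>\<^sub>M lborel) borel e = lborel"
    unfolding e_def by (rule distr_lborel_coordinates_plane[OF \<open>j \<noteq> k\<close>])
  have [measurable]: "e \<in> borel_measurable (lborel \<Otimes>\<^sub>M lborel)"
    unfolding e_def by simp
  have int_G: "integrable lborel G" using int by (simp add: G_def)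
  then have [measurable]: "G \<in> borel_measurable borel" by auto
  have int_Ge: "integrable (lborel \<Otimes>\<^sub>M lborel) (\<lambda>z. G (e z))"
    using int_G unfolding e[symmetric] by (subst (asm) integrable_distr_eq) auto
  \<comment> \<open>Lines on which the slice is not integrable need no argument: there the integral is zero by convention.\<close>
  have line: "(LINT s|lborel. G (e (s, y))) = 0" if "y \<noteq> 0" for y
  proof (cases "integrable lborel (\<lambda>s. G (e (s, y)))")
    case True
    define a where "a = \<bar>M\<bar> + 1"
    define S where "S = {s. e (s, y) \<in> N}"
    have S: "finite S"
      using thin[of "y *\<^sub>R axis k 1"] by (simp add: S_def e_def add.commute)
    have nz: "e (s, y) \<noteq> 0" for s
      using \<open>y \<noteq> 0\<close> \<open>j \<noteq> k\<close> by (auto simp: e_def vec_eq_iff axis_def)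
    have big: "norm (e (s, y)) \<ge> \<bar>s\<bar>" for s
      using component_le_norm_cart[of "e (s, y)" j] \<open>j \<noteq> k\<close> by (simp add: e_def axis_def)
    have contl: "continuous_on UNIV (\<lambda>s. F (e (s, y)))"
      by (rule continuous_on_compose2[OF cont]) (use nz in \<open>auto simp: e_def intro!: continuous_intros\<close>)
    have derl: "((\<lambda>s. F (e (s, y))) has_vector_derivative G (e (s, y))) (at s)" if "s \<notin> S" for s
    proof -
      have "((\<lambda>s. e (s, y)) has_vector_derivative axis j 1) (at s)"
        unfolding e_def by (auto intro!: derivative_eq_intros simp: has_vector_derivative_def)
      moreover have "(F has_derivative F' (e (s, y))) (at (e (s, y)))"
        using der nz that by (simp add: S_def)
      ultimately show ?thesis
        using vector_derivative_diff_chain_within[of "\<lambda>s. e (s, y)" "axis j 1" s UNIV F "F' (e (s,y))"]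
        by (simp add: G_def o_def has_derivative_at_withinI)
    qed
    have zero: "G (e (s, y)) = 0" if "s \<notin> S" "s \<notin> {-a..a}" for s
    proof -
      have "((\<lambda>s. F (e (s, y))) has_vector_derivative 0) (at s)"
      proof (rule has_vector_derivative_transform_within_open[where f = "\<lambda>_. 0" and S = "- {-a..a}"])
        show "0 = F (e (t, y))" if "t \<in> - {-a..a}" for t
          using that big[of t] supp[of "e (t, y)"] by (auto simp: a_def)
      qed (use that in auto)
      with derl[OF \<open>s \<notin> S\<close>] show ?thesis
        using vector_derivative_unique_at by blast
    qed
    have "((\<lambda>s. G (e (s, y))) has_integral F (e (a, y)) - F (e (-a, y))) {-a..a}"
      by (rule fundamental_theorem_of_calculus_strong[OF S])
        (use derl contl in \<open>auto simp: a_def intro: continuous_on_subset\<close>)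
    moreover have "F (e (a, y)) = 0" "F (e (-a, y)) = 0"
      using big[of a] big[of "-a"] by (auto intro!: supp simp: a_def)
    ultimately have "((\<lambda>s. G (e (s, y))) has_integral 0) {-a..a}" by simp
    then have "((\<lambda>s. if s \<in> {-a..a} then G (e (s, y)) else 0) has_integral 0) UNIV"
      by (subst has_integral_restrict_UNIV)
    then have "((\<lambda>s. G (e (s, y))) has_integral 0) UNIV"
      by (rule has_integral_spike_finite[OF S, rotated]) (use zero in auto)
    with has_integral_integral_lborel[OF True] show ?thesis
      by (simp add: has_integral_unique)
  qed (rule not_integrable_integral_eq)
  have "(LINT x|lborel. G x) = (LINT z|(lborel \<Otimes>\<^sub>M lborel). G (e z))"
    by (subst e[symmetric], subst integral_distr) auto
  also have "\<dots> = (LINT y|lborel. LINT s|lborel. G (e (s, y)))"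
    using int_Ge lborel_pair.integral_snd[of "\<lambda>s y. G (e (s, y))"] by (simp add: case_prod_unfold)
  also have "\<dots> = 0"
    by (rule integral_eq_zero_AE, rule eventually_mono[OF AE_lborel_singleton[of 0]]) (rule line)
  finally show ?thesis by (simp add: G_def)
qed

section \<open>Integration by parts with a singularity at the origin\<close>

text \<open>
On a line, the equation of a sphere is a monic quadratic polynomial.
\<close>

lemma finite_line_Int_spheres:
  fixes x e :: "real^2"
  assumes "finite N" "norm e = 1"
  shows "finite {s. x + s *\<^sub>R e \<in> {y. norm y \<in> N}}"
proof -
  have "finite {s. norm (x + s *\<^sub>R e) = r}" for r
  proof -
    have sub: "{s. norm (x + s *\<^sub>R e) = r} \<subseteq> {s. poly [:(norm x)\<^sup>2 - r\<^sup>2, 2 * (x \<bullet> e), 1:] s = 0}"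
    proof (safe, simp)
      fix s
      show "(norm x)\<^sup>2 - (norm (x + s *\<^sub>R e))\<^sup>2 + s * (2 * (x \<bullet> e) + s) = 0"
        using assms(2) unfolding power2_norm_eq_inner
        by (simp add: inner_simps algebra_simps norm_eq_1 inner_commute)
    qed
    show ?thesis
      by (rule finite_subset[OF sub poly_roots_finite]) simp
  qed
  moreover have "{s. x + s *\<^sub>R e \<in> {y. norm y \<in> N}} = (\<Union>r\<in>N. {s. norm (x + s *\<^sub>R e) = r})"
    by auto
  ultimately show ?thesis using assms(1) by auto
qed

lemma C1_test_UNIV_bounds:
  fixes \<phi> :: "real^2 \<Rightarrow> 'b::euclidean_space"
  assumes "C1_test UNIV \<phi> D"
  obtains M L where "M > 0" "L > 0"
    "\<And>x. norm x > M \<Longrightarrow> \<phi> x = 0" "\<And>x. norm x > M \<Longrightarrow> D x = 0"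
    "\<And>x. norm (\<phi> x) \<le> L" "\<And>x. norm (D x) \<le> L" "\<And>x y. norm (\<phi> x - \<phi> y) \<le> L * norm (x - y)"
proof -
  from assms obtain K where der: "\<And>x. (\<phi> has_derivative blinfun_apply (D x)) (at x)"
    and cD: "continuous_on UNIV D" and K: "compact K" "\<And>x. x \<notin> K \<Longrightarrow> \<phi> x = 0"
    unfolding C1_test_def by auto
  have c\<phi>: "continuous_on UNIV \<phi>"
    using der by (auto intro!: continuous_at_imp_continuous_on has_derivative_continuous)
  obtain M where M: "M > 0" "\<And>x. x \<in> K \<Longrightarrow> norm x \<le> M"
    using compact_imp_bounded[OF K(1)] by (auto simp: bounded_pos)
  have \<phi>0: "\<phi> x = 0" if "norm x > M" for x
    using that M(2) K(2) by force
  have D0: "D x = 0" if "norm x > M" for x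
  proof -
    have "(\<phi> has_derivative (\<lambda>_. 0)) (at x)"
    proof (rule has_derivative_transform_within_open[where f = "\<lambda>_. 0" and s = "{y. M < norm y}"])
      show "open {y::real^2. M < norm y}"
        by (intro open_Collect_less continuous_intros)
    qed (use that \<phi>0 in auto)
    then have "blinfun_apply (D x) = (\<lambda>_. 0)"
      using der has_derivative_unique by blast
    then show ?thesis by (intro blinfun_eqI) simp
  qed
  have "compact (\<phi> ` cball 0 M)" "compact (D ` cball 0 M)"
    by (auto intro!: compact_continuous_image continuous_on_subset[OF c\<phi>] continuous_on_subset[OF cD])
  then obtain L1 L2 where L: "L1 > 0" "\<And>x. norm x \<le> M \<Longrightarrow> norm (\<phi> x) \<le> L1"
    "L2 > 0" "\<And>x. norm x \<le> M \<Longrightarrow> norm (D x) \<le> L2"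
    by (auto dest!: compact_imp_bounded simp: bounded_pos)
  define L where "L = max L1 L2"
  have n\<phi>: "norm (\<phi> x) \<le> L" for x
    using L \<phi>0 by (cases "norm x \<le> M") (auto simp: L_def le_max_iff_disj)
  have nD: "norm (D x) \<le> L" for x
    using L D0 by (cases "norm x \<le> M") (auto simp: L_def le_max_iff_disj)
  have "norm (\<phi> x - \<phi> y) \<le> L * norm (x - y)" for x y
    by (rule differentiable_bound[where S = UNIV and f' = "\<lambda>x. blinfun_apply (D x)"])
      (use der nD in \<open>auto simp: norm_blinfun.rep_eq[symmetric]\<close>)
  with that[of M L] M(1) L \<phi>0 D0 n\<phi> nD show thesis by (simp add: L_def)
qed

lemma borel_measurable_vec_nth [measurable (raw)]:
  fixes f :: "'a \<Rightarrow> real^'n"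
  shows "f \<in> borel_measurable M \<Longrightarrow> (\<lambda>x. f x $ i) \<in> borel_measurable M"
  by (rule measurable_compose[OF _ borel_measurable_continuous_onI])
    (auto intro: continuous_intros)

lemma C1_test_measurable:
  fixes \<phi> :: "real^2 \<Rightarrow> 'b::euclidean_space"
  assumes "C1_test UNIV \<phi> D"
  shows "\<phi> \<in> borel_measurable borel" "(\<lambda>x. blinfun_apply (D x) y) \<in> borel_measurable borel"
proof -
  have "continuous_on UNIV \<phi>" "continuous_on UNIV D"
    using assms by (auto simp: C1_test_def intro!: continuous_at_imp_continuous_on has_derivative_continuous)
  then show "\<phi> \<in> borel_measurable borel" "(\<lambda>x. blinfun_apply (D x) y) \<in> borel_measurable borel"
    by (auto intro!: borel_measurable_continuous_onI continuous_intros)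
qed

text \<open>
In the plane \<open>|x| powr (- a)\<close> is locally integrable exactly for \<open>a < 2\<close>; most integrability
claims below are reduced to this one.
\<close>

lemma integrable_norm_powr_bound:
  fixes f :: "real^2 \<Rightarrow> 'b::euclidean_space"
  assumes "a < 2" "0 < M" "f \<in> borel_measurable borel"
    and bound: "\<And>x. x \<noteq> 0 \<Longrightarrow> norm x \<le> M \<Longrightarrow> norm (f x) \<le> C * norm x powr (- a)"
    and supp: "\<And>x. norm x > M \<Longrightarrow> f x = 0"
  shows "integrable lborel f"
proof (rule Bochner_Integration.integrable_bound)
  show "integrable lborel (\<lambda>x::real^2. C * (indicator {..M} (norm x) * norm x powr (- a)))"
    using assms by (intro integrable_mult_right integrable_norm_powr) auto
  have "norm (f x) \<le> norm (C * (indicator {..M} (norm x) * norm x powr (- a)))" if "x \<noteq> 0" for x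
    using bound[OF that] supp[of x]
    by (cases "norm x \<le> M") (auto simp: indicator_def intro: order_trans[OF _ abs_ge_self])
  then show "AE x in lborel. norm (f x) \<le> norm (C * (indicator {..M} (norm x) * norm x powr (- a)))"
    using AE_lborel_singleton[of "0::real^2"] by (rule eventually_mono[rotated])
qed (use assms in simp)

text \<open>
The divergence theorem for \<open>h(|x|) P(x) \<phi>(x)\<close>, where \<open>h\<close> may be singular at \<open>0\<close> and has corners on
finitely many spheres. The divergence of \<open>h(|x|) P(x)\<close> is \<open>h'(r)/r x \<bullet> P + h(r) div P\<close>. The bounds
involve the products with \<open>\<phi>\<close>, so that a zero of \<open>\<phi>\<close> at the origin can compensate a singularity
of \<open>h\<close> or \<open>h'\<close>.
\<close>

lemma radial_integration_by_parts:
  fixes h h' :: "real \<Rightarrow> real" and P :: "real^2 \<Rightarrow> real^2" and P' :: "real^2 \<Rightarrow> real^2 \<Rightarrow> real^2"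
    and \<phi> :: "real^2 \<Rightarrow> real"
  assumes contr: "continuous_on {0<..} h"
    and derh: "\<And>r. r > 0 \<Longrightarrow> r \<notin> N \<Longrightarrow> (h has_real_derivative h' r) (at r)" and N: "finite N"
    and meas[measurable]: "h \<in> borel_measurable borel" "h' \<in> borel_measurable borel"
    and derP: "\<And>x. (P has_derivative P' x) (at x)"
    and measP'[measurable]: "\<And>j. (\<lambda>x. P' x (axis j 1)) \<in> borel_measurable borel"
    and test: "C1_test UNIV \<phi> D" and a: "a < 2"
    and b1: "\<And>x. x \<noteq> 0 \<Longrightarrow> \<bar>h (norm x)\<bar> * norm (P x) \<le> C * norm x powr (- a)"
    and b2: "\<And>x. x \<noteq> 0 \<Longrightarrow> \<bar>h' (norm x)\<bar> * norm (P x) * \<bar>\<phi> x\<bar> \<le> C * norm x powr (- a)"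
    and b3: "\<And>x j. x \<noteq> 0 \<Longrightarrow> \<bar>h (norm x)\<bar> * norm (P' x (axis j 1)) * \<bar>\<phi> x\<bar> \<le> C * norm x powr (- a)"
  shows "integrable lborel (\<lambda>x. h (norm x) * (\<Sum>j\<in>UNIV. P x $ j * D x (axis j 1)))" (is "?I1")
    and "integrable lborel (\<lambda>x. (h' (norm x) / norm x * (x \<bullet> P x)
            + h (norm x) * (\<Sum>j\<in>UNIV. P' x (axis j 1) $ j)) * \<phi> x)" (is "?I2")
    and "(LINT x|lborel. h (norm x) * (\<Sum>j\<in>UNIV. P x $ j * D x (axis j 1)))
       = - (LINT x|lborel. (h' (norm x) / norm x * (x \<bullet> P x)
            + h (norm x) * (\<Sum>j\<in>UNIV. P' x (axis j 1) $ j)) * \<phi> x)" (is "?eq")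
proof -
  note [measurable] = C1_test_measurable(1)[OF test]
  have [measurable]: "(\<lambda>x. blinfun_apply (D x) (axis j 1)) \<in> borel_measurable borel" for j
    by (rule C1_test_measurable(2)[OF test])
  have derphi: "\<And>x. (\<phi> has_derivative blinfun_apply (D x)) (at x)"
    using test by (auto simp: C1_test_def)
  have cP: "continuous_on UNIV P" and cphi: "continuous_on UNIV \<phi>"
    using derP derphi by (auto intro!: continuous_at_imp_continuous_on has_derivative_continuous)
  have [measurable]: "P \<in> borel_measurable borel"
    by (rule borel_measurable_continuous_onI[OF cP])
  from C1_test_UNIV_bounds[OF test] obtain M L where bd: "M > 0" "L > 0"
    "\<And>x. norm x > M \<Longrightarrow> \<phi> x = 0" "\<And>x. norm x > M \<Longrightarrow> D x = 0"
    "\<And>x. norm (\<phi> x) \<le> L" "\<And>x. norm (D x) \<le> L" by metis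
  define G1 where "G1 j x = h (norm x) * (P x $ j * D x (axis j 1))" for j x
  define G2 where "G2 j x = (h' (norm x) * (x $ j / norm x) * P x $ j + h (norm x) * P' x (axis j 1) $ j) * \<phi> x" for j x
  have i1: "integrable lborel (G1 j)" for j
  proof (rule integrable_norm_powr_bound[OF a bd(1)])
    show "norm (G1 j x) \<le> (C * L) * norm x powr (- a)" if "x \<noteq> 0" for x
    proof -
      have "norm (D x (axis j 1)) \<le> L"
        using norm_blinfun[of "D x" "axis j 1"] bd(6)[of x] by simp
      then have "\<bar>h (norm x)\<bar> * \<bar>P x $ j\<bar> * norm (D x (axis j 1)) \<le> \<bar>h (norm x)\<bar> * norm (P x) * L"
        by (intro mult_mono component_le_norm_cart) auto
      also have "\<dots> \<le> C * norm x powr (- a) * L"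
        by (intro mult_right_mono b1) (use that bd in auto)
      finally show ?thesis by (simp add: G1_def abs_mult mult_ac)
    qed
    show "G1 j \<in> borel_measurable borel" unfolding G1_def by measurable
  qed (simp add: G1_def bd)
  have i2: "integrable lborel (G2 j)" for j
  proof (rule integrable_norm_powr_bound[OF a bd(1)])
    show "norm (G2 j x) \<le> (C + C) * norm x powr (- a)" if "x \<noteq> 0" for x
    proof -
      have "\<bar>x $ j / norm x\<bar> \<le> 1"
        using component_le_norm_cart[of x j] that by simp
      then have "\<bar>h' (norm x)\<bar> * \<bar>x $ j / norm x\<bar> * \<bar>P x $ j\<bar> * \<bar>\<phi> x\<bar> \<le> \<bar>h' (norm x)\<bar> * 1 * norm (P x) * \<bar>\<phi> x\<bar>"
        by (intro mult_mono component_le_norm_cart) auto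
      also have "\<dots> \<le> C * norm x powr (- a)" using b2[OF that] by simp
      finally have 1: "\<bar>h' (norm x) * (x $ j / norm x) * P x $ j * \<phi> x\<bar> \<le> C * norm x powr (- a)"
        by (simp only: abs_mult)
      have "\<bar>h (norm x)\<bar> * \<bar>P' x (axis j 1) $ j\<bar> * \<bar>\<phi> x\<bar> \<le> \<bar>h (norm x)\<bar> * norm (P' x (axis j 1)) * \<bar>\<phi> x\<bar>"
        by (intro mult_mono component_le_norm_cart) auto
      also have "\<dots> \<le> C * norm x powr (- a)" by (rule b3[OF that])
      finally have 2: "\<bar>h (norm x) * P' x (axis j 1) $ j * \<phi> x\<bar> \<le> C * norm x powr (- a)"
        by (simp only: abs_mult)
      have "norm (G2 j x) \<le> C * norm x powr (- a) + C * norm x powr (- a)"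
        using abs_triangle_ineq add_mono[OF 1 2] unfolding G2_def real_norm_def distrib_right
        by (rule order_trans)
      then show ?thesis by (simp add: distrib_right)
    qed
    show "G2 j \<in> borel_measurable borel" unfolding G2_def by measurable
  qed (simp add: G2_def bd)
  have zero: "(LINT x|lborel. G1 j x + G2 j x) = 0" for j
  proof -
    define F where "F x = h (norm x) * P x $ j * \<phi> x" for x
    define F' where "F' x y = (h' (norm x) * ((x \<bullet> y) / norm x) * P x $ j + h (norm x) * P' x y $ j) * \<phi> x
      + h (norm x) * (P x $ j * D x y)" for x y
    have F': "F' x (axis j 1) = G1 j x + G2 j x" for x
      by (simp add: F'_def G1_def G2_def inner_axis)
    have "(LINT x|lborel. F' x (axis j 1)) = 0"
    proof (rule integral_partial_derivative_eq_0[where N = "{x. norm x \<in> N}" and F = F and M = M])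
      show "continuous_on (- {0}) F"
        unfolding F_def
        by (intro continuous_intros continuous_on_compose2[OF contr] continuous_on_subset[OF cP]
            continuous_on_subset[OF cphi]) auto
      show "(F has_derivative F' x) (at x)" if "x \<notin> {x. norm x \<in> N}" "x \<noteq> 0" for x
      proof -
        have "(h has_derivative (\<lambda>s. h' (norm x) * s)) (at (norm x))"
          using derh[of "norm x"] that by (simp add: has_field_derivative_def)
        from has_derivative_compose[OF has_derivative_norm[OF that(2)] this]
        have "((\<lambda>x. h (norm x)) has_derivative (\<lambda>y. h' (norm x) * (sgn x \<bullet> y))) (at x)"
          by (simp add: inner_commute)
        then have "((\<lambda>x. h (norm x) * (P x $ j) * \<phi> x) has_derivative
          (\<lambda>y. h (norm x) * P x $ j * D x y + (h (norm x) * P' x y $ j + h' (norm x) * (sgn x \<bullet> y) * P x $ j) * \<phi> x)) (at x)"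
          by (intro has_derivative_mult derphi bounded_linear.has_derivative[OF bounded_linear_vec_nth derP])
        moreover have "(\<lambda>y. h (norm x) * P x $ j * D x y + (h (norm x) * P' x y $ j + h' (norm x) * (sgn x \<bullet> y) * P x $ j) * \<phi> x) = F' x"
          by (rule ext) (simp add: F'_def sgn_div_norm divide_inverse algebra_simps)
        ultimately show ?thesis unfolding F_def by simp
      qed
      show "finite {s. x + s *\<^sub>R axis j 1 \<in> {x. norm x \<in> N}}" for x :: "real^2"
        by (rule finite_line_Int_spheres[OF N norm_axis_1])
      show "integrable lborel (\<lambda>x. F' x (axis j 1))"
        unfolding F' by (intro Bochner_Integration.integrable_add i1 i2)
    qed (simp add: F_def bd)
    then show ?thesis unfolding F' .
  qed
  have s1: "(\<lambda>x. h (norm x) * (\<Sum>j\<in>UNIV. P x $ j * D x (axis j 1))) = (\<lambda>x. \<Sum>j\<in>UNIV. G1 j x)"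
    by (simp add: G1_def sum_distrib_left)
  have s2: "(\<lambda>x. (h' (norm x) / norm x * (x \<bullet> P x)
            + h (norm x) * (\<Sum>j\<in>UNIV. P' x (axis j 1) $ j)) * \<phi> x) = (\<lambda>x. \<Sum>j\<in>UNIV. G2 j x)"
    by (simp add: G2_def sum_2 inner_vec_def algebra_simps)
  show ?I1 unfolding s1 by (intro Bochner_Integration.integrable_sum i1)
  show ?I2 unfolding s2 by (intro Bochner_Integration.integrable_sum i2)
  show ?eq
    unfolding s1 s2 using zero[of 1] zero[of 2] i1 i2
    by (simp add: Bochner_Integration.integral_sum Bochner_Integration.integral_add sum_2)
qed

section \<open>Momentum balance of radial fields at a fixed time\<close>

lemma perp_nth [simp]: "perp x $ 1 = - x $ 2" "perp x $ 2 = x $ 1"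
  by (simp_all add: perp_def)

lemma bounded_linear_perp: "bounded_linear perp"
  unfolding linear_conv_bounded_linear[symmetric]
  by (intro linearI) (simp_all add: vec_eq_iff forall_2)

lemma perp_minus [simp]: "perp (- x) = - perp x"
  by (simp add: vec_eq_iff forall_2)

lemma perp_zero [simp]: "perp 0 = 0"
  by (simp add: vec_eq_iff forall_2)

lemma norm_perp [simp]: "norm (perp x) = norm x"
  by (simp add: norm_eq_sqrt_inner inner_vec_def sum_2)

lemma perp_inner_self [simp]: "x \<bullet> perp x = 0" "perp x \<bullet> x = 0"
  by (simp_all add: inner_vec_def sum_2)

lemma norm_sq_2: "(norm (x::real^2))\<^sup>2 = (x $ 1)\<^sup>2 + (x $ 2)\<^sup>2"
  unfolding power2_norm_eq_inner by (simp add: inner_vec_def sum_2 power2_eq_square)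

lemma perp_axis [simp]: "perp (axis 1 1) = axis 2 1" "perp (axis 2 1) = - axis 1 1"
  by (auto simp add: vec_eq_iff forall_2 axis_def)

lemma continuous_on_perp [continuous_intros]:
  "continuous_on S f \<Longrightarrow> continuous_on S (\<lambda>x. perp (f x))"
  by (rule bounded_linear.continuous_on[OF bounded_linear_perp])

lemma borel_measurable_perp [measurable (raw)]:
  "f \<in> borel_measurable M \<Longrightarrow> (\<lambda>x. perp (f x)) \<in> borel_measurable M"
  by (rule measurable_compose[OF _ borel_measurable_continuous_onI])
    (auto intro: continuous_intros)

lemma integral_reflect_lborel:
  fixes f :: "'a::euclidean_space \<Rightarrow> real"
  assumes [measurable]: "f \<in> borel_measurable borel"
  shows "(LINT x|lborel. f (- x)) = (LINT x|lborel. f x)"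
    and "integrable lborel (\<lambda>x. f (- x)) \<longleftrightarrow> integrable lborel f"
proof -
  have *: "distr lborel borel (\<lambda>x::'a. - x) = lborel"
    using lborel_affine[of "-1" "0::'a"] by (simp add: density_1)
  show "(LINT x|lborel. f (- x)) = (LINT x|lborel. f x)"
    by (subst (2) *[symmetric], subst integral_distr) auto
  show "integrable lborel (\<lambda>x. f (- x)) \<longleftrightarrow> integrable lborel f"
    by (subst (2) *[symmetric], subst integrable_distr_eq) auto
qed

text \<open>
The field \<open>x\<^sup>\<bottom>\<close> is divergence-free and orthogonal to \<open>x\<close>, so both source terms of the integration
by parts vanish.
\<close>

lemma radial_vortex_weakly_div_free:
  fixes g g' :: "real \<Rightarrow> real"
  assumes "continuous_on {0<..} g"
    and "\<And>r. r > 0 \<Longrightarrow> r \<notin> N \<Longrightarrow> (g has_real_derivative g' r) (at r)" and "finite N"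
    and "g \<in> borel_measurable borel" "g' \<in> borel_measurable borel" and "a < 2"
    and b: "\<And>r. r > 0 \<Longrightarrow> \<bar>g r\<bar> * r \<le> C * r powr (- a)"
      "\<And>r. r > 0 \<Longrightarrow> \<bar>g' r\<bar> * r \<le> C * r powr (- a)"
      "\<And>r. r > 0 \<Longrightarrow> \<bar>g r\<bar> \<le> C * r powr (- a)"
  shows "weakly_div_free (\<lambda>x. g (norm x) *\<^sub>R perp x)"
  unfolding weakly_div_free_def
proof (intro allI impI)
  fix \<phi> :: "real^2 \<Rightarrow> real" and D assume test: "C1_test UNIV \<phi> D"
  obtain L where L: "L > 0" "\<And>x. \<bar>\<phi> x\<bar> \<le> L"
    using C1_test_UNIV_bounds[OF test] by (metis real_norm_def)
  have C: "C \<ge> 0"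
    using b(3)[of 1] by simp
  have K: "C * x \<le> C * (1 + L) * x" "C * x * L \<le> C * (1 + L) * x" if "x \<ge> 0" for x
    using C L that by (auto simp: algebra_simps)
  have "(LINT x|lborel. g (norm x) * (\<Sum>j\<in>UNIV. perp x $ j * D x (axis j 1)))
       = - (LINT x|lborel. (g' (norm x) / norm x * (x \<bullet> perp x)
            + g (norm x) * (\<Sum>j\<in>UNIV. perp (axis j 1) $ j)) * \<phi> x)"
  proof (rule radial_integration_by_parts(3)[where N = N and a = a and C = "C * (1 + L)"])
    show "(perp has_derivative perp) (at x)" for x
      by (rule bounded_linear_imp_has_derivative[OF bounded_linear_perp])
    show "\<bar>g (norm x)\<bar> * norm (perp x) \<le> C * (1 + L) * norm x powr - a" if "x \<noteq> 0" for x
      using order_trans[OF b(1) K(1)] that by simp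
    show "\<bar>g' (norm x)\<bar> * norm (perp x) * \<bar>\<phi> x\<bar> \<le> C * (1 + L) * norm x powr - a" if "x \<noteq> 0" for x
      using mult_mono[OF b(2)[of "norm x"] L(2)[of x]] order_trans[OF _ K(2)] that C by simp
    show "\<bar>g (norm x)\<bar> * norm (perp (axis j 1)) * \<bar>\<phi> x\<bar> \<le> C * (1 + L) * norm x powr - a" if "x \<noteq> 0" for x j
      using mult_mono[OF b(3)[of "norm x"] L(2)[of x]] order_trans[OF _ K(2)] that C by simp
  qed (use assms test in auto)
  also have "\<dots> = 0" by (simp add: sum_2 axis_def)
  finally show "(LINT x|lborel. (\<Sum>i\<in>UNIV. (g (norm x) *\<^sub>R perp x) $ i * blinfun_apply (D x) (axis i 1))) = 0"
    by (simp add: sum_distrib_left mult_ac)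
qed

text \<open>
Against a field that is even in \<open>x\<close>, the derivatives of \<open>\<phi>\<close> may be replaced by those of its odd
part. The odd part vanishes at the origin and is therefore bounded by a multiple of \<open>|x|\<close>.
\<close>

lemma C1_test_odd_part:
  fixes \<phi> :: "real^2 \<Rightarrow> real"
  assumes "C1_test UNIV \<phi> D"
  shows "C1_test UNIV (\<lambda>x. (\<phi> x - \<phi> (- x)) / 2) (\<lambda>x. (1/2) *\<^sub>R (D x + D (- x)))"
proof -
  from assms obtain K where der: "\<And>x. (\<phi> has_derivative blinfun_apply (D x)) (at x)"
    and cD: "continuous_on UNIV D" and K: "compact K" "\<And>x. x \<notin> K \<Longrightarrow> \<phi> x = 0"
    unfolding C1_test_def by auto
  have "((\<lambda>x. \<phi> (- x)) has_derivative (\<lambda>y. - D (- x) y)) (at x)" for x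
    using has_derivative_compose[OF has_derivative_minus[OF has_derivative_ident] der, of x UNIV]
    by (simp add: blinfun.minus_right)
  then have "((\<lambda>x. (1/2) *\<^sub>R (\<phi> x - \<phi> (- x))) has_derivative (\<lambda>y. (1/2) *\<^sub>R (D x y - - D (- x) y))) (at x)" for x
    by (intro has_derivative_scaleR_right has_derivative_diff der)
  moreover have "(\<lambda>y. (1/2) *\<^sub>R (D x y - - D (- x) y)) = blinfun_apply ((1/2) *\<^sub>R (D x + D (- x)))" for x
    by (rule ext) (simp add: blinfun.bilinear_simps)
  moreover have "(\<lambda>x. (1/2) *\<^sub>R (\<phi> x - \<phi> (- x))) = (\<lambda>x. (\<phi> x - \<phi> (- x)) / 2)"
    by (rule ext) simp
  moreover have "continuous_on UNIV (\<lambda>x. (1/2) *\<^sub>R (D x + D (- x)))"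
    by (intro continuous_intros continuous_on_compose2[OF cD]) auto
  moreover have "compact (K \<union> uminus ` K)"
    using K(1) by (auto intro!: compact_Un compact_continuous_image continuous_intros)
  moreover have "\<forall>x\<in>UNIV - (K \<union> uminus ` K). (\<phi> x - \<phi> (- x)) / 2 = 0"
  proof
    fix x assume x: "x \<in> UNIV - (K \<union> uminus ` K)"
    then have "- x \<notin> K" by (metis DiffD2 UnI2 imageI minus_minus)
    with x K(2) show "(\<phi> x - \<phi> (- x)) / 2 = 0" by simp
  qed
  ultimately show ?thesis
    unfolding C1_test_def by (auto intro!: exI[of _ "K \<union> uminus ` K"])
qed

text \<open>
Row \<open>i\<close> of the momentum flux \<open>k x\<^sup>\<bottom> \<otimes> x\<^sup>\<bottom> + b (x \<otimes> x\<^sup>\<bottom> + x\<^sup>\<bottom> \<otimes> x) + p I\<close>, where \<open>k = g\<^sup>2\<close> for the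
velocity \<open>g x\<^sup>\<bottom>\<close>.
\<close>

definition radial_stress_row ::
  "(real \<Rightarrow> real) \<Rightarrow> (real \<Rightarrow> real) \<Rightarrow> (real \<Rightarrow> real) \<Rightarrow> 2 \<Rightarrow> real^2 \<Rightarrow> real^2" where
  "radial_stress_row k b p i x = (k (norm x) * perp x $ i) *\<^sub>R perp x
     + b (norm x) *\<^sub>R (x $ i *\<^sub>R perp x + perp x $ i *\<^sub>R x) + p (norm x) *\<^sub>R axis i 1"

text \<open>
The three terms of the flux have the divergences \<open>- k x\<close>, \<open>(r b' + 4 b) x\<^sup>\<bottom>\<close> and \<open>(p'/r) x\<close>, and the
first cancels the third by \<open>p' = r k\<close>. The flux is bounded by \<open>r powr (- a)\<close>, but its gradient only
by \<open>r powr (- a - 1)\<close>, which is integrable only for \<open>a < 1\<close>. The integrations by parts are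
therefore done for the odd part of \<open>\<phi>\<close>, which is \<open>O(r)\<close>, and reflection symmetry transfers the result
to \<open>\<phi>\<close>.
\<close>

lemma radial_stress_balance:
  fixes k k' b b' p :: "real \<Rightarrow> real" and \<phi> :: "real^2 \<Rightarrow> real"
  assumes cont: "continuous_on {0<..} k" "continuous_on {0<..} b" "continuous_on {0<..} p"
    and der: "\<And>r. r > 0 \<Longrightarrow> r \<notin> N \<Longrightarrow> (k has_real_derivative k' r) (at r)"
      "\<And>r. r > 0 \<Longrightarrow> r \<notin> N \<Longrightarrow> (b has_real_derivative b' r) (at r)"
      "\<And>r. r > 0 \<Longrightarrow> r \<notin> N \<Longrightarrow> (p has_real_derivative r * k r) (at r)"
    and N: "finite N"
    and meas[measurable]: "k \<in> borel_measurable borel" "k' \<in> borel_measurable borel"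
      "b \<in> borel_measurable borel" "b' \<in> borel_measurable borel" "p \<in> borel_measurable borel"
    and a: "a < 2"
    and bd: "\<And>r. r > 0 \<Longrightarrow> \<bar>k r\<bar> * r\<^sup>2 \<le> C * r powr (- a)"
      "\<And>r. r > 0 \<Longrightarrow> \<bar>k' r\<bar> * r ^ 3 \<le> C * r powr (- a)"
      "\<And>r. r > 0 \<Longrightarrow> \<bar>b r\<bar> * r\<^sup>2 \<le> C * r powr (- a)"
      "\<And>r. r > 0 \<Longrightarrow> \<bar>b' r\<bar> * r ^ 3 \<le> C * r powr (- a)"
      "\<And>r. r > 0 \<Longrightarrow> \<bar>p r\<bar> \<le> C * r powr (- a)"
      "\<And>r. r > 0 \<Longrightarrow> \<bar>r * b' r + 4 * b r\<bar> * r \<le> C * r powr (- a)"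
    and test: "C1_test UNIV \<phi> D"
  shows "integrable lborel (\<lambda>x. radial_stress_row k b p i x \<bullet> (\<chi> j. D x (axis j 1)))" (is "?flux")
    and "integrable lborel (\<lambda>x. (norm x * b' (norm x) + 4 * b (norm x)) * perp x $ i * \<phi> x)" (is "?source")
    and "(LINT x|lborel. radial_stress_row k b p i x \<bullet> (\<chi> j. D x (axis j 1)))
       = - (LINT x|lborel. (norm x * b' (norm x) + 4 * b (norm x)) * perp x $ i * \<phi> x)" (is "?balance")
proof -
  define \<psi> where "\<psi> x = (\<phi> x - \<phi> (- x)) / 2" for x
  define D\<psi> where "D\<psi> x = (1/2) *\<^sub>R (D x + D (- x))" for x
  have odd: "C1_test UNIV \<psi> D\<psi>"
    unfolding \<psi>_def D\<psi>_def by (rule C1_test_odd_part[OF test])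
  note [measurable] = C1_test_measurable(1)[OF test] C1_test_measurable(1)[OF odd]
  have mD[measurable]: "(\<lambda>x. blinfun_apply (D x) (axis j 1)) \<in> borel_measurable borel" for j
    by (rule C1_test_measurable(2)[OF test])
  obtain M L where L: "M > 0" "L > 0" "\<And>x. norm x > M \<Longrightarrow> \<phi> x = 0" "\<And>x. norm x > M \<Longrightarrow> D x = 0"
    "\<And>x. \<bar>\<phi> x\<bar> \<le> L" "\<And>x. norm (D x) \<le> L" "\<And>x y. \<bar>\<phi> x - \<phi> y\<bar> \<le> L * norm (x - y)"
    using C1_test_UNIV_bounds[OF test] by (metis real_norm_def)
  have \<psi>: "\<bar>\<psi> x\<bar> \<le> L * norm x" for x
  proof -
    have "x - - x = 2 *\<^sub>R x" by (simp add: scaleR_2)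
    then have "norm (x - - x) = 2 * norm x" by (metis norm_scaleR abs_numeral)
    then show ?thesis using L(7)[of x "- x"] by (simp add: \<psi>_def)
  qed
  have C: "C \<ge> 0"
    using order_trans[OF abs_ge_zero bd(5)[of 1]] by simp
  \<comment> \<open>The constant \<open>4\<close> covers the quadratic field \<open>P2\<close>, the largest of the three, and its gradient.\<close>
  have K: "n * m * f \<le> 4 * C * (1 + L) * r powr (- a)"
    if "0 \<le> n" "0 \<le> f" "0 \<le> w" "m \<le> 4 * w" "f \<le> L * r" "n * (w * r) \<le> C * r powr (- a)" "0 < r" for n m f w r :: real
  proof -
    have "n * m * f \<le> n * (4 * w) * (L * r)"
      by (rule mult_mono[OF mult_left_mono]) (use that in auto)
    also have "\<dots> = 4 * L * (n * (w * r))" by simp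
    also have "\<dots> \<le> 4 * L * (C * r powr (- a))"
      using that L by (intro mult_left_mono) auto
    also have "\<dots> \<le> 4 * C * (1 + L) * r powr (- a)"
      using C by (simp add: algebra_simps)
    finally show ?thesis .
  qed
  have K1: "n * m \<le> 4 * C * (1 + L) * r powr (- a)"
    if "0 \<le> n" "m \<le> 4 * w" "n * w \<le> C * r powr (- a)" for n m w r :: real
  proof -
    have "n * m \<le> 4 * (n * w)"
      using mult_left_mono[OF that(2,1)] by simp
    also have "\<dots> \<le> 4 * (C * r powr (- a))" using that by simp
    also have "\<dots> \<le> 4 * C * (1 + L) * r powr (- a)"
      using C L by (simp add: algebra_simps)
    finally show ?thesis .
  qed
  have nth: "\<bar>x $ j\<bar> \<le> norm x" "\<bar>perp x $ j\<bar> \<le> norm x" for x :: "real^2" and j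
    using component_le_norm_cart[of x j] component_le_norm_cart[of "perp x" j] by auto
  have n2: "norm (u *\<^sub>R v) \<le> r * s" if "\<bar>u\<bar> \<le> r" "norm v \<le> s" for u r s and v :: "real^2"
    using that by (auto intro!: mult_mono order_trans[OF abs_ge_zero that(1)])
  have n2': "norm (u *\<^sub>R v) \<le> r" if "\<bar>u\<bar> \<le> r" "norm v \<le> 1" for u r and v :: "real^2"
    using n2[OF that] by simp
  have n2'': "norm (u *\<^sub>R v) \<le> r" if "\<bar>u\<bar> \<le> 1" "norm v \<le> r" for u r and v :: "real^2"
    using n2[OF that] by simp
  have ax: "\<bar>axis j 1 $ i\<bar> \<le> (1::real)" "\<bar>perp (axis j 1) $ i\<bar> \<le> (1::real)" for j :: 2
    using nth[of "axis j 1" i] by (auto simp del: perp_axis)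
  define P1 where "P1 x = perp x $ i *\<^sub>R perp x" for x
  define P1' where "P1' x y = perp x $ i *\<^sub>R perp y + perp y $ i *\<^sub>R perp x" for x y
  define P2 where "P2 x = x $ i *\<^sub>R perp x + perp x $ i *\<^sub>R x" for x
  define P2' where "P2' x y = (x $ i *\<^sub>R perp y + y $ i *\<^sub>R perp x) + (perp x $ i *\<^sub>R y + perp y $ i *\<^sub>R x)" for x y
  have nP1: "norm (P1 x) \<le> 4 * (norm x)\<^sup>2" for x
  proof -
    have "norm (P1 x) \<le> norm x * norm x"
      unfolding P1_def by (rule n2[OF nth(2)]) simp
    also have "\<dots> \<le> 4 * (norm x)\<^sup>2" by (simp add: power2_eq_square)
    finally show ?thesis .
  qed
  have nP2: "norm (P2 x) \<le> 4 * (norm x)\<^sup>2" for x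
  proof -
    have "norm (P2 x) \<le> norm x * norm x + norm x * norm x"
      unfolding P2_def by (rule norm_triangle_mono[OF n2[OF nth(1)] n2[OF nth(2)]]) simp_all
    also have "\<dots> \<le> 4 * (norm x)\<^sup>2" by (simp add: power2_eq_square)
    finally show ?thesis .
  qed
  have nP1': "norm (P1' x (axis j 1)) \<le> 4 * norm x" for x j
  proof -
    have "norm (P1' x (axis j 1)) \<le> norm x + norm x"
      unfolding P1'_def by (rule norm_triangle_mono[OF n2'[OF nth(2)] n2''[OF ax(2)]]) simp_all
    then show ?thesis using norm_ge_zero[of x] by linarith
  qed
  have nP2': "norm (P2' x (axis j 1)) \<le> 4 * norm x" for x j
  proof -
    have "norm (P2' x (axis j 1)) \<le> (norm x + norm x) + (norm x + norm x)"
      unfolding P2'_def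
      by (rule norm_triangle_mono[OF norm_triangle_mono[OF n2'[OF nth(1)] n2''[OF ax(1)]]
            norm_triangle_mono[OF n2'[OF nth(2)] n2''[OF ax(2)]]]) simp_all
    then show ?thesis by linarith
  qed
  have dperp: "(perp has_derivative perp) (at x)" for x
    by (rule bounded_linear_imp_has_derivative[OF bounded_linear_perp])
  have dnth: "((\<lambda>x. x $ i) has_derivative (\<lambda>y. y $ i)) (at x)" for x :: "real^2"
    by (rule bounded_linear_imp_has_derivative[OF bounded_linear_vec_nth])
  have dpnth: "((\<lambda>x. perp x $ i) has_derivative (\<lambda>y. perp y $ i)) (at x)" for x
    by (rule bounded_linear.has_derivative[OF bounded_linear_vec_nth dperp])
  have dP1: "(P1 has_derivative P1' x) (at x)" for x
    unfolding P1_def P1'_def by (rule has_derivative_scaleR[OF dpnth dperp])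
  have dP2: "(P2 has_derivative P2' x) (at x)" for x
    unfolding P2_def P2'_def
    by (intro has_derivative_add has_derivative_scaleR[OF dnth dperp] has_derivative_scaleR[OF dpnth has_derivative_ident])
  have mP1: "(\<lambda>x. P1' x (axis j 1)) \<in> borel_measurable borel"
    and mP2: "(\<lambda>x. P2' x (axis j 1)) \<in> borel_measurable borel" for j
    unfolding P1'_def P2'_def by measurable
  let ?K = "4 * C * (1 + L)"
  have 1: "(\<Sum>j\<in>UNIV. P1' x (axis j 1) $ j) = - x $ i" "x \<bullet> P1 x = 0" for x
    using exhaust_2[of i] by (auto simp: P1_def P1'_def sum_2 axis_def)
  have 2: "(\<Sum>j\<in>UNIV. P2' x (axis j 1) $ j) = 4 * perp x $ i" "x \<bullet> P2 x = (norm x)\<^sup>2 * perp x $ i" for x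
    using exhaust_2[of i] by (auto simp: P2_def P2'_def sum_2 axis_def inner_add_right power2_norm_eq_inner)
  note I1 = radial_integration_by_parts[OF cont(1) der(1) N meas(1,2) dP1 _ odd a, of ?K, unfolded 1]
  note I2 = radial_integration_by_parts[OF cont(2) der(2) N meas(3,4) dP2 _ odd a, of ?K, unfolded 2]
  note I3 = radial_integration_by_parts[OF cont(3) der(3) N meas(5) _ has_derivative_const[of "axis i 1"] _ odd a, of ?K]
  have A1: "\<bar>k (norm x)\<bar> * norm (P1 x) \<le> ?K * norm x powr - a"
    "\<bar>k' (norm x)\<bar> * norm (P1 x) * \<bar>\<psi> x\<bar> \<le> ?K * norm x powr - a"
    "\<bar>k (norm x)\<bar> * norm (P1' x (axis j 1)) * \<bar>\<psi> x\<bar> \<le> ?K * norm x powr - a" if "x \<noteq> 0" for x j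
    using bd(1,2)[of "norm x"] that
    by (auto intro!: K1[OF _ nP1] K[OF _ _ _ nP1 \<psi>] K[OF _ _ _ nP1' \<psi>] simp: power2_eq_square power3_eq_cube)
  have A2: "\<bar>b (norm x)\<bar> * norm (P2 x) \<le> ?K * norm x powr - a"
    "\<bar>b' (norm x)\<bar> * norm (P2 x) * \<bar>\<psi> x\<bar> \<le> ?K * norm x powr - a"
    "\<bar>b (norm x)\<bar> * norm (P2' x (axis j 1)) * \<bar>\<psi> x\<bar> \<le> ?K * norm x powr - a" if "x \<noteq> 0" for x j
    using bd(3,4)[of "norm x"] that
    by (auto intro!: K1[OF _ nP2] K[OF _ _ _ nP2 \<psi>] K[OF _ _ _ nP2' \<psi>] simp: power2_eq_square power3_eq_cube)
  have A3: "\<bar>p (norm x)\<bar> * norm (axis i 1 :: real^2) \<le> ?K * norm x powr - a"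
    "\<bar>norm x * k (norm x)\<bar> * norm (axis i 1 :: real^2) * \<bar>\<psi> x\<bar> \<le> ?K * norm x powr - a"
    "\<bar>p (norm x)\<bar> * norm (0 :: real^2) * \<bar>\<psi> x\<bar> \<le> ?K * norm x powr - a" if "x \<noteq> 0" for x
    using K1[where n = "\<bar>p (norm x)\<bar>" and m = 1 and w = 1 and r = "norm x"]
      K[where n = "\<bar>norm x * k (norm x)\<bar>" and m = 1 and w = 1 and r = "norm x" and f = "\<bar>\<psi> x\<bar>"]
      bd(1,5)[of "norm x"] that C L \<psi>[of x]
    by (simp_all add: power2_eq_square abs_mult mult_ac)
  have mk: "(\<lambda>r. r * k r) \<in> borel_measurable borel" by measurable
  have mP3: "(\<lambda>x::real^2. 0::real^2) \<in> borel_measurable borel" by measurable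
  note J1 = I1[OF _ _ mP1 A1, simplified] and J2 = I2[OF _ _ mP2 A2, simplified]
    and J3 = I3[OF _ _ mk mP3 A3, simplified]
  define row where "row = radial_stress_row k b p i"
  have row: "(\<lambda>x. row x \<bullet> (\<chi> j. D\<psi> x (axis j 1))) = (\<lambda>x. k (norm x) * (\<Sum>j\<in>UNIV. P1 x $ j * D\<psi> x (axis j 1))
      + b (norm x) * (\<Sum>j\<in>UNIV. P2 x $ j * D\<psi> x (axis j 1)) + p (norm x) * (\<Sum>j\<in>UNIV. axis i 1 $ j * D\<psi> x (axis j 1)))"
    by (simp add: row_def radial_stress_row_def P1_def P2_def inner_vec_def sum_2 fun_eq_iff algebra_simps)
  define W where "W x = (norm x * b' (norm x) + 4 * b (norm x)) * perp x $ i" for x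
  have [measurable]: "W \<in> borel_measurable borel" "row \<in> borel_measurable borel"
    unfolding W_def row_def radial_stress_row_def by measurable
  \<comment> \<open>For the odd part, the terms \<open>- k x\<close> and \<open>(p'/r) x\<close> cancel pointwise.\<close>
  have src: "(LINT x|lborel. row x \<bullet> (\<chi> j. D\<psi> x (axis j 1))) = - (LINT x|lborel. W x * \<psi> x)"
  proof -
    have "(LINT x|lborel. row x \<bullet> (\<chi> j. D\<psi> x (axis j 1))) =
       - ((LINT x|lborel. k (norm x) * (- x $ i) * \<psi> x)
       + (LINT x|lborel. (b' (norm x) / norm x * ((norm x)\<^sup>2 * perp x $ i) + b (norm x) * (4 * perp x $ i)) * \<psi> x)
       + (LINT x|lborel. (norm x * k (norm x)) / norm x * (x $ i) * \<psi> x))"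
      unfolding row using J1 J2 J3 by (simp add: inner_axis del: perp_nth)
    also have "\<dots> = - (LINT x|lborel. k (norm x) * (- x $ i) * \<psi> x +
       (b' (norm x) / norm x * ((norm x)\<^sup>2 * perp x $ i) + b (norm x) * (4 * perp x $ i)) * \<psi> x +
       (norm x * k (norm x)) / norm x * (x $ i) * \<psi> x)"
      using J1 J2 J3 by (simp add: inner_axis del: perp_nth)
    also have "(\<lambda>x. k (norm x) * (- x $ i) * \<psi> x +
       (b' (norm x) / norm x * ((norm x)\<^sup>2 * perp x $ i) + b (norm x) * (4 * perp x $ i)) * \<psi> x +
       (norm x * k (norm x)) / norm x * (x $ i) * \<psi> x) = (\<lambda>x. W x * \<psi> x)"
    proof
      fix x show "k (norm x) * (- x $ i) * \<psi> x +
       (b' (norm x) / norm x * ((norm x)\<^sup>2 * perp x $ i) + b (norm x) * (4 * perp x $ i)) * \<psi> x +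
       (norm x * k (norm x)) / norm x * (x $ i) * \<psi> x = W x * \<psi> x"
        by (cases "x = 0") (simp_all add: W_def power2_eq_square algebra_simps del: perp_nth)
    qed
    finally show ?thesis .
  qed
  have nrow: "norm (row x) \<le> (4 * C) * norm x powr (- a)" if "x \<noteq> 0" for x
  proof -
    have "norm ((k (norm x) * perp x $ i) *\<^sub>R perp x) \<le> (\<bar>k (norm x)\<bar> * norm x) * norm x"
      by (intro n2) (auto simp: abs_mult intro!: mult_left_mono nth)
    also have "\<dots> \<le> C * norm x powr (- a)"
      using bd(1)[of "norm x"] that by (simp add: power2_eq_square mult_ac)
    finally have i: "norm ((k (norm x) * perp x $ i) *\<^sub>R perp x) \<le> C * norm x powr (- a)" .
    have "norm (b (norm x) *\<^sub>R (x $ i *\<^sub>R perp x + perp x $ i *\<^sub>R x))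
        \<le> \<bar>b (norm x)\<bar> * (norm x * norm x + norm x * norm x)"
      by (intro n2 norm_triangle_mono nth) auto
    also have "\<dots> \<le> 2 * (C * norm x powr (- a))"
      using bd(3)[of "norm x"] that by (simp add: power2_eq_square mult_ac)
    finally have ii: "norm (b (norm x) *\<^sub>R (x $ i *\<^sub>R perp x + perp x $ i *\<^sub>R x)) \<le> 2 * (C * norm x powr (- a))" .
    have iii: "norm (p (norm x) *\<^sub>R (axis i 1 :: real^2)) \<le> C * norm x powr (- a)"
      using bd(5)[of "norm x"] that by simp
    from norm_triangle_mono[OF norm_triangle_mono[OF i ii] iii] show ?thesis
      unfolding row_def radial_stress_row_def by simp
  qed
  have grad: "norm (\<chi> j. D x (axis j 1)) \<le> 2 * L" for x
  proof -
    have "\<bar>D x (axis j 1)\<bar> \<le> L" for j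
      using order_trans[OF norm_blinfun[of "D x" "axis j 1"]] L(6)[of x] by simp
    from add_mono[OF this[of 1] this[of 2]] have "(\<Sum>j\<in>UNIV. \<bar>D x (axis j 1)\<bar>) \<le> L + L"
      by (simp add: sum_2)
    then show ?thesis
      using norm_le_l1_cart[of "\<chi> j. D x (axis j 1)"] by simp
  qed
  have [measurable]: "(\<lambda>x. row x \<bullet> (\<chi> j. D x (axis j 1))) \<in> borel_measurable borel"
    unfolding inner_vec_def by simp
  have int: "integrable lborel (\<lambda>x. row x \<bullet> (\<chi> j. D x (axis j 1)))"
  proof (rule integrable_norm_powr_bound[OF a L(1)])
    show "norm (row x \<bullet> (\<chi> j. D x (axis j 1))) \<le> (4 * C * (2 * L)) * norm x powr - a" if "x \<noteq> 0" for x
      using order_trans[OF Cauchy_Schwarz_ineq2 mult_mono[OF nrow[OF that] grad]] C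
      by (simp add: mult_ac)
    show "row x \<bullet> (\<chi> j. D x (axis j 1)) = 0" if "norm x > M" for x
      using L(4)[OF that] by (simp add: inner_vec_def)
  qed simp
  have intW: "integrable lborel (\<lambda>x. W x * \<phi> x)"
  proof (rule integrable_norm_powr_bound[OF a L(1)])
    show "norm (W x * \<phi> x) \<le> (C * L) * norm x powr - a" if "x \<noteq> 0" for x
    proof -
      have "\<bar>W x\<bar> \<le> \<bar>norm x * b' (norm x) + 4 * b (norm x)\<bar> * norm x"
        unfolding W_def abs_mult by (intro mult_left_mono nth) auto
      also have "\<dots> \<le> C * norm x powr - a" using bd(6)[of "norm x"] that by simp
      finally have "\<bar>W x\<bar> * \<bar>\<phi> x\<bar> \<le> (C * norm x powr - a) * L"
        using C L by (intro mult_mono) auto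
      then show ?thesis by (simp add: abs_mult mult_ac)
    qed
  qed (use L in auto)
  \<comment> \<open>Reflection symmetry replaces the odd part by \<open>\<phi>\<close> on both sides.\<close>
  have row_even: "row (- x) = row x" and W_odd: "W (- x) = - W x" for x
    by (simp_all add: row_def radial_stress_row_def W_def scaleR_minus_right del: perp_nth)
  have "(LINT x|lborel. row x \<bullet> (\<chi> j. D (- x) (axis j 1))) = (LINT x|lborel. row x \<bullet> (\<chi> j. D x (axis j 1)))"
    using integral_reflect_lborel(1)[of "\<lambda>x. row x \<bullet> (\<chi> j. D x (axis j 1))"] by (simp add: row_even)
  moreover have int': "integrable lborel (\<lambda>x. row x \<bullet> (\<chi> j. D (- x) (axis j 1)))"
    using integral_reflect_lborel(2)[of "\<lambda>x. row x \<bullet> (\<chi> j. D x (axis j 1))"] int by (simp add: row_even)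
  moreover have eqD: "row x \<bullet> (\<chi> j. D\<psi> x (axis j 1)) = (row x \<bullet> (\<chi> j. D x (axis j 1)) + row x \<bullet> (\<chi> j. D (- x) (axis j 1))) / 2" for x
    by (simp add: D\<psi>_def inner_vec_def sum_2 blinfun.bilinear_simps algebra_simps)
  ultimately have l: "(LINT x|lborel. row x \<bullet> (\<chi> j. D\<psi> x (axis j 1))) = (LINT x|lborel. row x \<bullet> (\<chi> j. D x (axis j 1)))"
    using int unfolding eqD by simp
  have "(LINT x|lborel. W x * \<phi> (- x)) = - (LINT x|lborel. W x * \<phi> x)"
    using integral_reflect_lborel(1)[of "\<lambda>x. W x * \<phi> x"] by (simp add: W_odd)
  moreover have "integrable lborel (\<lambda>x. W x * \<phi> (- x))"
    using integral_reflect_lborel(2)[of "\<lambda>x. W x * \<phi> x"] intW by (simp add: W_odd)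
  moreover have eqW: "W x * \<psi> x = (W x * \<phi> x - W x * \<phi> (- x)) / 2" for x
    by (simp add: \<psi>_def algebra_simps)
  ultimately have r: "(LINT x|lborel. W x * \<psi> x) = (LINT x|lborel. W x * \<phi> x)"
    using intW unfolding eqW by simp
  show "?flux" using int by (simp add: row_def)
  show "?source" using intW by (simp add: W_def)
  show "?balance"
    using src l r by (simp add: row_def W_def)
qed

section \<open>Test functions in space-time and fields in Lebesgue spaces\<close>

text \<open>
The compact support stays away from \<open>t = T\<close> but may meet \<open>t = 0\<close>. The derivative is controlled at
interior times, where it is two-sided and hence unique; a single time is negligible in the integrals.
\<close>

lemma C1_test_spacetime_bounds:
  fixes \<Phi> :: "real \<times> (real^2) \<Rightarrow> real^2"
  assumes test: "C1_test ({0..<T} \<times> UNIV) \<Phi> D" and T: "0 < T"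
  obtains T' M L where "0 < T'" "T' < T" "0 < M" "0 < L"
    "\<And>t x. 0 \<le> t \<Longrightarrow> t < T \<Longrightarrow> T' < t \<or> M < norm x \<Longrightarrow> \<Phi> (t, x) = 0"
    "\<And>t x. 0 < t \<Longrightarrow> t < T \<Longrightarrow> T' < t \<or> M < norm x \<Longrightarrow> D (t, x) = 0"
    "\<And>t x. 0 \<le> t \<Longrightarrow> t < T \<Longrightarrow> norm (\<Phi> (t, x)) \<le> L"
    "\<And>t x. 0 < t \<Longrightarrow> t < T \<Longrightarrow> norm (D (t, x)) \<le> L"
    "\<And>t x. 0 < t \<Longrightarrow> t < T \<Longrightarrow> (\<Phi> has_derivative blinfun_apply (D (t, x))) (at (t, x))"
proof -
  let ?S = "{0..<T} \<times> (UNIV :: (real^2) set)" and ?I = "{0<..<T} \<times> (UNIV :: (real^2) set)"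
  have der: "\<And>z. z \<in> ?S \<Longrightarrow> (\<Phi> has_derivative blinfun_apply (D z)) (at z within ?S)"
    and cD: "continuous_on ?S D"
    and "\<exists>K. compact K \<and> K \<subseteq> ?S \<and> (\<forall>z\<in>?S - K. \<Phi> z = 0)"
    using test by (simp_all only: C1_test_def)
  then obtain K where K: "compact K" "K \<subseteq> ?S" "\<And>z. z \<in> ?S - K \<Longrightarrow> \<Phi> z = 0"
    by metis
  have c\<Phi>: "continuous_on ?S \<Phi>"
    using der by (metis has_derivative_continuous continuous_on_eq_continuous_within)
  have open0: "open ?I" by (intro open_Times) auto
  have der0: "(\<Phi> has_derivative blinfun_apply (D z)) (at z)" if "z \<in> ?I" for z
    using has_derivative_subset[OF der[of z], of ?I] that at_within_open[OF that open0] by force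
  obtain M where M: "M > 0" "\<And>z. z \<in> K \<Longrightarrow> norm z \<le> M"
    using compact_imp_bounded[OF K(1)] by (auto simp: bounded_pos)
  have "compact (insert (T/2) (fst ` K))"
    using K(1) by (intro compact_insert compact_continuous_image continuous_intros)
  then obtain T' where T': "T' \<in> insert (T/2) (fst ` K)" "\<And>t. t \<in> insert (T/2) (fst ` K) \<Longrightarrow> t \<le> T'"
    using compact_attains_sup[of "insert (T/2) (fst ` K)"] by (metis insert_not_empty)
  have T'0: "0 < T'" using T'(2)[of "T/2"] T by simp
  have T'T: "T' < T" using T'(1) K(2) T by auto
  have notK: "(t, x) \<notin> K" if "T' < t \<or> M < norm x" for t x
  proof
    assume "(t, x) \<in> K"
    moreover from this have "t \<in> insert (T/2) (fst ` K)" by force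
    ultimately have "norm x \<le> M" "t \<le> T'"
      using order_trans[OF norm_snd_le M(2)[of "(t, x)"]] T'(2)[of t] by auto
    with that show False by auto
  qed
  have \<Phi>0: "\<Phi> (t, x) = 0" if "0 \<le> t" "t < T" "T' < t \<or> M < norm x" for t x
    using notK[OF that(3)] that K(3) by auto
  have D0: "D (t, x) = 0" if "0 < t" "t < T" "T' < t \<or> M < norm x" for t x
  proof -
    let ?O = "?I - {..T'} \<times> cball 0 M"
    have "open ?O"
      by (intro open_Diff open0 closed_Times closed_atMost closed_cball)
    then have "(\<Phi> has_derivative (\<lambda>_. 0)) (at (t, x))"
    proof (rule has_derivative_transform_within_open[where f = "\<lambda>_. 0", rotated])
      show "(t, x) \<in> ?O" using that by auto
      show "0 = \<Phi> z" if "z \<in> ?O" for z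
        using that \<Phi>0[of "fst z" "snd z"] by (cases z) auto
    qed auto
    then have "blinfun_apply (D (t, x)) = (\<lambda>_. 0)"
      using has_derivative_unique[OF der0[of "(t, x)"]] that by simp
    then show ?thesis by (intro blinfun_eqI) simp
  qed
  have "compact ({0..T'} \<times> cball (0::real^2) M)" and sub: "{0..T'} \<times> cball (0::real^2) M \<subseteq> ?S"
    using T'T by (auto intro: compact_Times)
  then have "compact (\<Phi> ` ({0..T'} \<times> cball 0 M))" "compact (D ` ({0..T'} \<times> cball 0 M))"
    by (auto intro!: compact_continuous_image intro: continuous_on_subset[OF c\<Phi>] continuous_on_subset[OF cD])
  then obtain L1 L2 where L1: "L1 > 0" "\<forall>y\<in>\<Phi> ` ({0..T'} \<times> cball 0 M). norm y \<le> L1"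
    and L2: "L2 > 0" "\<forall>y\<in>D ` ({0..T'} \<times> cball 0 M). norm y \<le> L2"
    using compact_imp_bounded bounded_pos by metis
  have L: "0 < L1" "norm (\<Phi> (t, x)) \<le> L1" "norm (D (t, x)) \<le> L2"
    if "0 \<le> t" "t \<le> T'" "norm x \<le> M" for t x
    using L1 L2(2) that by auto
  define L where "L = max L1 L2"
  have "0 < L" using L1(1) by (simp add: L_def)
  have n\<Phi>: "norm (\<Phi> (t, x)) \<le> L" if "0 \<le> t" "t < T" for t x
  proof (cases "t \<le> T' \<and> norm x \<le> M")
    case True
    then show ?thesis using L(2)[of t x] that by (simp add: L_def)
  next
    case False
    then show ?thesis using \<Phi>0[OF that, of x] \<open>0 < L\<close> by auto
  qed
  have nD: "norm (D (t, x)) \<le> L" if "0 < t" "t < T" for t x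
  proof (cases "t \<le> T' \<and> norm x \<le> M")
    case True
    then show ?thesis using L(3)[of t x] that by (simp add: L_def)
  next
    case False
    then show ?thesis using D0[OF that, of x] \<open>0 < L\<close> by auto
  qed
  show thesis
    by (rule that[of T' M L]) (use T'0 T'T M(1) \<open>0 < L\<close> \<Phi>0 D0 n\<Phi> nD der0 in auto)
qed

lemma C1_test_time_slice:
  fixes \<Phi> :: "real \<times> (real^2) \<Rightarrow> real^2"
  assumes test: "C1_test ({0..<T} \<times> UNIV) \<Phi> D" and t: "0 \<le> t" "t < T"
  shows "\<exists>E. C1_test UNIV (\<lambda>x. \<Phi> (t, x) $ i) E \<and> (\<forall>x y. blinfun_apply (E x) y = D (t, x) (0, y) $ i)"
proof -
  let ?S = "{0..<T} \<times> (UNIV :: (real^2) set)"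
  have der: "\<And>z. z \<in> ?S \<Longrightarrow> (\<Phi> has_derivative blinfun_apply (D z)) (at z within ?S)"
    and cD: "continuous_on ?S D"
    and "\<exists>K. compact K \<and> K \<subseteq> ?S \<and> (\<forall>z\<in>?S - K. \<Phi> z = 0)"
    using test by (simp_all only: C1_test_def)
  then obtain K where K: "compact K" "K \<subseteq> ?S" "\<And>z. z \<in> ?S - K \<Longrightarrow> \<Phi> z = 0"
    by metis
  define J where "J = Blinfun (\<lambda>y::real^2. (0::real, y))"
  define N where "N = Blinfun (\<lambda>v::real^2. v $ i)"
  have J: "blinfun_apply J y = (0, y)" for y
    unfolding J_def by (subst bounded_linear_Blinfun_apply) (auto intro!: bounded_linear_Pair bounded_linear_zero bounded_linear_ident)
  have N: "blinfun_apply N v = v $ i" for v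
    unfolding N_def by (subst bounded_linear_Blinfun_apply) (auto intro: bounded_linear_vec_nth)
  define E where "E x = N o\<^sub>L (D (t, x) o\<^sub>L J)" for x
  have E: "blinfun_apply (E x) y = D (t, x) (0, y) $ i" for x y
    by (simp add: E_def J N)
  have "((\<lambda>x. \<Phi> (t, x) $ i) has_derivative blinfun_apply (E x)) (at x)" for x
  proof -
    have "((\<lambda>x. (t, x)) has_derivative (\<lambda>y. (0, y))) (at x)"
      by (intro has_derivative_Pair has_derivative_const has_derivative_ident)
    moreover have "(\<Phi> has_derivative blinfun_apply (D (t, x))) (at (t, x) within ?S)"
      using der t by auto
    ultimately have "((\<lambda>x. \<Phi> (t, x)) has_derivative (\<lambda>y. D (t, x) (0, y))) (at x)"
      using has_derivative_in_compose2[of ?S \<Phi> "\<lambda>z. blinfun_apply (D z)" "\<lambda>x. (t, x)" UNIV x "\<lambda>y. (0, y)"] der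
        image_subset_iff[of "\<lambda>x. (t, x)" UNIV ?S] t
      by auto
    from bounded_linear.has_derivative[OF bounded_linear_vec_nth this]
    show ?thesis by (simp add: E[abs_def])
  qed
  moreover have "continuous_on UNIV E"
    unfolding E_def
    by (intro bounded_bilinear.continuous_on[OF bounded_bilinear_blinfun_compose] continuous_intros
        continuous_on_compose2[OF cD]) (use t in auto)
  moreover have "compact (snd ` K)"
    by (intro compact_continuous_image continuous_intros K)
  moreover have "\<Phi> (t, x) $ i = 0" if "x \<notin> snd ` K" for x
    using K(3)[of "(t, x)"] that t by force
  ultimately have "C1_test UNIV (\<lambda>x. \<Phi> (t, x) $ i) E"
    unfolding C1_test_def by (auto intro!: exI[of _ "snd ` K"])
  with E show ?thesis by blast
qed

text \<open>
Dominated convergence: pointwise continuity in time away from the origin and one common majorant of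
all time slices give continuity with values in \<open>L\<^sup>p\<close>.
\<close>

lemma continuous_into_Lp_dominated:
  fixes u :: "real \<Rightarrow> 'a::euclidean_space \<Rightarrow> 'b::euclidean_space" and H :: "'a \<Rightarrow> real"
  assumes p: "0 < p"
    and meas: "\<And>t. t \<in> {0..T} \<Longrightarrow> u t \<in> borel_measurable borel"
    and H[measurable]: "H \<in> borel_measurable borel" "\<And>x. 0 \<le> H x" "integrable lborel (\<lambda>x. H x powr p)"
    and dom: "\<And>t x. t \<in> {0..T} \<Longrightarrow> x \<noteq> 0 \<Longrightarrow> norm (u t x) \<le> H x"
    and cont: "\<And>x. x \<noteq> 0 \<Longrightarrow> continuous_on {0..T} (\<lambda>t. u t x)"
  shows "continuous_into_Lp T p u"
  unfolding continuous_into_Lp_def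
proof (intro conjI ballI)
  note ae = AE_lborel_singleton[of "0::'a"]
  fix t assume t: "t \<in> {0..T}"
  note [measurable] = meas[OF t]
  have "integrable lborel (\<lambda>x. norm (u t x) powr p)"
  proof (rule Bochner_Integration.integrable_bound[OF H(3)])
    show "AE x in lborel. norm (norm (u t x) powr p) \<le> norm (H x powr p)"
      by (rule eventually_mono[OF ae]) (use dom[OF t] p in \<open>auto intro: powr_mono2\<close>)
  qed measurable
  then show "in_Lp p (u t)" by (simp add: in_Lp_def)
  show "((\<lambda>s. Lp_norm p (\<lambda>x. u s x - u t x)) \<longlongrightarrow> 0) (at t within {0..T})"
    unfolding tendsto_at_iff_sequentially comp_def
  proof (intro allI impI)
    fix X :: "nat \<Rightarrow> real" assume X: "\<forall>i. X i \<in> {0..T} - {t}" "X \<longlonglongrightarrow> t"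
    then have Xm[measurable]: "u (X i) \<in> borel_measurable borel" for i using meas by auto
    have "(\<lambda>i. LINT x|lborel. norm (u (X i) x - u t x) powr p) \<longlonglongrightarrow> (LINT x|(lborel::'a measure). 0)"
    proof (rule integral_dominated_convergence)
      show "integrable lborel (\<lambda>x. 2 powr p * H x powr p)"
        using H by simp
      show "AE x in lborel. (\<lambda>i. norm (u (X i) x - u t x) powr p) \<longlonglongrightarrow> 0"
      proof (rule eventually_mono[OF ae])
        fix x :: 'a assume "x \<noteq> 0"
        have "(\<lambda>i. u (X i) x) \<longlonglongrightarrow> u t x"
          using continuous_on_tendsto_compose[OF cont[OF \<open>x \<noteq> 0\<close>] X(2) t] X(1) by auto
        then have "(\<lambda>i. norm (u (X i) x - u t x)) \<longlonglongrightarrow> 0"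
          using LIM_zero tendsto_norm_zero by blast
        from tendsto_powr'[OF this tendsto_const, of p]
        show "(\<lambda>i. norm (u (X i) x - u t x) powr p) \<longlonglongrightarrow> 0" using p by auto
      qed
      show "AE x in lborel. norm (norm (u (X i) x - u t x) powr p) \<le> 2 powr p * H x powr p" for i
      proof (rule eventually_mono[OF ae])
        fix x :: 'a assume "x \<noteq> 0"
        then have "norm (u (X i) x - u t x) \<le> 2 * H x"
          using norm_triangle_ineq4[of "u (X i) x" "u t x"] dom[of "X i" x] dom[of t x] X(1) t by force
        then have "norm (u (X i) x - u t x) powr p \<le> (2 * H x) powr p"
          using p by (intro powr_mono2) auto
        then show "norm (norm (u (X i) x - u t x) powr p) \<le> 2 powr p * H x powr p"
          using H(2)[of x] by (simp add: powr_mult)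
      qed
    qed (measurable)
    then have "(\<lambda>i. LINT x|lborel. norm (u (X i) x - u t x) powr p) \<longlonglongrightarrow> 0" by simp
    from tendsto_powr'[OF this tendsto_const, of "1 / p"] p
    show "(\<lambda>i. Lp_norm p (\<lambda>x. u (X i) x - u t x)) \<longlonglongrightarrow> 0"
      unfolding Lp_norm_def by auto
  qed
qed

lemma norm_outer: "norm (outer v w) = norm v * norm w"
proof -
  have "outer v w $ i = v $ i *\<^sub>R w" for i
    by (simp add: outer_def vec_eq_iff)
  then have "norm (outer v w) = L2_set (\<lambda>i. norm (v $ i *\<^sub>R w)) UNIV"
    by (simp only: norm_vec_def[of "outer v w"])
  also have "\<dots> = L2_set (\<lambda>i. norm (v $ i)) UNIV * norm w"
    by (simp add: L2_set_left_distrib)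
  finally show ?thesis by (simp only: norm_vec_def[of v])
qed

definition radial_velocity :: "(real \<Rightarrow> real) \<Rightarrow> real^2 \<Rightarrow> real^2" where
  "radial_velocity g x = g (norm x) *\<^sub>R perp x"

definition radial_stress :: "(real \<Rightarrow> real) \<Rightarrow> (real \<Rightarrow> real) \<Rightarrow> real^2 \<Rightarrow> real^2^2" where
  "radial_stress g b x = traceless_square (radial_velocity g x)
     + b (norm x) *\<^sub>R (outer x (perp x) + outer (perp x) x)"

definition radial_bernoulli :: "(real \<Rightarrow> real) \<Rightarrow> (real \<Rightarrow> real) \<Rightarrow> real^2 \<Rightarrow> real" where
  "radial_bernoulli g p x = (norm (radial_velocity g x))\<^sup>2 / 2 + p (norm x)"

lemma radial_stress_symmetric: "transpose (radial_stress g b x) = radial_stress g b x"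
  by (simp add: radial_stress_def traceless_square_def outer_def transpose_def vec_eq_iff mat_def algebra_simps)

lemma radial_stress_traceless: "trace (radial_stress g b x) = 0"
proof -
  have "trace (traceless_square v) = 0" for v :: "real^2"
    unfolding traceless_square_def norm_sq_2
    by (simp add: trace_def sum_2 outer_def mat_def power2_eq_square)
  then show ?thesis
    unfolding radial_stress_def by (simp add: trace_add) (simp add: trace_def sum_2 outer_def algebra_simps)
qed

text \<open>
The term \<open>|v|\<^sup>2/2\<close> of the Bernoulli pressure cancels the trace part of \<open>\<sigma>\<close>, so that the total flux is
the matrix with the rows \<open>radial_stress_row\<close>.
\<close>

lemma radial_stress_row_nth:
  "radial_stress_row (\<lambda>r. (g r)\<^sup>2) b p i x $ j
   = radial_stress g b x $ i $ j + (if i = j then radial_bernoulli g p x else 0)"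
  by (simp add: radial_stress_def radial_bernoulli_def radial_stress_row_def traceless_square_def outer_def
      mat_def radial_velocity_def axis_def power2_eq_square algebra_simps del: perp_nth)

lemma radial_stress_contraction:
  "radial_stress g b x \<bullet> grad E + radial_bernoulli g p x * trace (grad E)
   = (\<Sum>i\<in>UNIV. radial_stress_row (\<lambda>r. (g r)\<^sup>2) b p i x \<bullet> (\<chi> j. E (0, axis j 1) $ i))"
  by (simp add: inner_vec_def[where 'a = "real^2"] inner_vec_def[where 'a = real] sum_2 radial_stress_row_nth
      grad_def trace_def algebra_simps)

section \<open>Radial flows: integrability and continuity in time\<close>

lemma borel_measurable_vec2I:
  fixes f :: "'a \<Rightarrow> 'b::euclidean_space^2"
  assumes "\<And>i. (\<lambda>x. f x $ i) \<in> borel_measurable M"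
  shows "f \<in> borel_measurable M"
proof -
  have c: "continuous_on UNIV (axis i :: 'b \<Rightarrow> 'b^2)" for i
    by (rule linear_continuous_on, rule linear_conv_bounded_linear[THEN iffD1], rule linearI)
      (auto simp: axis_def vec_eq_iff)
  have "(\<lambda>x. \<Sum>i\<in>UNIV. axis i (f x $ i)) \<in> borel_measurable M"
    by (rule borel_measurable_sum, rule measurable_compose[OF assms borel_measurable_continuous_onI[OF c]])
  moreover have "(\<Sum>i\<in>UNIV. axis i (f x $ i)) = f x" for x
    by (auto simp: vec_eq_iff axis_def sum_2 forall_2)
  ultimately show ?thesis by simp
qed

lemma radial_velocity_measurable:
  assumes [measurable]: "g \<in> borel_measurable borel"
  shows "radial_velocity g \<in> borel_measurable borel"
  unfolding radial_velocity_def[abs_def] by measurable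

lemma radial_bernoulli_measurable:
  assumes [measurable]: "g \<in> borel_measurable borel" "p \<in> borel_measurable borel"
  shows "radial_bernoulli g p \<in> borel_measurable borel"
proof -
  note [measurable] = radial_velocity_measurable[OF assms(1)]
  show ?thesis unfolding radial_bernoulli_def[abs_def] by measurable
qed

lemma radial_stress_measurable:
  assumes [measurable]: "g \<in> borel_measurable borel" "b \<in> borel_measurable borel"
  shows "radial_stress g b \<in> borel_measurable borel"
proof (intro borel_measurable_vec2I)
  note [measurable] = radial_velocity_measurable[OF assms(1)]
  fix i j :: 2
  have "radial_stress g b x $ i $ j = radial_velocity g x $ i * radial_velocity g x $ j
      - (norm (radial_velocity g x))\<^sup>2 / 2 * (if i = j then 1 else 0)
      + b (norm x) * (x $ i * perp x $ j + perp x $ i * x $ j)" for x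
    by (simp add: radial_stress_def traceless_square_def outer_def mat_def del: perp_nth)
  then show "(\<lambda>x. radial_stress g b x $ i $ j) \<in> borel_measurable borel"
    by (simp only:) measurable
qed

text \<open>
What a family of radial profiles has to satisfy in order to give a subsolution. The set \<open>N\<close> is the
interface in the \<open>(t, r)\<close> half-plane: the profiles are continuous across it and differentiable off it.
The bounds on the profiles are uniform in time, since they enter the continuity in time; those on the
radial derivatives are used for one time at a time, hence the constant \<open>C'\<close> that depends on \<open>t\<close>. The
right-hand side in \<open>deriv_t\<close> is the angular momentum balance, and \<open>source_bound\<close> makes \<open>\<partial>\<^sub>t v\<close>
integrable over space-time although it may blow up as \<open>t \<rightarrow> 0\<close>.
\<close>

locale radial_flow =
  fixes a M C T :: real and g g' b b' p :: "real \<Rightarrow> real \<Rightarrow> real" and N :: "(real \<times> real) set"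
  assumes a: "0 < a" "a < 2" and M: "0 < M" and T: "0 < T"
    and interface: "\<And>t. finite {r. (t, r) \<in> N}" "\<And>r. finite {t. (t, r) \<in> N}"
    and meas: "(\<lambda>z. g (fst z) (snd z)) \<in> borel_measurable borel"
      "(\<lambda>z. b (fst z) (snd z)) \<in> borel_measurable borel"
      "(\<lambda>z. p (fst z) (snd z)) \<in> borel_measurable borel"
      "(\<lambda>z. g' (fst z) (snd z)) \<in> borel_measurable borel"
      "(\<lambda>z. b' (fst z) (snd z)) \<in> borel_measurable borel"
    and cont_r: "\<And>t. t \<in> {0..T} \<Longrightarrow> continuous_on {0<..} (g t)"
      "\<And>t. t \<in> {0..T} \<Longrightarrow> continuous_on {0<..} (b t)"
      "\<And>t. t \<in> {0..T} \<Longrightarrow> continuous_on {0<..} (p t)"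
    and cont_t: "\<And>r. r > 0 \<Longrightarrow> continuous_on {0..T} (\<lambda>t. g t r)"
      "\<And>r. r > 0 \<Longrightarrow> continuous_on {0..T} (\<lambda>t. b t r)"
      "\<And>r. r > 0 \<Longrightarrow> continuous_on {0..T} (\<lambda>t. p t r)"
    and deriv_r: "\<And>t r. t \<in> {0..T} \<Longrightarrow> r > 0 \<Longrightarrow> (t, r) \<notin> N \<Longrightarrow> (g t has_real_derivative g' t r) (at r)"
      "\<And>t r. t \<in> {0..T} \<Longrightarrow> r > 0 \<Longrightarrow> (t, r) \<notin> N \<Longrightarrow> (b t has_real_derivative b' t r) (at r)"
      "\<And>t r. t \<in> {0..T} \<Longrightarrow> r > 0 \<Longrightarrow> (t, r) \<notin> N \<Longrightarrow> (p t has_real_derivative r * (g t r)\<^sup>2) (at r)"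
    and deriv_t: "\<And>t r. t \<in> {0<..<T} \<Longrightarrow> r > 0 \<Longrightarrow> (t, r) \<notin> N \<Longrightarrow>
      ((\<lambda>t. g t r) has_real_derivative - (r * b' t r + 4 * b t r)) (at t)"
    and bound: "\<And>t r. t \<in> {0..T} \<Longrightarrow> r > 0 \<Longrightarrow> \<bar>g t r\<bar> \<le> C * r powr (- a)"
      "\<And>t r. t \<in> {0..T} \<Longrightarrow> r > 0 \<Longrightarrow> \<bar>b t r\<bar> * r\<^sup>2 \<le> C * r powr (- a)"
      "\<And>t r. t \<in> {0..T} \<Longrightarrow> r > 0 \<Longrightarrow> \<bar>p t r\<bar> \<le> C * r powr (- a)"
    and support: "\<And>t r. t \<in> {0..T} \<Longrightarrow> r > M \<Longrightarrow> g t r = 0 \<and> b t r = 0 \<and> p t r = 0"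
    and deriv_bound: "\<And>t. t \<in> {0..T} \<Longrightarrow> \<exists>C'. \<forall>r>0. \<bar>g' t r\<bar> * r \<le> C' * r powr (- a) \<and> \<bar>b' t r\<bar> * r ^ 3 \<le> C' * r powr (- a)"
    and source_bound: "\<And>t r. t \<in> {0<..<T} \<Longrightarrow> r > 0 \<Longrightarrow>
      \<bar>r * b' t r + 4 * b t r\<bar> * r \<le> C * r powr (- a) * t powr (- 1 / 2)"
begin

lemma C_nonneg: "0 \<le> C"
  using order_trans[OF abs_ge_zero bound(1)[of 0 1]] T by simp

lemma meas_comp:
  assumes "f \<in> borel_measurable K" "h \<in> borel_measurable K"
  shows "(\<lambda>x. g (f x) (h x)) \<in> borel_measurable K" "(\<lambda>x. b (f x) (h x)) \<in> borel_measurable K"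
    "(\<lambda>x. p (f x) (h x)) \<in> borel_measurable K"
    "(\<lambda>x. g' (f x) (h x)) \<in> borel_measurable K" "(\<lambda>x. b' (f x) (h x)) \<in> borel_measurable K"
  using measurable_compose[OF borel_measurable_Pair[OF assms] meas(1)]
    measurable_compose[OF borel_measurable_Pair[OF assms] meas(2)]
    measurable_compose[OF borel_measurable_Pair[OF assms] meas(3)]
    measurable_compose[OF borel_measurable_Pair[OF assms] meas(4)]
    measurable_compose[OF borel_measurable_Pair[OF assms] meas(5)]
  by simp_all

lemma meas_r: "g t \<in> borel_measurable borel" "b t \<in> borel_measurable borel"
  "p t \<in> borel_measurable borel" "g' t \<in> borel_measurable borel" "b' t \<in> borel_measurable borel"
  by (rule meas_comp; simp)+

lemma velocity_bound:
  assumes "t \<in> {0..T}" "x \<noteq> 0"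
  shows "norm (radial_velocity (g t) x) \<le> C * (indicator {..M} (norm x) * norm x powr (1 - a))"
proof (cases "norm x \<le> M")
  case True
  have "norm (radial_velocity (g t) x) = \<bar>g t (norm x)\<bar> * norm x"
    by (simp add: radial_velocity_def)
  also have "\<dots> \<le> C * norm x powr (- a) * norm x"
    using bound(1)[OF assms(1), of "norm x"] assms by (intro mult_right_mono) auto
  also have "\<dots> = C * norm x powr (1 - a)"
    using assms by (simp add: powr_diff powr_minus divide_inverse)
  finally show ?thesis using True by simp
next
  case False
  then show ?thesis using support[OF assms(1), of "norm x"] by (simp add: radial_velocity_def)
qed

text \<open>
The square of \<open>r powr (1 - a)\<close> is \<open>r powr (2 - a)\<close> times \<open>r powr (- a)\<close>, and the first factor is
bounded on the support. In this way the single exponent \<open>- a\<close> serves for all fields.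
\<close>

lemma velocity_square_bound:
  assumes "t \<in> {0..T}" "x \<noteq> 0"
  shows "(norm (radial_velocity (g t) x))\<^sup>2 \<le> C\<^sup>2 * M powr (2 - a) * (indicator {..M} (norm x) * norm x powr (- a))"
proof (cases "norm x \<le> M")
  case True
  have "(norm (radial_velocity (g t) x))\<^sup>2 \<le> (C * norm x powr (1 - a))\<^sup>2"
    using velocity_bound[OF assms] True by (intro power_mono) auto
  also have "\<dots> = C\<^sup>2 * (norm x powr (2 - a) * norm x powr (- a))"
    by (simp add: power_mult_distrib power2_eq_square powr_add[symmetric])
  also have "\<dots> \<le> C\<^sup>2 * (M powr (2 - a) * norm x powr (- a))"
    using True a by (intro mult_left_mono mult_right_mono powr_mono2) auto
  finally show ?thesis using True by simp
next
  case False
  then show ?thesis using support[OF assms(1), of "norm x"] by (simp add: radial_velocity_def)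
qed

lemma g_bounds:
  assumes "t \<in> {0..T}" "r > 0"
  shows "\<bar>g t r\<bar> * r \<le> C * M * r powr (- a)"
    and "(g t r)\<^sup>2 * r\<^sup>2 \<le> C\<^sup>2 * M powr (2 - a) * r powr (- a)"
proof -
  show "\<bar>g t r\<bar> * r \<le> C * M * r powr (- a)"
  proof (cases "r \<le> M")
    case True
    then show ?thesis
      using mult_mono[OF bound(1)[OF assms] True] assms C_nonneg by (simp add: mult_ac)
  next
    case False
    then show ?thesis using support[OF assms(1), of r] C_nonneg M by simp
  qed
  have r: "norm (r *\<^sub>R axis 1 1 :: real^2) = r" "r *\<^sub>R axis 1 1 \<noteq> (0 :: real^2)"
    using assms by auto
  have "(g t r)\<^sup>2 * r\<^sup>2 \<le> C\<^sup>2 * M powr (2 - a) * (indicator {..M} r * r powr (- a))"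
    using velocity_square_bound[OF assms(1) r(2)] r(1) by (simp add: radial_velocity_def power_mult_distrib)
  also have "\<dots> \<le> C\<^sup>2 * M powr (2 - a) * (1 * r powr (- a))"
    by (intro mult_left_mono mult_right_mono) (auto simp: indicator_def)
  finally show "(g t r)\<^sup>2 * r\<^sup>2 \<le> C\<^sup>2 * M powr (2 - a) * r powr (- a)" by simp
qed

text \<open>
The majorant is square-integrable because \<open>2 a - 2 < 2\<close>.
\<close>

lemma velocity_continuous_L2: "continuous_into_Lp T 2 (\<lambda>t. radial_velocity (g t))"
proof (rule continuous_into_Lp_dominated)
  have "(C * (indicator {..M} (norm x) * norm x powr (1 - a))) powr 2
      = C\<^sup>2 * (indicator {..M} (norm x) * norm x powr (- (2 * a - 2)))" for x :: "real^2"
  proof (cases "norm x \<le> M")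
    case True
    have "(C * norm x powr (1 - a)) powr 2 = C\<^sup>2 * (norm x powr (1 - a) * norm x powr (1 - a))"
      using C_nonneg by (subst powr_numeral) (auto simp: power_mult_distrib power2_eq_square)
    also have "norm x powr (1 - a) * norm x powr (1 - a) = norm x powr (- (2 * a - 2))"
      by (subst powr_add[symmetric]) (rule arg_cong[of _ _ "\<lambda>z. norm x powr z"], simp)
    finally show ?thesis using True by simp
  qed simp
  moreover have "integrable lborel (\<lambda>x::real^2. C\<^sup>2 * (indicator {..M} (norm x) * norm x powr (- (2 * a - 2))))"
    using a M by (intro integrable_mult_right integrable_norm_powr) auto
  ultimately show "integrable lborel (\<lambda>x::real^2. (C * (indicator {..M} (norm x) * norm x powr (1 - a))) powr 2)"
    by simp
  show "continuous_on {0..T} (\<lambda>t. radial_velocity (g t) x)" if "x \<noteq> 0" for x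
    unfolding radial_velocity_def using that by (intro continuous_intros cont_t) auto
  show "(\<lambda>x::real^2. C * (indicator {..M} (norm x) * norm x powr (1 - a))) \<in> borel_measurable borel" by measurable
  show "0 \<le> C * (indicator {..M} (norm x) * norm x powr (1 - a))" for x :: "real^2" using C_nonneg by simp
  show "radial_velocity (g t) \<in> borel_measurable borel" for t
    by (rule radial_velocity_measurable[OF meas_r(1)])
  show "norm (radial_velocity (g t) x) \<le> C * (indicator {..M} (norm x) * norm x powr (1 - a))"
    if "t \<in> {0..T}" "x \<noteq> 0" for t x
    by (rule velocity_bound[OF that])
qed simp

lemma stress_continuous_L1: "continuous_into_Lp T 1 (\<lambda>t. radial_stress (g t) (b t))"
proof -
  define K where "K = C\<^sup>2 * M powr (2 - a) * (1 + norm (mat 1 :: real^2^2)) + 2 * C"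
  have K: "0 \<le> K" using C_nonneg by (simp add: K_def)
  let ?H = "\<lambda>x::real^2. K * (indicator {..M} (norm x) * norm x powr (- a))"
  have H: "integrable lborel ?H"
    using a M by (intro integrable_mult_right integrable_norm_powr) auto
  show ?thesis
  proof (rule continuous_into_Lp_dominated[where H = ?H])
    show "integrable lborel (\<lambda>x. ?H x powr 1)"
      using K H by (simp add: indicator_def)
    show "norm (radial_stress (g t) (b t) x) \<le> ?H x" if t: "t \<in> {0..T}" and x: "x \<noteq> 0" for t x
    proof -
      let ?v = "radial_velocity (g t) x" and ?I = "indicator {..M} (norm x) * norm x powr (- a)"
      have "norm (traceless_square ?v) \<le> norm ?v * norm ?v + (norm ?v)\<^sup>2 / 2 * norm (mat 1 :: real^2^2)"
        unfolding traceless_square_def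
        using norm_triangle_ineq4[of "outer ?v ?v" "((norm ?v)\<^sup>2 / 2) *\<^sub>R mat 1"] by (simp add: norm_outer)
      also have "\<dots> \<le> (norm ?v)\<^sup>2 * (1 + norm (mat 1 :: real^2^2))"
        by (simp add: power2_eq_square algebra_simps)
      also have "\<dots> \<le> (C\<^sup>2 * M powr (2 - a) * ?I) * (1 + norm (mat 1 :: real^2^2))"
        by (intro mult_right_mono velocity_square_bound[OF t x]) auto
      finally have 1: "norm (traceless_square ?v) \<le> (C\<^sup>2 * M powr (2 - a) * ?I) * (1 + norm (mat 1 :: real^2^2))" .
      have bI: "\<bar>b t (norm x)\<bar> * (norm x)\<^sup>2 \<le> C * ?I"
        using bound(2)[OF t, of "norm x"] support[OF t, of "norm x"] x by (cases "norm x \<le> M") auto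
      have "norm (b t (norm x) *\<^sub>R (outer x (perp x) + outer (perp x) x)) \<le> \<bar>b t (norm x)\<bar> * (norm x * norm x + norm x * norm x)"
        using norm_triangle_ineq[of "outer x (perp x)" "outer (perp x) x"]
        by (auto simp: norm_outer intro!: mult_left_mono)
      also have "\<dots> = 2 * (\<bar>b t (norm x)\<bar> * (norm x)\<^sup>2)"
        by (simp add: power2_eq_square)
      also have "\<dots> \<le> 2 * (C * ?I)" using bI by simp
      finally have 2: "norm (b t (norm x) *\<^sub>R (outer x (perp x) + outer (perp x) x)) \<le> 2 * (C * ?I)" .
      from norm_triangle_mono[OF 1 2] show ?thesis
        unfolding radial_stress_def K_def by (simp add: algebra_simps)
    qed
    show "continuous_on {0..T} (\<lambda>t. radial_stress (g t) (b t) x)" if "x \<noteq> 0" for x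
      unfolding radial_stress_def traceless_square_def radial_velocity_def outer_def using that
      by (intro continuous_intros cont_t continuous_on_vec_lambda) auto
    show "?H \<in> borel_measurable borel" by measurable
    show "0 \<le> ?H x" for x using K by simp
    show "radial_stress (g t) (b t) \<in> borel_measurable borel" for t
      by (rule radial_stress_measurable[OF meas_r(1,2)])
  qed simp
qed

lemma bernoulli_continuous_L1: "continuous_into_Lp T 1 (\<lambda>t. radial_bernoulli (g t) (p t))"
proof -
  define K where "K = C\<^sup>2 * M powr (2 - a) + C"
  have K: "0 \<le> K" using C_nonneg by (simp add: K_def)
  let ?H = "\<lambda>x::real^2. K * (indicator {..M} (norm x) * norm x powr (- a))"
  have H: "integrable lborel ?H"
    using a M by (intro integrable_mult_right integrable_norm_powr) auto
  show ?thesis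
  proof (rule continuous_into_Lp_dominated[where H = ?H])
    show "integrable lborel (\<lambda>x. ?H x powr 1)"
      using K H by (simp add: indicator_def)
    show "norm (radial_bernoulli (g t) (p t) x) \<le> ?H x" if t: "t \<in> {0..T}" and x: "x \<noteq> 0" for t x
    proof -
      let ?I = "indicator {..M} (norm x) * norm x powr (- a)"
      have "\<bar>p t (norm x)\<bar> \<le> C * ?I"
        using bound(3)[OF t, of "norm x"] support[OF t, of "norm x"] x by (cases "norm x \<le> M") auto
      moreover have "\<bar>(norm (radial_velocity (g t) x))\<^sup>2 / 2\<bar> \<le> C\<^sup>2 * M powr (2 - a) * ?I"
        by (rule order_trans[OF _ velocity_square_bound[OF t x]]) simp
      ultimately have "\<bar>(norm (radial_velocity (g t) x))\<^sup>2 / 2 + p t (norm x)\<bar> \<le> C\<^sup>2 * M powr (2 - a) * ?I + C * ?I"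
        by (intro order_trans[OF abs_triangle_ineq] add_mono)
      then show ?thesis
        unfolding radial_bernoulli_def K_def real_norm_def distrib_right .
    qed
    show "continuous_on {0..T} (\<lambda>t. radial_bernoulli (g t) (p t) x)" if "x \<noteq> 0" for x
      unfolding radial_bernoulli_def radial_velocity_def using that
      by (intro continuous_intros cont_t) auto
    show "?H \<in> borel_measurable borel" by measurable
    show "0 \<le> ?H x" for x using K by simp
    show "radial_bernoulli (g t) (p t) \<in> borel_measurable borel" for t
      by (rule radial_bernoulli_measurable[OF meas_r(1,3)])
  qed simp
qed

lemma velocity_div_free:
  assumes t: "t \<in> {0..T}"
  shows "weakly_div_free (radial_velocity (g t))"
proof -
  obtain C' where C': "\<And>r. r > 0 \<Longrightarrow> \<bar>g' t r\<bar> * r \<le> C' * r powr (- a)"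
    using deriv_bound[OF t] by blast
  define K where "K = max (C * M) (max C' C)"
  have K: "z \<le> K * r powr (- a)" if "z \<le> B * r powr (- a)" "B \<le> K" for z B r
    using that by (meson mult_right_mono order_trans powr_ge_zero)
  have KB: "C * M \<le> K" "C' \<le> K" "C \<le> K"
    unfolding K_def by auto
  have "weakly_div_free (\<lambda>x. g t (norm x) *\<^sub>R perp x)"
    by (rule radial_vortex_weakly_div_free[OF cont_r(1)[OF t] _ interface(1)[of t] meas_r(1,4) a(2), where C = K])
      (use deriv_r(1)[OF t] in \<open>auto intro: K[OF g_bounds(1)[OF t] KB(1)] K[OF C' KB(2)] K[OF bound(1)[OF t] KB(3)]\<close>)
  then show ?thesis by (simp add: radial_velocity_def[abs_def])
qed

lemma momentum_balance:
  fixes \<phi> :: "real^2 \<Rightarrow> real"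
  assumes t: "t \<in> {0..T}" and test: "C1_test UNIV \<phi> E"
    and src: "\<And>r. r > 0 \<Longrightarrow> \<bar>r * b' t r + 4 * b t r\<bar> * r \<le> B * r powr (- a)"
  shows "integrable lborel (\<lambda>x. radial_stress_row (\<lambda>r. (g t r)\<^sup>2) (b t) (p t) i x \<bullet> (\<chi> j. E x (axis j 1)))"
      (is "?flux")
    and "integrable lborel (\<lambda>x. (norm x * b' t (norm x) + 4 * b t (norm x)) * perp x $ i * \<phi> x)" (is "?source")
    and "(LINT x|lborel. radial_stress_row (\<lambda>r. (g t r)\<^sup>2) (b t) (p t) i x \<bullet> (\<chi> j. E x (axis j 1)))
       = - (LINT x|lborel. (norm x * b' t (norm x) + 4 * b t (norm x)) * perp x $ i * \<phi> x)" (is "?balance")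
proof -
  obtain C' where C': "\<And>r. r > 0 \<Longrightarrow> \<bar>g' t r\<bar> * r \<le> C' * r powr (- a)"
    "\<And>r. r > 0 \<Longrightarrow> \<bar>b' t r\<bar> * r ^ 3 \<le> C' * r powr (- a)"
    using deriv_bound[OF t] by blast
  have C'0: "0 \<le> C'" using C'(1)[of 1] by simp
  define K where "K = Max {C\<^sup>2 * M powr (2 - a), 2 * C * C' * M powr (2 - a), C, C', B}"
  have K: "z \<le> K * r powr (- a)" if "z \<le> B * r powr (- a)" "B \<le> K" for z B r
    using that by (meson mult_right_mono order_trans powr_ge_zero)
  have KB: "C\<^sup>2 * M powr (2 - a) \<le> K" "2 * C * C' * M powr (2 - a) \<le> K" "C \<le> K" "C' \<le> K" "B \<le> K"
    unfolding K_def by (intro Max_ge; simp)+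
  have k': "\<bar>2 * g t r * g' t r\<bar> * r ^ 3 \<le> (2 * C * C' * M powr (2 - a)) * r powr (- a)" if "r > 0" for r
  proof (cases "r \<le> M")
    case True
    have "\<bar>2 * g t r * g' t r\<bar> * r ^ 3 = 2 * r\<^sup>2 * (\<bar>g t r\<bar> * (\<bar>g' t r\<bar> * r))"
      by (simp add: abs_mult power2_eq_square power3_eq_cube)
    also have "\<dots> \<le> 2 * r\<^sup>2 * ((C * r powr (- a)) * (C' * r powr (- a)))"
      using that C_nonneg by (intro mult_left_mono mult_mono bound(1)[OF t] C') auto
    also have "\<dots> = 2 * C * C' * (r powr (2 - a) * r powr (- a))"
      using that by (simp add: powr_diff powr_minus divide_inverse mult_ac)
    also have "\<dots> \<le> 2 * C * C' * (M powr (2 - a) * r powr (- a))"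
      using True that a C_nonneg C'0 by (intro mult_left_mono mult_right_mono powr_mono2) auto
    finally show ?thesis by (simp add: mult_ac)
  next
    case False
    then show ?thesis using support[OF t, of r] C_nonneg C'0 by simp
  qed
  have ck: "continuous_on {0<..} (\<lambda>r. (g t r)\<^sup>2)"
    by (intro continuous_intros cont_r t)
  have dk: "((\<lambda>r. (g t r)\<^sup>2) has_real_derivative 2 * g t r * g' t r) (at r)"
    and db: "(b t has_real_derivative b' t r) (at r)" and dp: "(p t has_real_derivative r * (g t r)\<^sup>2) (at r)"
    if "r > 0" "r \<notin> {r. (t, r) \<in> N}" for r
    using deriv_r[OF t, of r] that by (auto intro!: derivative_eq_intros)
  have mk: "(\<lambda>r. (g t r)\<^sup>2) \<in> borel_measurable borel" "(\<lambda>r. 2 * g t r * g' t r) \<in> borel_measurable borel"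
    using meas_r(1,4)[of t] by simp_all
  have bk: "\<bar>(g t r)\<^sup>2\<bar> * r\<^sup>2 \<le> K * r powr (- a)" if "r > 0" for r
    using K[OF g_bounds(2)[OF t that] KB(1)] by simp
  note bal = radial_stress_balance[OF ck cont_r(2,3)[OF t] dk db dp interface(1)[of t] mk(1,2) meas_r(2,5,3) a(2)
      bk K[OF k' KB(2)] K[OF bound(2)[OF t] KB(3)] K[OF C'(2) KB(4)] K[OF bound(3)[OF t] KB(3)] K[OF src KB(5)] test]
  show "?flux" "?source" "?balance"
    by (rule bal; assumption)+
qed

end

section \<open>Radial flows: the weak momentum equation\<close>

lemma integrable_product_of_functions:
  fixes h1 :: "'a::euclidean_space \<Rightarrow> real" and h2 :: "'b::euclidean_space \<Rightarrow> real"
  assumes h: "integrable lborel h1" "integrable lborel h2"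
  shows "integrable (lborel \<Otimes>\<^sub>M lborel) (\<lambda>z. h1 (fst z) * h2 (snd z))"
proof (rule lborel_pair.Fubini_integrable)
  have [measurable]: "h1 \<in> borel_measurable borel" "h2 \<in> borel_measurable borel"
    using h by auto
  show "(\<lambda>z. h1 (fst z) * h2 (snd z)) \<in> borel_measurable (lborel \<Otimes>\<^sub>M lborel)"
    by measurable
  have "integrable lborel (\<lambda>x. \<bar>h1 x\<bar> * (LINT y|lborel. \<bar>h2 y\<bar>))"
    using h by (intro integrable_mult_left integrable_abs)
  then show "integrable lborel (\<lambda>x. LINT y|lborel. norm (h1 (fst (x, y)) * h2 (snd (x, y))))"
    by (simp add: abs_mult)
  show "AE x in lborel. integrable lborel (\<lambda>y. h1 (fst (x, y)) * h2 (snd (x, y)))"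
    using h by simp
qed

context radial_flow
begin

text \<open>
The value of \<open>- \<partial>\<^sub>t g\<close> off the interface.
\<close>

definition source :: "real \<Rightarrow> real \<Rightarrow> real" where
  "source t r = r * b' t r + 4 * b t r"

text \<open>
At a fixed positive time the flux terms integrate to \<open>\<integral> \<partial>\<^sub>t v \<bullet> \<Phi>\<close>, so the integrand may be replaced by
the time derivative of \<open>v \<bullet> \<Phi>\<close>.
\<close>

lemma weak_momentum_slice:
  fixes \<Phi> :: "real \<times> (real^2) \<Rightarrow> real^2"
  assumes test: "C1_test ({0..<T} \<times> UNIV) \<Phi> D" and t: "0 < t" "t < T"
  shows "(LINT x|lborel. radial_velocity (g t) x \<bullet> dt (D (t, x)) + radial_stress (g t) (b t) x \<bullet> grad (D (t, x))
      + radial_bernoulli (g t) (p t) x * trace (grad (D (t, x))))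
    = (LINT x|lborel. radial_velocity (g t) x \<bullet> dt (D (t, x)) - source t (norm x) * (perp x \<bullet> \<Phi> (t, x)))"
proof -
  have t': "t \<in> {0..T}" "t \<in> {0<..<T}" using t by auto
  from C1_test_spacetime_bounds[OF test T] obtain L where L: "0 < L" "\<And>x. norm (D (t, x)) \<le> L"
    using t by metis
  have dtL: "norm (dt (D (t, x))) \<le> L" for x
    using norm_blinfun[of "D (t, x)" "(1, 0)"] L(2)[of x] by (simp add: dt_def norm_Pair)
  have "\<forall>i. \<exists>E. C1_test UNIV (\<lambda>x. \<Phi> (t, x) $ i) E \<and> (\<forall>x y. blinfun_apply (E x) y = D (t, x) (0, y) $ i)"
    using C1_test_time_slice[OF test] t by auto
  then obtain E where E: "\<And>i. C1_test UNIV (\<lambda>x. \<Phi> (t, x) $ i) (E i)"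
    "\<And>i x y. blinfun_apply (E i x) y = D (t, x) (0, y) $ i"
    by metis
  have src: "\<bar>r * b' t r + 4 * b t r\<bar> * r \<le> (C * t powr (- 1 / 2)) * r powr (- a)" if "r > 0" for r
    using source_bound[OF t'(2) that] by (simp add: mult_ac)
  note bal = momentum_balance[OF t'(1) E(1) src, unfolded E(2)]
  have "continuous_on UNIV (\<lambda>x. D (t, x))"
    by (rule continuous_on_compose2[where s = UNIV and t = "{0..<T} \<times> UNIV" and g = D])
      (use test t in \<open>auto simp: C1_test_def intro!: continuous_intros\<close>)
  then have [measurable]: "(\<lambda>x. dt (D (t, x))) \<in> borel_measurable borel"
    unfolding dt_def by (intro borel_measurable_continuous_onI continuous_intros)
  note [measurable] = radial_velocity_measurable[OF meas_r(1)[of t]]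
  have vint: "integrable lborel (\<lambda>x. radial_velocity (g t) x \<bullet> dt (D (t, x)))"
  proof (rule integrable_norm_powr_bound[where a = "a - 1" and M = M and C = "C * L"])
    show "norm (radial_velocity (g t) x \<bullet> dt (D (t, x))) \<le> C * L * norm x powr - (a - 1)"
      if "x \<noteq> 0" "norm x \<le> M" for x
    proof -
      have "norm (radial_velocity (g t) x \<bullet> dt (D (t, x))) \<le> norm (radial_velocity (g t) x) * norm (dt (D (t, x)))"
        using Cauchy_Schwarz_ineq2 by simp
      also have "\<dots> \<le> (C * norm x powr (1 - a)) * L"
        using velocity_bound[OF t'(1) that(1)] that(2) dtL C_nonneg by (intro mult_mono) auto
      finally show ?thesis by (simp add: mult_ac)
    qed
    show "radial_velocity (g t) x \<bullet> dt (D (t, x)) = 0" if "norm x > M" for x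
      using support[OF t'(1) that] by (simp add: radial_velocity_def)
  qed (use a M in auto)
  have "(LINT x|lborel. radial_velocity (g t) x \<bullet> dt (D (t, x)) + radial_stress (g t) (b t) x \<bullet> grad (D (t, x))
      + radial_bernoulli (g t) (p t) x * trace (grad (D (t, x))))
    = (LINT x|lborel. radial_velocity (g t) x \<bullet> dt (D (t, x)) +
        (\<Sum>i\<in>UNIV. radial_stress_row (\<lambda>r. (g t r)\<^sup>2) (b t) (p t) i x \<bullet> (\<chi> j. D (t, x) (0, axis j 1) $ i)))"
    by (simp only: radial_stress_contraction add.assoc)
  also have "\<dots> = (LINT x|lborel. radial_velocity (g t) x \<bullet> dt (D (t, x))) +
        (\<Sum>i\<in>UNIV. LINT x|lborel. radial_stress_row (\<lambda>r. (g t r)\<^sup>2) (b t) (p t) i x \<bullet> (\<chi> j. D (t, x) (0, axis j 1) $ i))"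
    using vint bal(1) by (simp add: Bochner_Integration.integral_sum)
  also have "\<dots> = (LINT x|lborel. radial_velocity (g t) x \<bullet> dt (D (t, x))) -
        (\<Sum>i\<in>UNIV. LINT x|lborel. (norm x * b' t (norm x) + 4 * b t (norm x)) * perp x $ i * \<Phi> (t, x) $ i)"
    by (simp only: bal(3) sum_negf diff_conv_add_uminus)
  also have "\<dots> = (LINT x|lborel. radial_velocity (g t) x \<bullet> dt (D (t, x)) -
        (\<Sum>i\<in>UNIV. (norm x * b' t (norm x) + 4 * b t (norm x)) * perp x $ i * \<Phi> (t, x) $ i))"
    using vint bal(2) by (simp add: Bochner_Integration.integral_sum del: perp_nth)
  also have "\<dots> = (LINT x|lborel. radial_velocity (g t) x \<bullet> dt (D (t, x)) - source t (norm x) * (perp x \<bullet> \<Phi> (t, x)))"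
    by (simp add: source_def inner_vec_def sum_2 algebra_simps)
  finally show ?thesis .
qed

text \<open>
The majorant is a product of \<open>t powr (-1/2)\<close> and \<open>|x| powr (- a)\<close>, both restricted to bounded sets.
The bounded factor of the first term is absorbed by
\<open>1 \<le> T powr (1/2) t powr (-1/2)\<close>.
\<close>

lemma weak_momentum_integrable:
  fixes \<Phi> :: "real \<times> (real^2) \<Rightarrow> real^2"
  assumes test: "C1_test ({0..<T} \<times> UNIV) \<Phi> D"
  shows "integrable (lborel \<Otimes>\<^sub>M lborel) (\<lambda>(t, x). indicator {0<..<T} t *
    (radial_velocity (g t) x \<bullet> dt (D (t, x)) - source t (norm x) * (perp x \<bullet> \<Phi> (t, x))))"
    (is "integrable _ ?G")
proof -
  from C1_test_spacetime_bounds[OF test T] obtain M' L where L: "0 < M'" "0 < L"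
    "\<And>t x. 0 < t \<Longrightarrow> t < T \<Longrightarrow> norm (D (t, x)) \<le> L"
    "\<And>t x. 0 \<le> t \<Longrightarrow> t < T \<Longrightarrow> norm (\<Phi> (t, x)) \<le> L"
    "\<And>t x. 0 \<le> t \<Longrightarrow> t < T \<Longrightarrow> M' < norm x \<Longrightarrow> \<Phi> (t, x) = 0"
    by metis
  let ?I = "{0<..<T} \<times> (UNIV :: (real^2) set)"
  define M3 where "M3 = max M M'"
  define K where "K = C * L * M * T powr (1 / 2) + C * L"
  define h1 where "h1 t = K * (indicator {0<..<T} t * t powr (- 1 / 2))" for t :: real
  define h2 where "h2 x = indicator {..M3} (norm x) * norm x powr (- a)" for x :: "real^2"
  have "integrable lborel h1"
    unfolding h1_def using integrable.intros[OF has_bochner_integral_powr_near_0[of "- 1 / 2" T]] T by (intro integrable_mult_right) simp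
  moreover have "integrable lborel h2"
    unfolding h2_def using a M by (intro integrable_norm_powr) (auto simp: M3_def)
  ultimately have H: "integrable (lborel \<Otimes>\<^sub>M lborel) (\<lambda>z. h1 (fst z) * h2 (snd z))"
    by (rule integrable_product_of_functions)
  show ?thesis
  proof (rule Bochner_Integration.integrable_bound[OF H])
    have cD: "continuous_on ?I D"
      by (rule continuous_on_subset[of "{0..<T} \<times> UNIV"]) (use test in \<open>auto simp: C1_test_def\<close>)
    have "continuous_on ({0..<T} \<times> UNIV) \<Phi>"
      using test unfolding C1_test_def by (metis has_derivative_continuous continuous_on_eq_continuous_within)
    then have cP: "continuous_on ?I \<Phi>"
      by (rule continuous_on_subset) auto
    have oI: "?I \<in> sets borel"
      by (intro borel_open open_Times) auto
    have m1: "(\<lambda>z. indicator ?I z *\<^sub>R dt (D z)) \<in> borel_measurable borel"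
      unfolding dt_def by (intro borel_measurable_continuous_on_indicator oI continuous_intros cD)
    have m2: "(\<lambda>z. indicator ?I z *\<^sub>R \<Phi> z) \<in> borel_measurable borel"
      by (intro borel_measurable_continuous_on_indicator oI cP)
    have f: "fst \<in> borel_measurable (borel :: (real \<times> (real^2)) measure)"
      and s: "snd \<in> borel_measurable (borel :: (real \<times> (real^2)) measure)"
      by (auto intro!: borel_measurable_continuous_onI continuous_intros)
    have n: "(\<lambda>z::real \<times> (real^2). norm (snd z)) \<in> borel_measurable borel"
      using s by simp
    have m3: "(\<lambda>z::real \<times> (real^2). g (fst z) (norm (snd z)) *\<^sub>R perp (snd z)) \<in> borel_measurable borel"
      by (intro borel_measurable_scaleR borel_measurable_perp meas_comp f s n)
    have m4: "(\<lambda>z::real \<times> (real^2). norm (snd z) * b' (fst z) (norm (snd z)) + 4 * b (fst z) (norm (snd z))) \<in> borel_measurable borel"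
      by (intro borel_measurable_add borel_measurable_times borel_measurable_const meas_comp f s n)
    have "(\<lambda>z. (g (fst z) (norm (snd z)) *\<^sub>R perp (snd z)) \<bullet> (indicator ?I z *\<^sub>R dt (D z))
       - (norm (snd z) * b' (fst z) (norm (snd z)) + 4 * b (fst z) (norm (snd z))) * (perp (snd z) \<bullet> (indicator ?I z *\<^sub>R \<Phi> z)))
       \<in> borel_measurable borel"
      by (intro borel_measurable_diff borel_measurable_times borel_measurable_inner m1 m2 m3 m4 borel_measurable_perp s)
    also have "(\<lambda>z. (g (fst z) (norm (snd z)) *\<^sub>R perp (snd z)) \<bullet> (indicator ?I z *\<^sub>R dt (D z))
       - (norm (snd z) * b' (fst z) (norm (snd z)) + 4 * b (fst z) (norm (snd z))) * (perp (snd z) \<bullet> (indicator ?I z *\<^sub>R \<Phi> z))) = ?G"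
      by (auto simp: fun_eq_iff indicator_def source_def radial_velocity_def)
    finally show "?G \<in> borel_measurable (lborel \<Otimes>\<^sub>M lborel)"
      by (simp add: lborel_prod)
    have "norm (?G (t, x)) \<le> norm (h1 t * h2 x)" for t x
    proof (cases "t \<in> {0<..<T} \<and> x \<noteq> 0")
      case False
      then show ?thesis by (auto simp: radial_velocity_def)
    next
      case True
      then have t: "0 < t" "t < T" "t \<in> {0..T}" and x: "x \<noteq> 0" by auto
      have dtL: "norm (dt (D (t, x))) \<le> L"
        using norm_blinfun[of "D (t, x)" "(1, 0)"] L(3)[OF t(1,2), of x] by (simp add: dt_def norm_Pair)
      let ?J = "indicator {..M3} (norm x) * norm x powr (- a) :: real"
      have J: "0 \<le> ?J" by simp
      have "\<bar>radial_velocity (g t) x \<bullet> dt (D (t, x))\<bar> \<le> norm (radial_velocity (g t) x) * L"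
        by (rule order_trans[OF Cauchy_Schwarz_ineq2]) (intro mult_left_mono dtL norm_ge_zero)
      also have "norm (radial_velocity (g t) x) \<le> C * M * ?J"
        using g_bounds(1)[OF t(3), of "norm x"] support[OF t(3), of "norm x"] x C_nonneg M
        by (cases "norm x \<le> M") (auto simp: radial_velocity_def M3_def)
      also have "C * M * ?J \<le> C * M * ?J * (T powr (1 / 2) * t powr (- 1 / 2))"
      proof -
        have "t powr (1 / 2) * t powr (- 1 / 2) \<le> T powr (1 / 2) * t powr (- 1 / 2)"
          using t by (intro mult_right_mono powr_mono2) auto
        then have "1 \<le> T powr (1 / 2) * t powr (- 1 / 2)"
          using t by (simp add: powr_add[symmetric])
        then show ?thesis
          using mult_left_mono[of 1 "T powr (1 / 2) * t powr (- 1 / 2)" "C * M * ?J"] C_nonneg M by simp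
      qed
      finally have 1: "\<bar>radial_velocity (g t) x \<bullet> dt (D (t, x))\<bar> \<le> C * M * ?J * (T powr (1 / 2) * t powr (- 1 / 2)) * L"
        using L(2) by (simp add: mult_right_mono)
      have "\<bar>source t (norm x) * (perp x \<bullet> \<Phi> (t, x))\<bar> \<le> (C * t powr (- 1 / 2) * ?J) * L"
      proof (cases "norm x \<le> M'")
        case True
        have "\<bar>source t (norm x) * (perp x \<bullet> \<Phi> (t, x))\<bar> \<le> \<bar>source t (norm x)\<bar> * (norm x * norm (\<Phi> (t, x)))"
          using Cauchy_Schwarz_ineq2[of "perp x" "\<Phi> (t, x)"] by (simp add: abs_mult mult_left_mono)
        also have "\<dots> = (\<bar>source t (norm x)\<bar> * norm x) * norm (\<Phi> (t, x))" by simp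
        also have "\<dots> \<le> (C * norm x powr (- a) * t powr (- 1 / 2)) * L"
          by (rule mult_mono) (use source_bound[of t "norm x"] t x L(4)[of t x] C_nonneg in \<open>auto simp: source_def\<close>)
        finally show ?thesis using True by (simp add: M3_def mult_ac)
      next
        case False
        then show ?thesis using L(5)[of t x] t C_nonneg L(2) by simp
      qed
      with 1 have "\<bar>radial_velocity (g t) x \<bullet> dt (D (t, x)) - source t (norm x) * (perp x \<bullet> \<Phi> (t, x))\<bar>
        \<le> C * M * ?J * (T powr (1 / 2) * t powr (- 1 / 2)) * L + (C * t powr (- 1 / 2) * ?J) * L"
        by (intro order_trans[OF abs_triangle_ineq4] add_mono)
      also have "\<dots> = h1 t * h2 x"
        using t by (simp add: h1_def h2_def K_def algebra_simps)
      finally show ?thesis using t by simp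
    qed
    then show "AE z in lborel \<Otimes>\<^sub>M lborel. norm (?G z) \<le> norm (h1 (fst z) * h2 (snd z))"
      by (intro always_eventually) auto
  qed
qed

text \<open>
For fixed \<open>x \<noteq> 0\<close> the function \<open>v \<bullet> \<Phi>\<close> of time is continuous, has a corner only where the interface
passes \<open>|x|\<close>, and vanishes near \<open>T\<close>; the initial datum is its value at \<open>t = 0\<close>.
\<close>

lemma weak_momentum_time_line:
  fixes \<Phi> :: "real \<times> (real^2) \<Rightarrow> real^2"
  assumes test: "C1_test ({0..<T} \<times> UNIV) \<Phi> D" and x: "x \<noteq> 0"
    and int: "integrable lborel (\<lambda>t. indicator {0<..<T} t *
      (radial_velocity (g t) x \<bullet> dt (D (t, x)) - source t (norm x) * (perp x \<bullet> \<Phi> (t, x))))"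
  shows "(LINT t|lborel. indicator {0<..<T} t *
      (radial_velocity (g t) x \<bullet> dt (D (t, x)) - source t (norm x) * (perp x \<bullet> \<Phi> (t, x))))
    = - (radial_velocity (g 0) x \<bullet> \<Phi> (0, x))"
proof -
  let ?f = "\<lambda>t::real. indicator {0<..<T} t *
      (radial_velocity (g t) x \<bullet> dt (D (t, x)) - source t (norm x) * (perp x \<bullet> \<Phi> (t, x)))"
  from C1_test_spacetime_bounds[OF test T] obtain T' where T': "0 < T'" "T' < T"
    "\<And>t x. 0 \<le> t \<Longrightarrow> t < T \<Longrightarrow> T' < t \<Longrightarrow> \<Phi> (t, x) = 0"
    "\<And>t x. 0 < t \<Longrightarrow> t < T \<Longrightarrow> T' < t \<Longrightarrow> D (t, x) = 0"
    "\<And>t x. 0 < t \<Longrightarrow> t < T \<Longrightarrow> (\<Phi> has_derivative blinfun_apply (D (t, x))) (at (t, x))"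
    by metis
  define S where "S = (T' + T) / 2"
  have S: "0 < S" "S < T" "T' < S" using T' T by (auto simp: S_def)
  define U where "U s = radial_velocity (g s) x \<bullet> \<Phi> (s, x)" for s
  have "continuous_on ({0..<T} \<times> UNIV) \<Phi>"
    using test unfolding C1_test_def by (metis has_derivative_continuous continuous_on_eq_continuous_within)
  then have "continuous_on {0..S} (\<lambda>s. \<Phi> (s, x))"
    by (rule continuous_on_compose2) (use S in \<open>auto intro!: continuous_intros\<close>)
  moreover have "continuous_on {0..S} (\<lambda>s. g s (norm x))"
    by (rule continuous_on_subset[OF cont_t(1)]) (use S x in auto)
  ultimately have "continuous_on {0..S} U"
    unfolding U_def radial_velocity_def by (intro continuous_intros)
  moreover have "(U has_vector_derivative ?f s) (at s)" if s: "s \<in> {0<..<S} - {t. (t, norm x) \<in> N}" for s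
  proof -
    have s': "0 < s" "s < T" "s \<in> {0<..<T}" "(s, norm x) \<notin> N" using s S by auto
    have "((\<lambda>s. (s, x)) has_derivative (\<lambda>h. (h, 0))) (at s)"
      by (intro has_derivative_Pair has_derivative_ident has_derivative_const)
    from has_derivative_compose[OF this T'(5)[OF s'(1,2)]]
    have "((\<lambda>s. \<Phi> (s, x)) has_derivative (\<lambda>h. D (s, x) (h, 0))) (at s)" .
    moreover have "blinfun_apply (D (s, x)) (h, 0) = h *\<^sub>R dt (D (s, x))" for h
      unfolding dt_def blinfun.scaleR_right[symmetric] by simp
    ultimately have d\<Phi>: "((\<lambda>s. \<Phi> (s, x)) has_vector_derivative dt (D (s, x))) (at s)"
      by (simp add: has_vector_derivative_def)
    have "((\<lambda>s. g s (norm x)) has_real_derivative - source s (norm x)) (at s)"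
      unfolding source_def by (rule deriv_t) (use s' x in auto)
    then have "((\<lambda>s. g s (norm x) *\<^sub>R perp x) has_vector_derivative (- source s (norm x)) *\<^sub>R perp x) (at s)"
      by (auto intro!: derivative_eq_intros simp: has_real_derivative_iff_has_vector_derivative)
    from bounded_bilinear.has_vector_derivative[OF bounded_bilinear_inner this d\<Phi>]
    show ?thesis
      using s' unfolding U_def radial_velocity_def by simp
  qed
  ultimately have "(?f has_integral (U S - U 0)) {0..S}"
    by (intro fundamental_theorem_of_calculus_interior_strong[OF interface(2)[of "norm x"]]) (use S in auto)
  moreover have "U S = 0" using T'(3)[of S x] S by (simp add: U_def)
  ultimately have "(?f has_integral - U 0) {0..S}" by simp
  then have "((\<lambda>s. if s \<in> {0..S} then ?f s else 0) has_integral - U 0) UNIV"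
    by (subst has_integral_restrict_UNIV)
  moreover have "(\<lambda>s. if s \<in> {0..S} then ?f s else 0) = ?f"
    using S T'(3,4) by (auto simp: fun_eq_iff indicator_def dt_def)
  ultimately have "(?f has_integral - U 0) UNIV" by simp
  with has_integral_integral_lborel[OF int] show ?thesis
    using has_integral_unique by (auto simp: U_def)
qed

text \<open>
The definition of a subsolution integrates over space first. After the integration by parts at fixed
time, the integrand has a majorant on space-time; then Fubini's theorem puts the time integral inside,
where it is that of a derivative.
\<close>

lemma weak_momentum:
  fixes \<Phi> :: "real \<times> (real^2) \<Rightarrow> real^2"
  assumes test: "C1_test ({0..<T} \<times> UNIV) \<Phi> D"
  shows "(LINT t:{0..<T}|lborel. LINT x|lborel.
      radial_velocity (g t) x \<bullet> dt (D (t, x)) + radial_stress (g t) (b t) x \<bullet> grad (D (t, x))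
        + radial_bernoulli (g t) (p t) x * trace (grad (D (t, x))))
    = - (LINT x|lborel. radial_velocity (g 0) x \<bullet> \<Phi> (0, x))"
proof -
  define G where "G t x = indicator {0<..<T} t *
    (radial_velocity (g t) x \<bullet> dt (D (t, x)) - source t (norm x) * (perp x \<bullet> \<Phi> (t, x)))" for t x
  define I where "I t = (LINT x|lborel. radial_velocity (g t) x \<bullet> dt (D (t, x)) + radial_stress (g t) (b t) x \<bullet> grad (D (t, x))
        + radial_bernoulli (g t) (p t) x * trace (grad (D (t, x))))" for t
  have G: "integrable (lborel \<Otimes>\<^sub>M lborel) (case_prod G)"
    using weak_momentum_integrable[OF test] by (simp add: G_def[abs_def])
  then have [measurable]: "case_prod G \<in> borel_measurable (lborel \<Otimes>\<^sub>M lborel)"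
    by (rule borel_measurable_integrable)
  have Gm[measurable]: "(\<lambda>t. LINT x|lborel. G t x) \<in> borel_measurable lborel"
    by measurable
  have eq: "indicator {0..<T} t * I t = (LINT x|lborel. G t x)" if "t \<noteq> 0" for t
  proof (cases "t \<in> {0<..<T}")
    case True
    then show ?thesis
      using weak_momentum_slice[OF test, of t] by (simp add: G_def I_def)
  next
    case False
    then show ?thesis using that by (auto simp: G_def indicator_def)
  qed
  \<comment> \<open>The slice identity is not available at \<open>t = 0\<close>, which is a single point.\<close>
  have "(\<lambda>t. indicator {0..<T} t * I t) = (\<lambda>t. if t = 0 then I 0 else LINT x|lborel. G t x)"
    using eq T by (auto simp: fun_eq_iff)
  then have m: "(\<lambda>t. indicator {0..<T} t * I t) \<in> borel_measurable lborel"
    by simp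
  have "(LINT t:{0..<T}|lborel. I t) = (LINT t|lborel. indicator {0..<T} t * I t)"
    by (simp add: set_lebesgue_integral_def)
  also have "\<dots> = (LINT t|lborel. LINT x|lborel. G t x)"
    by (rule integral_cong_AE[OF m Gm], rule eventually_mono[OF AE_lborel_singleton[of 0]]) (rule eq)
  also have "\<dots> = (LINT x|lborel. LINT t|lborel. G t x)"
    by (rule lborel_pair.Fubini_integral[OF G, symmetric])
  also have "\<dots> = (LINT x|lborel. - (radial_velocity (g 0) x \<bullet> \<Phi> (0, x)))"
  proof (rule integral_cong_AE)
    show "(\<lambda>x. LINT t|lborel. G t x) \<in> borel_measurable lborel"
      using lborel_pair.integrable_snd[OF G] by (rule borel_measurable_integrable)
    have "continuous_on ({0..<T} \<times> UNIV) \<Phi>"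
      using test unfolding C1_test_def by (metis has_derivative_continuous continuous_on_eq_continuous_within)
    then have "continuous_on UNIV (\<lambda>x. \<Phi> (0, x))"
      by (rule continuous_on_compose2) (use T in \<open>auto intro!: continuous_intros\<close>)
    then show "(\<lambda>x. - (radial_velocity (g 0) x \<bullet> \<Phi> (0, x))) \<in> borel_measurable lborel"
      using borel_measurable_inner[OF radial_velocity_measurable[OF meas_r(1)[of 0]] borel_measurable_continuous_onI]
      by simp
    show "AE x in lborel. (LINT t|lborel. G t x) = - (radial_velocity (g 0) x \<bullet> \<Phi> (0, x))"
      using AE_lborel_singleton[of "0::real^2"] lborel_pair.AE_integrable_snd[OF G]
    proof eventually_elim
      case (elim x)
      then show ?case
        using weak_momentum_time_line[OF test, of x] by (simp add: G_def[abs_def])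
    qed
  qed
  finally show ?thesis by (simp add: I_def)
qed

theorem subsolution:
  "subsolution T (radial_velocity (g 0)) (\<lambda>t. radial_velocity (g t))
     (\<lambda>t. radial_stress (g t) (b t)) (\<lambda>t. radial_bernoulli (g t) (p t))"
proof -
  have "in_Lp 2 (radial_velocity (g 0))"
    using velocity_continuous_L2 T by (auto simp: continuous_into_Lp_def)
  then show ?thesis
    unfolding subsolution_def
    using velocity_continuous_L2 stress_continuous_L1 bernoulli_continuous_L1 velocity_div_free weak_momentum
    by (auto simp: radial_stress_symmetric radial_stress_traceless)
qed

end

section \<open>The steady vortex\<close>

lemma borel_measurable_pos_half_line:
  fixes f :: "real \<Rightarrow> real"
  assumes "continuous_on {0<..} f"
  shows "(\<lambda>r. if 0 < r then f r else 0) \<in> borel_measurable borel"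
proof -
  have "(\<lambda>r. indicator {0<..} r *\<^sub>R f r) \<in> borel_measurable borel"
    by (rule borel_measurable_continuous_on_indicator[OF _ assms]) simp
  also have "(\<lambda>r. indicator {0<..} r *\<^sub>R f r) = (\<lambda>r. if 0 < r then f r else 0)"
    by (auto simp: indicator_def)
  finally show ?thesis .
qed

text \<open>
A logarithmic singularity is weaker than any power; the exponent \<open>k\<close> is chosen according to how much
decay is available.
\<close>

lemma minus_ln_le_powr:
  fixes u :: real
  assumes "0 < u" "0 < k"
  shows "- ln u \<le> (u powr (- k) - 1) / k"
proof -
  have "ln (u powr (- k)) \<le> u powr (- k) - 1"
    using assms by (intro ln_le_minus_one) auto
  then show ?thesis using assms by (simp add: ln_powr field_simps)
qed

text \<open>
The data of the theorem, together with a radius \<open>M\<close> beyond which the cutoff vanishes, a bound \<open>K\<close>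
for \<open>r |\<chi>'|\<close>, and the pressure profile \<open>ps\<close> of the steady vortex, normalised to vanish at infinity.
\<close>

locale truncated_vortex =
  fixes \<alpha> r0 M K :: real and chi chi' ps :: "real \<Rightarrow> real"
  assumes alpha: "0 < \<alpha>" "\<alpha> < 2" and r0: "0 < r0" "r0 \<le> M"
    and chi_deriv: "\<And>r. r > 0 \<Longrightarrow> (chi has_real_derivative chi' r) (at r)"
    and chi'_cont: "continuous_on {0<..} chi'"
    and chi_range: "\<And>r. r > 0 \<Longrightarrow> 0 \<le> chi r \<and> chi r \<le> 1"
    and chi_zero: "\<And>r. r \<ge> M \<Longrightarrow> chi r = 0"
    and chi_one: "\<And>r. 0 < r \<Longrightarrow> r \<le> r0 \<Longrightarrow> chi r = 1"
    and chi'_bound: "\<And>r. r > 0 \<Longrightarrow> \<bar>chi' r\<bar> * r \<le> K"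
    and ps_deriv: "\<And>r. r > 0 \<Longrightarrow> (ps has_real_derivative r * (chi r * r powr (- \<alpha>))\<^sup>2) (at r)"
    and ps_zero: "\<And>r. r \<ge> M \<or> r \<le> 0 \<Longrightarrow> ps r = 0"
begin

text \<open>
The steady angular velocity. The value \<open>0\<close> for \<open>r \<le> 0\<close> makes the profile Borel measurable whatever
the cutoff is on the negative half-line; at the origin it is multiplied by \<open>perp 0 = 0\<close>.
\<close>

definition gs :: "real \<Rightarrow> real" where
  "gs r = (if 0 < r then chi r * r powr (- \<alpha>) else 0)"

definition gs' :: "real \<Rightarrow> real" where
  "gs' r = (if 0 < r then chi' r * r powr (- \<alpha>) - \<alpha> * chi r * r powr (- \<alpha> - 1) else 0)"

definition c :: real where "c = (2 * \<alpha> / (4 - \<alpha>))\<^sup>2"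
definition B :: real where "B = 4 * \<alpha> / (4 - \<alpha>)"
definition T :: real where "T = r0 powr \<alpha> / c"

lemma M_pos: "0 < M" using r0 by simp

lemma c_pos: "0 < c" using alpha by (simp add: c_def)

lemma B_pos: "0 < B" using alpha by (simp add: B_def)

lemma T_pos: "0 < T" using c_pos r0 by (simp add: T_def)

lemma K_nonneg: "0 \<le> K" using chi'_bound[of 1] by simp

lemma chi_cont: "continuous_on {0<..} chi"
  by (intro continuous_at_imp_continuous_on ballI DERIV_isCont[OF chi_deriv]) simp

lemma ps_cont: "continuous_on {0<..} ps"
  by (intro continuous_at_imp_continuous_on ballI DERIV_isCont[OF ps_deriv]) simp

lemma gs_cont: "continuous_on {0<..} gs"
proof -
  have "continuous_on {0<..} (\<lambda>r. chi r * r powr (- \<alpha>))"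
    by (intro continuous_intros chi_cont) auto
  then show ?thesis by (rule continuous_on_eq) (simp add: gs_def)
qed

lemma gs_deriv: "r > 0 \<Longrightarrow> (gs has_real_derivative gs' r) (at r)"
proof -
  assume r: "r > 0"
  have "((\<lambda>r. chi r * r powr (- \<alpha>)) has_real_derivative gs' r) (at r)"
    using r by (auto intro!: derivative_eq_intros chi_deriv simp: gs'_def)
  then show ?thesis
    by (rule has_field_derivative_transform_within_open[where S = "{0<..}"]) (use r in \<open>auto simp: gs_def\<close>)
qed

lemma gs_measurable: "gs \<in> borel_measurable borel"
proof -
  have "continuous_on {0<..} (\<lambda>r. chi r * r powr (- \<alpha>))"
    by (intro continuous_intros chi_cont) auto
  from borel_measurable_pos_half_line[OF this] show ?thesis
    by (simp add: gs_def[abs_def])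
qed

lemma gs'_measurable: "gs' \<in> borel_measurable borel"
proof -
  have "continuous_on {0<..} (\<lambda>r. chi' r * r powr (- \<alpha>) - \<alpha> * chi r * r powr (- \<alpha> - 1))"
    by (intro continuous_intros chi_cont chi'_cont) auto
  from borel_measurable_pos_half_line[OF this] show ?thesis
    by (simp add: gs'_def[abs_def])
qed

lemma ps_measurable: "ps \<in> borel_measurable borel"
proof -
  have "(\<lambda>r. if 0 < r then ps r else 0) = ps"
    using ps_zero by (auto simp: fun_eq_iff)
  with borel_measurable_pos_half_line[OF ps_cont] show ?thesis by simp
qed

lemma gs_bound: "r > 0 \<Longrightarrow> \<bar>gs r\<bar> \<le> r powr (- \<alpha>)"
  using chi_range[of r] by (simp add: gs_def abs_mult mult_left_le_one_le)

lemma gs'_bound: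
  assumes "r > 0"
  shows "\<bar>gs' r\<bar> * r \<le> (K + \<alpha>) * r powr (- \<alpha>)"
proof -
  have "\<bar>gs' r\<bar> * r \<le> (\<bar>chi' r\<bar> * r powr (- \<alpha>) + \<alpha> * \<bar>chi r\<bar> * r powr (- \<alpha> - 1)) * r"
    using assms alpha abs_triangle_ineq4[of "chi' r * r powr (- \<alpha>)" "\<alpha> * chi r * r powr (- \<alpha> - 1)"]
    by (intro mult_right_mono) (auto simp: gs'_def abs_mult)
  also have "\<dots> = (\<bar>chi' r\<bar> * r) * r powr (- \<alpha>) + \<alpha> * \<bar>chi r\<bar> * r powr (- \<alpha>)"
    using assms by (simp add: powr_diff algebra_simps)
  also have "\<dots> \<le> K * r powr (- \<alpha>) + \<alpha> * 1 * r powr (- \<alpha>)"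
    using assms alpha chi'_bound[of r] chi_range[of r]
    by (intro add_mono mult_right_mono mult_left_mono) auto
  finally show ?thesis by (simp add: distrib_right)
qed

lemma gs_square: "r > 0 \<Longrightarrow> r * (gs r)\<^sup>2 = r * (chi r * r powr (- \<alpha>))\<^sup>2"
  by (simp add: gs_def)

lemma powr_le_M: 
  assumes "0 < r" "r \<le> M"
  shows "r powr (2 - 2 * \<alpha>) \<le> M powr (2 - \<alpha>) * r powr (- \<alpha>)"
proof -
  have "r powr (2 - 2 * \<alpha>) = r powr (2 - \<alpha>) * r powr (- \<alpha>)"
    by (simp add: powr_add[symmetric])
  also have "\<dots> \<le> M powr (2 - \<alpha>) * r powr (- \<alpha>)"
    using assms alpha by (intro mult_right_mono powr_mono2) auto
  finally show ?thesis .
qed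

text \<open>
The pressure is nonpositive because it increases to \<open>0\<close>, and \<open>ps + const r powr (- \<alpha>)\<close> is
nonincreasing because \<open>ps' \<le> r powr (1 - 2 \<alpha>) \<le> M powr (2 - \<alpha>) r powr (- \<alpha> - 1)\<close>.
\<close>

lemma ps_bound:
  assumes r: "r > 0"
  shows "\<bar>ps r\<bar> \<le> M powr (2 - \<alpha>) / \<alpha> * r powr (- \<alpha>)"
proof (cases "r \<le> M")
  case True
  have "ps r \<le> ps M"
  proof (rule DERIV_nonneg_imp_nondecreasing[OF True])
    fix x assume "r \<le> x" "x \<le> M"
    then show "\<exists>y. DERIV ps x :> y \<and> y \<ge> 0"
      using r ps_deriv[of x] by (intro exI[of _ "x * (chi x * x powr (- \<alpha>))\<^sup>2"]) auto
  qed
  then have le: "ps r \<le> 0" using ps_zero by simp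
  define C where "C = M powr (2 - \<alpha>) / \<alpha>"
  have "ps M + C * M powr (- \<alpha>) \<le> ps r + C * r powr (- \<alpha>)"
  proof (rule DERIV_nonpos_imp_nonincreasing[OF True])
    fix x assume x: "r \<le> x" "x \<le> M"
    then have x0: "0 < x" using r by simp
    have "((\<lambda>x. ps x + C * x powr (- \<alpha>)) has_real_derivative
        x * (chi x * x powr (- \<alpha>))\<^sup>2 + C * (- \<alpha> * x powr (- \<alpha> - 1))) (at x)"
      using x0 by (auto intro!: derivative_eq_intros ps_deriv)
    moreover have "x * (chi x * x powr (- \<alpha>))\<^sup>2 + C * (- \<alpha> * x powr (- \<alpha> - 1)) \<le> 0"
    proof -
      have "x * (chi x * x powr (- \<alpha>))\<^sup>2 \<le> x * (1 * x powr (- \<alpha>))\<^sup>2"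
        using x0 chi_range[of x] by (intro mult_left_mono power_mono mult_right_mono) auto
      also have "\<dots> = x powr (2 - 2 * \<alpha>) * x powr (-1)"
      proof -
        have "x * (1 * x powr (- \<alpha>))\<^sup>2 = x powr 1 * (x powr (- \<alpha>) * x powr (- \<alpha>))"
          using x0 by (simp add: power2_eq_square)
        also have "\<dots> = x powr (2 - 2 * \<alpha>) * x powr (-1)"
          by (simp only: powr_add[symmetric]) (simp add: algebra_simps)
        finally show ?thesis .
      qed
      also have "\<dots> \<le> (M powr (2 - \<alpha>) * x powr (- \<alpha>)) * x powr (-1)"
        using powr_le_M[OF x0 x(2)] by (intro mult_right_mono) auto
      also have "\<dots> = M powr (2 - \<alpha>) * (x powr (- \<alpha>) * x powr (-1))"
        by (rule mult.assoc)
      also have "x powr (- \<alpha>) * x powr (-1) = x powr (- \<alpha> - 1)"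
        by (simp only: powr_add[symmetric]) simp
      also have "M powr (2 - \<alpha>) * x powr (- \<alpha> - 1) = C * \<alpha> * x powr (- \<alpha> - 1)"
        using alpha by (simp add: C_def)
      finally show ?thesis by simp
    qed
    ultimately show "\<exists>y. DERIV (\<lambda>x. ps x + C * x powr (- \<alpha>)) x :> y \<and> y \<le> 0" by blast
  qed
  moreover have "0 \<le> C" using alpha by (simp add: C_def)
  ultimately have "- ps r \<le> C * r powr (- \<alpha>)"
    using ps_zero[of M] by (smt (verit) mult_nonneg_nonneg powr_ge_zero)
  with le show ?thesis by (simp add: C_def)
next
  case False
  then show ?thesis using ps_zero[of r] alpha by simp
qed

lemma steady_radial_flow:
  "radial_flow \<alpha> M (Max {1, M powr (2 - \<alpha>) / \<alpha>}) T (\<lambda>_. gs) (\<lambda>_. gs') (\<lambda>_ _. 0) (\<lambda>_ _. 0) (\<lambda>_. ps) {}"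
proof
  let ?C = "Max {1, M powr (2 - \<alpha>) / \<alpha>}"
  have mono: "z \<le> ?C * r powr (- \<alpha>)" if "z \<le> k * r powr (- \<alpha>)" "k \<le> ?C" for z k r
    using that by (meson mult_right_mono order_trans powr_ge_zero)
  have s: "snd \<in> borel_measurable (borel :: (real \<times> real) measure)"
    by (auto intro!: borel_measurable_continuous_onI continuous_intros)
  show "(\<lambda>z::real\<times>real. gs (snd z)) \<in> borel_measurable borel" "(\<lambda>z::real\<times>real. ps (snd z)) \<in> borel_measurable borel"
    "(\<lambda>z::real\<times>real. gs' (snd z)) \<in> borel_measurable borel"
    by (rule measurable_compose[OF s gs_measurable] measurable_compose[OF s ps_measurable]
          measurable_compose[OF s gs'_measurable])+
  show "\<bar>gs r\<bar> \<le> ?C * r powr - \<alpha>" if "r > 0" for r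
    using mono[of "\<bar>gs r\<bar>" 1 r] gs_bound[OF that] by simp
  show "\<bar>ps r\<bar> \<le> ?C * r powr - \<alpha>" if "r > 0" for r
    by (rule mono[OF ps_bound[OF that]]) simp
  show "\<exists>C'. \<forall>r>0. \<bar>gs' r\<bar> * r \<le> C' * r powr - \<alpha> \<and> \<bar>0\<bar> * r ^ 3 \<le> C' * r powr - \<alpha>"
    using gs'_bound K_nonneg alpha by (intro exI[of _ "K + \<alpha>"]) auto
  show "gs r = 0 \<and> (0::real) = 0 \<and> ps r = 0" if "r > M" for r
    using that chi_zero[of r] ps_zero[of r] by (simp add: gs_def)
  show "(ps has_real_derivative r * (gs r)\<^sup>2) (at r)" if "r > 0" for r
    by (simp only: gs_square[OF that] ps_deriv[OF that])
qed (use alpha M_pos T_pos gs_cont ps_cont gs_deriv in auto)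

section \<open>The fan: profiles and their derivatives\<close>

text \<open>
The radius of the front.
\<close>

definition R :: "real \<Rightarrow> real" where "R t = (c * t) powr (1 / \<alpha>)"

text \<open>
The relaxed region \<open>0 < r \<le> R t\<close>, in a form that also makes sense, and is empty, at \<open>t = 0\<close>.
\<close>

definition inside :: "real \<Rightarrow> real \<Rightarrow> bool" where
  "inside t r \<longleftrightarrow> 0 < r \<and> r powr \<alpha> \<le> c * t"

text \<open>
The quantity \<open>B ln (r / R t)\<close>; it is zero at the front and negative inside.
\<close>

definition lam :: "real \<Rightarrow> real \<Rightarrow> real" where
  "lam t r = B * ln r - B / \<alpha> * ln (c * t)"

definition fan_g :: "real \<Rightarrow> real \<Rightarrow> real" where
  "fan_g t r = (if inside t r then (1 - lam t r) / (c * t) else gs r)"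

definition fan_g' :: "real \<Rightarrow> real \<Rightarrow> real" where
  "fan_g' t r = (if inside t r then - B / (r * (c * t)) else gs' r)"

definition fan_b :: "real \<Rightarrow> real \<Rightarrow> real" where
  "fan_b t r = (if inside t r then - lam t r / (4 * c * t\<^sup>2) else 0)"

definition fan_b' :: "real \<Rightarrow> real \<Rightarrow> real" where
  "fan_b' t r = (if inside t r then - B / (4 * c * t\<^sup>2 * r) else 0)"

text \<open>
The inner branch integrates \<open>p' = r g\<^sup>2 = r (1 - lam)\<^sup>2 / (c t)\<^sup>2\<close> from the front inwards, starting
from the steady value at \<open>R t\<close>.
\<close>

definition fan_p :: "real \<Rightarrow> real \<Rightarrow> real" where
  "fan_p t r = (if inside t r
     then ps (R t) + (r\<^sup>2 * ((1 - lam t r)\<^sup>2 + B * (1 - lam t r) + B\<^sup>2 / 2)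
            - (R t)\<^sup>2 * (1 + B + B\<^sup>2 / 2)) / (2 * (c * t)\<^sup>2)
     else ps r)"

definition front :: "(real \<times> real) set" where
  "front = {(t, r). 0 < r \<and> r powr \<alpha> = c * t}"

lemma c_T: "c * T = r0 powr \<alpha>"
  using c_pos by (simp add: T_def)

lemma R_pos: "t > 0 \<Longrightarrow> 0 < R t"
  using c_pos by (simp add: R_def)

lemma R_powr: "t \<ge> 0 \<Longrightarrow> R t powr \<alpha> = c * t"
  using c_pos alpha by (simp add: R_def powr_powr)

lemma inside_iff: "t > 0 \<Longrightarrow> inside t r \<longleftrightarrow> 0 < r \<and> r \<le> R t"
  using powr_mono2[of \<alpha> r "R t"] powr_less_mono2[of \<alpha> "R t" r] R_powr[of t] R_pos[of t] alpha
  by (auto simp: inside_def not_le[symmetric])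

lemma inside_pos: "inside t r \<Longrightarrow> 0 < t \<and> 0 < r"
proof -
  assume i: "inside t r"
  then have "0 < c * t"
    using order_less_le_trans[of 0 "r powr \<alpha>" "c * t"] by (simp add: inside_def)
  with i c_pos show ?thesis by (simp add: inside_def zero_less_mult_iff)
qed

lemma not_inside_0: "\<not> inside 0 r"
  by (simp add: inside_def)

lemma R_le: "0 < t \<Longrightarrow> t \<le> T \<Longrightarrow> R t \<le> r0"
proof -
  assume t: "0 < t" "t \<le> T"
  have "c * t \<le> r0 powr \<alpha>" using t c_pos c_T by (metis mult_left_mono less_imp_le)
  then have "R t \<le> (r0 powr \<alpha>) powr (1 / \<alpha>)"
    unfolding R_def using t c_pos alpha by (intro powr_mono2) auto
  then show ?thesis using alpha r0 by (simp add: powr_powr)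
qed

lemma inside_le: "inside t r \<Longrightarrow> t \<le> T \<Longrightarrow> r \<le> r0"
  using inside_iff[of t r] inside_pos[of t r] R_le[of t] by auto

lemma front_le: "(t, r) \<in> front \<Longrightarrow> t \<le> T \<Longrightarrow> inside t r \<and> r \<le> r0"
  using inside_le[of t r] by (auto simp: front_def inside_def)

text \<open>
In terms of the similarity variable \<open>u = r powr \<alpha> / (c t)\<close>, which runs through \<open>(0, 1]\<close> in the
relaxed region; all bounds below are bounds in \<open>u\<close>.
\<close>

lemma lam_eq:
  assumes "0 < t" "0 < r"
  shows "lam t r = B / \<alpha> * ln (r powr \<alpha> / (c * t))"
  using assms c_pos alpha by (simp add: lam_def ln_div ln_powr right_diff_distrib)

lemma lam_front: "(t, r) \<in> front \<Longrightarrow> lam t r = 0"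
  using lam_eq[of t r] inside_pos[of t r] by (cases "t > 0") (auto simp: front_def inside_def)

lemma lam_nonpos:
  assumes "inside t r"
  shows "lam t r \<le> 0"
proof -
  have t: "0 < t" "0 < r" "r powr \<alpha> \<le> c * t"
    using inside_pos[OF assms] assms by (auto simp: inside_def)
  then have "ln (r powr \<alpha> / (c * t)) \<le> 0"
    using c_pos by (subst ln_le_zero_iff) auto
  then have "B / \<alpha> * ln (r powr \<alpha> / (c * t)) \<le> 0"
    using B_pos alpha by (intro mult_nonneg_nonpos) auto
  then show ?thesis using lam_eq[OF t(1,2)] by simp
qed

lemma lam_deriv_r: "r > 0 \<Longrightarrow> (lam t has_real_derivative B / r) (at r)"
  unfolding lam_def[abs_def] by (auto intro!: derivative_eq_intros)

lemma lam_deriv_t: "t > 0 \<Longrightarrow> ((\<lambda>t. lam t r) has_real_derivative - (B / \<alpha>) / t) (at t)"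
  unfolding lam_def using c_pos alpha by (auto intro!: derivative_eq_intros simp: field_simps)

text \<open>
This identity between \<open>B\<close> and \<open>\<alpha>\<close> is what makes the profiles satisfy the angular momentum balance.
\<close>

lemma B_alpha: "B / \<alpha> - 1 = B / 4"
  using alpha by (simp add: B_def field_simps)

lemma gs_inner: "0 < r \<Longrightarrow> r \<le> r0 \<Longrightarrow> gs r = r powr (- \<alpha>)"
  using chi_one[of r] by (simp add: gs_def)

text \<open>
The inner and outer branches agree on the front. For the velocity this is where \<open>r powr \<alpha> = c t\<close>
is used, together with \<open>R t \<le> r0\<close>, which keeps the front in the region where the cutoff is \<open>1\<close>.
\<close>

lemma front_values:
  assumes "(t, r) \<in> front" "t \<le> T"
  shows "(1 - lam t r) / (c * t) = gs r" "- lam t r / (4 * c * t\<^sup>2) = 0"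
    "ps (R t) + (r\<^sup>2 * ((1 - lam t r)\<^sup>2 + B * (1 - lam t r) + B\<^sup>2 / 2)
            - (R t)\<^sup>2 * (1 + B + B\<^sup>2 / 2)) / (2 * (c * t)\<^sup>2) = ps r"
proof -
  have t: "0 < t" "0 < r" "r \<le> r0" "r powr \<alpha> = c * t"
    using front_le[OF assms] inside_pos[of t r] assms(1) by (auto simp: front_def)
  have rR: "R t = r"
    using t alpha by (simp add: R_def t(4)[symmetric] powr_powr)
  show "(1 - lam t r) / (c * t) = gs r" "- lam t r / (4 * c * t\<^sup>2) = 0"
    "ps (R t) + (r\<^sup>2 * ((1 - lam t r)\<^sup>2 + B * (1 - lam t r) + B\<^sup>2 / 2)
            - (R t)\<^sup>2 * (1 + B + B\<^sup>2 / 2)) / (2 * (c * t)\<^sup>2) = ps r"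
    using t gs_inner[of r] by (simp_all add: rR lam_front[OF assms(1)] powr_minus_divide)
qed

lemma fan_cont_r:
  assumes t: "t \<in> {0..T}"
  shows "continuous_on {0<..} (fan_g t)" "continuous_on {0<..} (fan_b t)" "continuous_on {0<..} (fan_p t)"
proof -
  have h: "continuous_on {0<..} (\<lambda>r. r powr \<alpha>)"
    by (intro continuous_intros) auto
  let ?S = "{r \<in> {0<..}. r powr \<alpha> \<le> c * t}"
  have ins: "0 < t" if "r \<in> ?S" for r
    using inside_pos[of t r] that by (simp add: inside_def)
  have nz: "c * t \<noteq> 0" "4 * c * t\<^sup>2 \<noteq> 0" "2 * (c * t)\<^sup>2 \<noteq> 0" if "r \<in> ?S" for r
    using ins[OF that] c_pos by auto
  have lamc: "continuous_on ?S (lam t)"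
    unfolding lam_def[abs_def] by (intro continuous_intros) auto
  have fr: "(t, r) \<in> front" if "r \<in> {0<..}" "r powr \<alpha> = c * t" for r
    using that by (simp add: front_def)
  have tT: "t \<le> T" using t by simp
  have "continuous_on {0<..} (\<lambda>r. if r powr \<alpha> \<le> c * t then (1 - lam t r) / (c * t) else gs r)"
  proof (rule continuous_on_cases_le[OF _ _ h])
    show "continuous_on ?S (\<lambda>r. (1 - lam t r) / (c * t))"
      using nz by (intro continuous_intros lamc) blast
  qed (rule continuous_on_subset[OF gs_cont], blast, rule front_values(1)[OF fr tT])
  then show "continuous_on {0<..} (fan_g t)"
    by (rule continuous_on_eq) (simp add: fan_g_def inside_def)
  have "continuous_on {0<..} (\<lambda>r. if r powr \<alpha> \<le> c * t then - lam t r / (4 * c * t\<^sup>2) else 0)"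
  proof (rule continuous_on_cases_le[OF _ _ h])
    show "continuous_on ?S (\<lambda>r. - lam t r / (4 * c * t\<^sup>2))"
      using nz by (intro continuous_intros lamc) blast
  qed (rule continuous_on_const, rule front_values(2)[OF fr tT])
  then show "continuous_on {0<..} (fan_b t)"
    by (rule continuous_on_eq) (simp add: fan_b_def inside_def)
  have "continuous_on {0<..} (\<lambda>r. if r powr \<alpha> \<le> c * t then
     ps (R t) + (r\<^sup>2 * ((1 - lam t r)\<^sup>2 + B * (1 - lam t r) + B\<^sup>2 / 2)
            - (R t)\<^sup>2 * (1 + B + B\<^sup>2 / 2)) / (2 * (c * t)\<^sup>2) else ps r)"
  proof (rule continuous_on_cases_le[OF _ _ h])
    show "continuous_on ?S (\<lambda>r. ps (R t) + (r\<^sup>2 * ((1 - lam t r)\<^sup>2 + B * (1 - lam t r) + B\<^sup>2 / 2)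
            - (R t)\<^sup>2 * (1 + B + B\<^sup>2 / 2)) / (2 * (c * t)\<^sup>2))"
      using nz by (intro continuous_intros lamc) auto
  qed (rule continuous_on_subset[OF ps_cont], blast, rule front_values(3)[OF fr tT])
  then show "continuous_on {0<..} (fan_p t)"
    by (rule continuous_on_eq) (simp add: fan_p_def inside_def)
qed

lemma fan_cont_t:
  assumes r: "r > 0"
  shows "continuous_on {0..T} (\<lambda>t. fan_g t r)" "continuous_on {0..T} (\<lambda>t. fan_b t r)"
    "continuous_on {0..T} (\<lambda>t. fan_p t r)"
proof -
  let ?S = "{t \<in> {0..T}. - (c * t) \<le> - (r powr \<alpha>)}"
  have h: "continuous_on {0..T} (\<lambda>t. - (c * t))"
    by (intro continuous_intros)
  have pos: "0 < t" if "t \<in> ?S" for t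
    using inside_pos[of t r] that r by (simp add: inside_def)
  have ctS: "0 < c * t" if "t \<in> ?S" for t
    using pos[OF that] c_pos by simp
  have lamc: "continuous_on ?S (\<lambda>t. lam t r)"
    unfolding lam_def by (intro continuous_intros) (use ctS c_pos in fastforce)
  have Rc: "continuous_on ?S R"
    unfolding R_def[abs_def] by (intro continuous_intros) (use ctS c_pos in fastforce)
  have psR: "continuous_on ?S (\<lambda>t. ps (R t))"
    by (rule continuous_on_compose2[OF ps_cont Rc]) (use pos R_pos in auto)
  have nz: "c * t \<noteq> 0" "2 * (c * t)\<^sup>2 \<noteq> 0" "4 * c * t\<^sup>2 \<noteq> 0" if "t \<in> ?S" for t
    using pos[OF that] c_pos by auto
  have fr: "(t, r) \<in> front" "t \<le> T" if "t \<in> {0..T}" "- (c * t) = - (r powr \<alpha>)" for t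
    using that r by (simp_all add: front_def)
  have "continuous_on {0..T} (\<lambda>t. if - (c * t) \<le> - (r powr \<alpha>) then (1 - lam t r) / (c * t) else gs r)"
  proof (rule continuous_on_cases_le[OF _ _ h])
    show "continuous_on ?S (\<lambda>t. (1 - lam t r) / (c * t))"
      using nz by (intro continuous_intros lamc) blast
  qed (rule continuous_on_const, rule front_values(1)[OF fr])
  then show "continuous_on {0..T} (\<lambda>t. fan_g t r)"
    by (rule continuous_on_eq) (use r in \<open>simp add: fan_g_def inside_def\<close>)
  have "continuous_on {0..T} (\<lambda>t. if - (c * t) \<le> - (r powr \<alpha>) then - lam t r / (4 * c * t\<^sup>2) else 0)"
  proof (rule continuous_on_cases_le[OF _ _ h])
    show "continuous_on ?S (\<lambda>t. - lam t r / (4 * c * t\<^sup>2))"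
      using nz by (intro continuous_intros lamc) blast
  qed (rule continuous_on_const, rule front_values(2)[OF fr])
  then show "continuous_on {0..T} (\<lambda>t. fan_b t r)"
    by (rule continuous_on_eq) (use r in \<open>simp add: fan_b_def inside_def\<close>)
  have "continuous_on {0..T} (\<lambda>t. if - (c * t) \<le> - (r powr \<alpha>) then
     ps (R t) + (r\<^sup>2 * ((1 - lam t r)\<^sup>2 + B * (1 - lam t r) + B\<^sup>2 / 2)
            - (R t)\<^sup>2 * (1 + B + B\<^sup>2 / 2)) / (2 * (c * t)\<^sup>2) else ps r)"
  proof (rule continuous_on_cases_le[OF _ _ h])
    show "continuous_on ?S (\<lambda>t. ps (R t) + (r\<^sup>2 * ((1 - lam t r)\<^sup>2 + B * (1 - lam t r) + B\<^sup>2 / 2)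
            - (R t)\<^sup>2 * (1 + B + B\<^sup>2 / 2)) / (2 * (c * t)\<^sup>2))"
      by (intro continuous_intros lamc Rc psR) (use nz in auto)
  qed (rule continuous_on_const, rule front_values(3)[OF fr])
  then show "continuous_on {0..T} (\<lambda>t. fan_p t r)"
    by (rule continuous_on_eq) (use r in \<open>simp add: fan_p_def inside_def\<close>)
qed

lemma fan_deriv_r:
  assumes r: "r > 0" "(t, r) \<notin> front"
  shows "(fan_g t has_real_derivative fan_g' t r) (at r)" (is "?G")
    "(fan_b t has_real_derivative fan_b' t r) (at r)" (is "?B")
    "(fan_p t has_real_derivative r * (fan_g t r)\<^sup>2) (at r)" (is "?P")
proof -
  have h: "continuous_on {0<..} (\<lambda>r. r powr \<alpha>)"
    by (intro continuous_intros) auto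
  have "r powr \<alpha> < c * t \<or> c * t < r powr \<alpha>"
    using r by (auto simp: front_def)
  then have "?G \<and> ?B \<and> ?P"
  proof
    assume less: "r powr \<alpha> < c * t"
    let ?S = "{0<..} \<inter> (\<lambda>s. s powr \<alpha>) -` {..<c * t}"
    have S: "open ?S"
      by (rule continuous_open_preimage[OF h]) simp_all
    have ins: "inside t s" if "s \<in> ?S" for s using that by (simp add: inside_def)
    have rS: "r \<in> ?S" using r less by simp
    have t: "0 < t" using inside_pos[OF ins[OF rS]] by simp
    have ct: "c * t \<noteq> 0" using t c_pos by simp
    note d = lam_deriv_r[OF r(1), of t]
    have "((\<lambda>r. (1 - lam t r) / (c * t)) has_real_derivative fan_g' t r) (at r)"
      using ins[OF rS] t c_pos r by (auto intro!: derivative_eq_intros d simp: fan_g'_def field_simps)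
    then have 1: "(fan_g t has_real_derivative fan_g' t r) (at r)"
      by (rule has_field_derivative_transform_within_open[OF _ S rS]) (use ins in \<open>auto simp: fan_g_def\<close>)
    have "((\<lambda>r. - lam t r / (4 * c * t\<^sup>2)) has_real_derivative fan_b' t r) (at r)"
      using ins[OF rS] t c_pos r by (auto intro!: derivative_eq_intros d simp: fan_b'_def field_simps)
    then have 2: "(fan_b t has_real_derivative fan_b' t r) (at r)"
      by (rule has_field_derivative_transform_within_open[OF _ S rS]) (use ins in \<open>auto simp: fan_b_def\<close>)
    let ?l = "lam t r"
    have "((\<lambda>r. r\<^sup>2 * ((1 - lam t r)\<^sup>2 + B * (1 - lam t r) + B\<^sup>2 / 2)) has_real_derivative
        2 * r * ((1 - ?l)\<^sup>2 + B * (1 - ?l) + B\<^sup>2 / 2) + r\<^sup>2 * (2 * (1 - ?l) * (- (B / r)) + B * (- (B / r)))) (at r)"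
      by (auto intro!: derivative_eq_intros d)
    also have "2 * r * ((1 - ?l)\<^sup>2 + B * (1 - ?l) + B\<^sup>2 / 2) + r\<^sup>2 * (2 * (1 - ?l) * (- (B / r)) + B * (- (B / r)))
       = 2 * r * (1 - ?l)\<^sup>2"
      using r by (simp add: field_simps power2_eq_square)
    finally have dq: "((\<lambda>r. r\<^sup>2 * ((1 - lam t r)\<^sup>2 + B * (1 - lam t r) + B\<^sup>2 / 2)) has_real_derivative
        2 * r * (1 - ?l)\<^sup>2) (at r)" .
    have "((\<lambda>r. ps (R t) + (r\<^sup>2 * ((1 - lam t r)\<^sup>2 + B * (1 - lam t r) + B\<^sup>2 / 2)
            - (R t)\<^sup>2 * (1 + B + B\<^sup>2 / 2)) / (2 * (c * t)\<^sup>2)) has_real_derivative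
          0 + (2 * r * (1 - ?l)\<^sup>2 - 0) / (2 * (c * t)\<^sup>2)) (at r)"
      by (intro DERIV_add DERIV_const DERIV_cdivide DERIV_diff dq)
    also have "0 + (2 * r * (1 - ?l)\<^sup>2 - 0) / (2 * (c * t)\<^sup>2) = r * (fan_g t r)\<^sup>2"
      using ins[OF rS] by (simp add: fan_g_def power_divide)
    finally have 3: "(fan_p t has_real_derivative r * (fan_g t r)\<^sup>2) (at r)"
      by (rule has_field_derivative_transform_within_open[OF _ S rS]) (use ins in \<open>auto simp: fan_p_def\<close>)
    show ?thesis using 1 2 3 by blast
  next
    assume less: "c * t < r powr \<alpha>"
    let ?S = "{0<..} \<inter> (\<lambda>s. s powr \<alpha>) -` {c * t<..}"
    have S: "open ?S"
      by (rule continuous_open_preimage[OF h]) simp_all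
    have ins: "\<not> inside t s" if "s \<in> ?S" for s using that by (simp add: inside_def)
    have rS: "r \<in> ?S" using r less by simp
    have "(gs has_real_derivative fan_g' t r) (at r)"
      using ins[OF rS] gs_deriv[OF r(1)] by (simp add: fan_g'_def)
    then have 1: "(fan_g t has_real_derivative fan_g' t r) (at r)"
      by (rule has_field_derivative_transform_within_open[OF _ S rS]) (use ins in \<open>auto simp: fan_g_def\<close>)
    have "((\<lambda>_. 0) has_real_derivative fan_b' t r) (at r)"
      using ins[OF rS] by (simp add: fan_b'_def)
    then have 2: "(fan_b t has_real_derivative fan_b' t r) (at r)"
      by (rule has_field_derivative_transform_within_open[OF _ S rS]) (use ins in \<open>auto simp: fan_b_def\<close>)
    have "(ps has_real_derivative r * (fan_g t r)\<^sup>2) (at r)"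
      using ins[OF rS] ps_deriv[OF r(1)] r by (simp add: fan_g_def gs_def)
    then have 3: "(fan_p t has_real_derivative r * (fan_g t r)\<^sup>2) (at r)"
      by (rule has_field_derivative_transform_within_open[OF _ S rS]) (use ins in \<open>auto simp: fan_p_def\<close>)
    show ?thesis using 1 2 3 by blast
  qed
  then show ?G ?B ?P by blast+
qed

text \<open>
Inside, the derivative of \<open>(1 - lam) / (c t)\<close> is \<open>(B/\<alpha> - 1 + lam) / (c t\<^sup>2)\<close>; outside, both sides
vanish.
\<close>

lemma fan_deriv_t:
  assumes r: "r > 0" "(t, r) \<notin> front"
  shows "((\<lambda>t. fan_g t r) has_real_derivative - (r * fan_b' t r + 4 * fan_b t r)) (at t)"
proof (cases "r powr \<alpha> < c * t")
  case True
  let ?S = "{r powr \<alpha> / c <..}"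
  have tS: "t \<in> ?S" using True c_pos by (simp add: field_simps)
  have ins: "inside s r" if "s \<in> ?S" for s
    using that r c_pos by (simp add: inside_def field_simps)
  have t: "0 < t" using inside_pos[OF ins[OF tS]] by simp
  have "((\<lambda>t. (1 - lam t r) / (c * t)) has_real_derivative
     ((0 - - (B / \<alpha>) / t) * (c * t) - (1 - lam t r) * (c * 1)) / ((c * t) * (c * t))) (at t)"
    using t c_pos by (intro DERIV_divide DERIV_diff DERIV_const lam_deriv_t DERIV_cmult DERIV_ident) auto
  also have "((0 - - (B / \<alpha>) / t) * (c * t) - (1 - lam t r) * (c * 1)) / ((c * t) * (c * t))
    = ((B / \<alpha> - 1) + lam t r) / (c * t\<^sup>2)"
    using t c_pos alpha by (simp add: divide_simps power2_eq_square) (simp add: algebra_simps)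
  also have "\<dots> = - (r * fan_b' t r + 4 * fan_b t r)"
    using ins[OF tS] t c_pos r unfolding B_alpha
    by (simp add: fan_b'_def fan_b_def divide_simps power2_eq_square)
  finally show ?thesis
    by (rule has_field_derivative_transform_within_open[OF _ open_greaterThan tS]) (use ins in \<open>auto simp: fan_g_def\<close>)
next
  case False
  let ?S = "{..<r powr \<alpha> / c}"
  have tS: "t \<in> ?S" using False c_pos r by (auto simp: front_def field_simps)
  have ins: "\<not> inside s r" if "s \<in> ?S" for s
    using that r c_pos by (simp add: inside_def field_simps)
  have "((\<lambda>_. gs r) has_real_derivative - (r * fan_b' t r + 4 * fan_b t r)) (at t)"
    using ins[OF tS] by (simp add: fan_b'_def fan_b_def)
  then show ?thesis
    by (rule has_field_derivative_transform_within_open[OF _ open_lessThan tS]) (use ins in \<open>auto simp: fan_g_def\<close>)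
qed

end

section \<open>The fan: bounds\<close>

lemma measurable_power_region:
  fixes a k :: real
  shows "{z \<in> space (borel :: (real \<times> real) measure). 0 < snd z \<and> snd z powr a \<le> k * fst z} \<in> sets borel"
proof -
  have [measurable]: "fst \<in> borel_measurable (borel :: (real \<times> real) measure)"
    "snd \<in> borel_measurable (borel :: (real \<times> real) measure)"
    by (auto intro!: borel_measurable_continuous_onI continuous_intros)
  show ?thesis by measurable
qed
context truncated_vortex
begin

lemma inside_ratio:
  assumes "inside t r"
  defines "u \<equiv> r powr \<alpha> / (c * t)"
  shows "0 < u" "u \<le> 1" "1 / (c * t) = u * r powr (- \<alpha>)" "1 / (c * t) \<le> r powr (- \<alpha>)" "0 < c * t"
proof -
  have t: "0 < t" "0 < r" "r powr \<alpha> \<le> c * t"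
    using inside_pos[OF assms(1)] assms(1) by (auto simp: inside_def)
  show ct: "0 < c * t" using t c_pos by simp
  show u: "0 < u" "u \<le> 1" using t ct by (auto simp: u_def)
  show eq: "1 / (c * t) = u * r powr (- \<alpha>)"
    using t by (simp add: u_def powr_minus)
  show "1 / (c * t) \<le> r powr (- \<alpha>)"
    unfolding eq using mult_right_mono[OF u(2), of "r powr (- \<alpha>)"] by simp
qed

text \<open>
The logarithm is either absorbed by a full factor \<open>u\<close>, or it costs \<open>u powr (-1/2)\<close>, which the time
derivative can afford.
\<close>

lemma lam_lower:
  assumes "inside t r"
  defines "u \<equiv> r powr \<alpha> / (c * t)"
  shows "u * (1 - lam t r) \<le> 1 + B / \<alpha>"
    and "- lam t r \<le> 2 * (B / \<alpha>) * u powr (- 1 / 2)"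
proof -
  note u = inside_ratio[OF assms(1), folded u_def]
  have lam: "- lam t r = B / \<alpha> * (- ln u)"
    using lam_eq[of t r] inside_pos[OF assms(1)] by (simp add: u_def)
  have "- ln u \<le> (u powr (- 1) - 1) / 1"
    by (rule minus_ln_le_powr[OF u(1)]) simp
  then have "u * (- ln u) \<le> u * (1 / u - 1)"
    using u by (intro mult_left_mono) (auto simp: powr_minus_divide)
  also have "\<dots> \<le> 1" using u by (simp add: right_diff_distrib)
  finally have "u * (- ln u) \<le> 1" .
  then have "B / \<alpha> * (u * (- ln u)) \<le> B / \<alpha> * 1"
    using B_pos alpha by (intro mult_left_mono) auto
  moreover have "u * (1 - lam t r) = u + B / \<alpha> * (u * (- ln u))"
    using lam by (simp add: right_diff_distrib)
  ultimately show "u * (1 - lam t r) \<le> 1 + B / \<alpha>" using u(2) by simp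
  have "- ln u \<le> (u powr (- (1 / 2)) - 1) / (1 / 2)"
    by (rule minus_ln_le_powr[OF u(1)]) simp
  then have "- ln u \<le> 2 * u powr (- 1 / 2)" by simp
  then have "B / \<alpha> * (- ln u) \<le> B / \<alpha> * (2 * u powr (- 1 / 2))"
    using B_pos alpha by (intro mult_left_mono) auto
  then show "- lam t r \<le> 2 * (B / \<alpha>) * u powr (- 1 / 2)"
    unfolding lam by (simp add: mult_ac)
qed

lemma fan_g_bound:
  assumes "r > 0" 
  shows "\<bar>fan_g t r\<bar> \<le> (1 + B / \<alpha>) * r powr (- \<alpha>)"
proof (cases "inside t r")
  case True
  define u where "u = r powr \<alpha> / (c * t)"
  note u = inside_ratio[OF True, folded u_def] and l = lam_lower[OF True, folded u_def]
  have "fan_g t r = (1 - lam t r) * (1 / (c * t))" using True by (simp add: fan_g_def)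
  also have "\<dots> = (u * (1 - lam t r)) * r powr (- \<alpha>)" unfolding u(3) by simp
  finally have eq: "fan_g t r = (u * (1 - lam t r)) * r powr (- \<alpha>)" .
  have "0 \<le> u * (1 - lam t r)" using u(1) lam_nonpos[OF True] by simp
  then have "\<bar>fan_g t r\<bar> = (u * (1 - lam t r)) * r powr (- \<alpha>)" unfolding eq by simp
  also have "\<dots> \<le> (1 + B / \<alpha>) * r powr (- \<alpha>)" using l(1) by (intro mult_right_mono) auto
  finally show ?thesis .
next
  case False
  have "\<bar>gs r\<bar> \<le> 1 * r powr (- \<alpha>)" using gs_bound[OF assms] by simp
  also have "\<dots> \<le> (1 + B / \<alpha>) * r powr (- \<alpha>)" using B_pos alpha by (intro mult_right_mono) auto
  finally show ?thesis using False by (simp add: fan_g_def)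
qed

lemma inside_square:
  assumes "inside t r" "t \<le> T"
  defines "u \<equiv> r powr \<alpha> / (c * t)"
  shows "r\<^sup>2 / (c * t)\<^sup>2 = u\<^sup>2 * r powr (2 - 2 * \<alpha>)"
    and "r powr (2 - 2 * \<alpha>) \<le> M powr (2 - \<alpha>) * r powr (- \<alpha>)"
proof -
  note u = inside_ratio[OF assms(1), folded u_def]
  have r: "0 < r" "r \<le> M" using inside_pos[OF assms(1)] inside_le[OF assms(1,2)] r0 by auto
  have "r\<^sup>2 / (c * t)\<^sup>2 = (r * (1 / (c * t)))\<^sup>2" by (simp add: power_divide)
  also have "\<dots> = u\<^sup>2 * (r * r powr (- \<alpha>))\<^sup>2" unfolding u(3) by (simp add: power_mult_distrib)
  also have "(r * r powr (- \<alpha>))\<^sup>2 = (r powr 1 * r powr (- \<alpha>)) * (r powr 1 * r powr (- \<alpha>))"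
    using r by (simp add: power2_eq_square)
  also have "\<dots> = r powr (2 - 2 * \<alpha>)"
    by (simp only: powr_add[symmetric]) (simp add: algebra_simps)
  finally show "r\<^sup>2 / (c * t)\<^sup>2 = u\<^sup>2 * r powr (2 - 2 * \<alpha>)" .
  show "r powr (2 - 2 * \<alpha>) \<le> M powr (2 - \<alpha>) * r powr (- \<alpha>)" by (rule powr_le_M[OF r])
qed

lemma fan_b_bound:
  assumes "r > 0" "t \<le> T"
  shows "\<bar>fan_b t r\<bar> * r\<^sup>2 \<le> c / 4 * (1 + B / \<alpha>) * M powr (2 - \<alpha>) * r powr (- \<alpha>)"
proof (cases "inside t r")
  case True
  define u where "u = r powr \<alpha> / (c * t)"
  note u = inside_ratio[OF True, folded u_def] and l = lam_lower[OF True, folded u_def]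
  note sq = inside_square[OF True assms(2), folded u_def]
  have neg: "0 \<le> - lam t r" using lam_nonpos[OF True] by simp
  have t: "0 < t" using inside_pos[OF True] by simp
  have "\<bar>fan_b t r\<bar> * r\<^sup>2 = c / 4 * (- lam t r) * (r\<^sup>2 / (c * t)\<^sup>2)"
    using True neg t c_pos by (simp add: fan_b_def power2_eq_square field_simps)
  also have "\<dots> = c / 4 * ((u * (- lam t r)) * u) * r powr (2 - 2 * \<alpha>)"
    unfolding sq(1) by (simp add: power2_eq_square)
  also have "\<dots> \<le> c / 4 * ((1 + B / \<alpha>) * 1) * (M powr (2 - \<alpha>) * r powr (- \<alpha>))"
  proof (intro mult_mono mult_nonneg_nonneg)
    show "u * (- lam t r) \<le> 1 + B / \<alpha>" using l(1) u(1) by (simp add: right_diff_distrib)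
  qed (use u sq neg c_pos B_pos alpha in auto)
  finally show ?thesis by (simp add: mult_ac)
next
  case False
  then show ?thesis using c_pos B_pos alpha by (simp add: fan_b_def)
qed

text \<open>
The left-hand side is at most \<open>r (B/4 - lam) c / (c t)\<^sup>2\<close>. The logarithm costs
\<open>u powr (-1/2) = r powr (- \<alpha>/2) (c t) powr (1/2)\<close>, one factor \<open>1 / (c t)\<close> is at most \<open>r powr (- \<alpha>)\<close>,
and \<open>(c t) powr (-1/2)\<close> is left over.
\<close>

lemma fan_source_bound:
  assumes "r > 0" "0 < t" "t \<le> T"
  shows "\<bar>r * fan_b' t r + 4 * fan_b t r\<bar> * r
    \<le> (B / 4 + 2 * (B / \<alpha>)) * c powr (1 / 2) * M powr (1 - \<alpha> / 2) * r powr (- \<alpha>) * t powr (- 1 / 2)"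
proof (cases "inside t r")
  case True
  define u where "u = r powr \<alpha> / (c * t)"
  note u = inside_ratio[OF True, folded u_def] and l = lam_lower[OF True, folded u_def]
  define s where "s = c * t"
  have s: "0 < s" using u(5) by (simp add: s_def)
  have rM: "r \<le> M" using inside_le[OF True assms(3)] r0 by simp
  have bB: "0 < B / 4 + 2 * (B / \<alpha>)" using B_pos alpha by (intro add_pos_pos) auto
  have "r * fan_b' t r + 4 * fan_b t r = - (B / 4 + lam t r) * (c / s\<^sup>2)"
    using True assms c_pos by (simp add: fan_b'_def fan_b_def s_def power2_eq_square field_simps)
  from arg_cong[OF this, of abs] have "\<bar>r * fan_b' t r + 4 * fan_b t r\<bar> = \<bar>B / 4 + lam t r\<bar> * (c / s\<^sup>2)"
    unfolding abs_mult abs_minus_cancel using c_pos by simp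
  also have "\<dots> \<le> ((B / 4 + 2 * (B / \<alpha>)) * u powr (- 1 / 2)) * (c / s\<^sup>2)"
  proof (rule mult_right_mono)
    have "1 \<le> u powr (- 1 / 2)"
      using u(1,2) powr_mono2'[of "- 1 / 2" u 1] by simp
    then have "B / 4 * 1 \<le> B / 4 * u powr (- 1 / 2)" using B_pos by (intro mult_left_mono) auto
    moreover have "\<bar>B / 4 + lam t r\<bar> \<le> B / 4 - lam t r"
      using lam_nonpos[OF True] B_pos by simp
    ultimately show "\<bar>B / 4 + lam t r\<bar> \<le> (B / 4 + 2 * (B / \<alpha>)) * u powr (- 1 / 2)"
      using l(2) by (simp add: distrib_right)
  qed (use c_pos in simp)
  finally have "\<bar>r * fan_b' t r + 4 * fan_b t r\<bar> * r
     \<le> ((B / 4 + 2 * (B / \<alpha>)) * u powr (- 1 / 2)) * (c / s\<^sup>2) * r"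
    using assms(1) by (intro mult_right_mono) auto
  also have "\<dots> = (B / 4 + 2 * (B / \<alpha>)) * c * (u powr (- 1 / 2) * (r / s\<^sup>2))" by simp
  also have "u powr (- 1 / 2) * (r / s\<^sup>2) = r powr (1 - \<alpha> / 2) * s powr (- 1 / 2) * (1 / s)"
  proof -
    have "u powr (- 1 / 2) = r powr (- \<alpha> / 2) * s powr (1 / 2)"
      unfolding u_def s_def[symmetric] using s assms
      by (simp add: powr_divide powr_powr powr_minus_divide)
    moreover have "r * r powr (- \<alpha> / 2) = r powr (1 - \<alpha> / 2)"
      using assms by (simp add: powr_mult_base)
    moreover have "s powr (1 / 2) / s\<^sup>2 = s powr (- 1 / 2) * (1 / s)"
    proof -
      have "s powr (1 / 2) / s\<^sup>2 = s powr (1 / 2) * s powr (- 2)"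
        using s by (simp add: powr_minus_divide powr_numeral)
      also have "\<dots> = s powr (- 1 / 2) * s powr (- 1)"
        by (simp only: powr_add[symmetric]) simp
      finally show ?thesis using s by (simp add: powr_minus_divide)
    qed
    ultimately show ?thesis by (metis (no_types, lifting) mult.assoc mult.commute times_divide_eq_right)
  qed
  also have "(B / 4 + 2 * (B / \<alpha>)) * c * (r powr (1 - \<alpha> / 2) * s powr (- 1 / 2) * (1 / s))
     \<le> (B / 4 + 2 * (B / \<alpha>)) * c * (M powr (1 - \<alpha> / 2) * s powr (- 1 / 2) * r powr (- \<alpha>))"
  proof (rule mult_left_mono)
    have A1: "r powr (1 - \<alpha> / 2) \<le> M powr (1 - \<alpha> / 2)"
      using assms rM alpha by (intro powr_mono2) auto
    have A2: "1 / s \<le> r powr (- \<alpha>)" using u(4) by (simp add: s_def)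
    show "r powr (1 - \<alpha> / 2) * s powr (- 1 / 2) * (1 / s) \<le> M powr (1 - \<alpha> / 2) * s powr (- 1 / 2) * r powr (- \<alpha>)"
      by (rule mult_mono[OF mult_right_mono[OF A1] A2]) (use s in auto)
  qed (use bB c_pos in simp)
  also have "\<dots> = (B / 4 + 2 * (B / \<alpha>)) * (c * (M powr (1 - \<alpha> / 2) * s powr (- 1 / 2) * r powr (- \<alpha>)))"
    by (rule mult.assoc)
  also have "c * (M powr (1 - \<alpha> / 2) * s powr (- 1 / 2) * r powr (- \<alpha>))
     = c powr (1 / 2) * M powr (1 - \<alpha> / 2) * r powr (- \<alpha>) * t powr (- 1 / 2)"
  proof -
    have "c * s powr (- 1 / 2) = (c powr 1 * c powr (- 1 / 2)) * t powr (- 1 / 2)"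
      using c_pos assms by (simp add: s_def powr_mult)
    also have "c powr 1 * c powr (- 1 / 2) = c powr (1 / 2)"
      by (simp only: powr_add[symmetric]) simp
    finally show ?thesis by (simp add: mult_ac)
  qed
  finally show ?thesis by (simp add: mult_ac)
next
  case False
  then show ?thesis using B_pos alpha by (simp add: fan_b_def fan_b'_def)
qed

lemma fan_p_bound:
  assumes "r > 0" "t \<le> T"
  shows "\<bar>fan_p t r\<bar> \<le> (M powr (2 - \<alpha>) / \<alpha> + M powr (2 - \<alpha>) *
     ((1 + B / \<alpha>)\<^sup>2 + B * (1 + B / \<alpha>) + B\<^sup>2 / 2 + (1 + B + B\<^sup>2 / 2))) * r powr (- \<alpha>)"
    (is "_ \<le> (?P + ?M * (?Q + ?E)) * _")
proof (cases "inside t r")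
  case True
  define u where "u = r powr \<alpha> / (c * t)"
  note u = inside_ratio[OF True, folded u_def] and l = lam_lower[OF True, folded u_def]
  note sq = inside_square[OF True assms(2), folded u_def]
  have t: "0 < t" using inside_pos[OF True] by simp
  have neg: "0 \<le> - lam t r" using lam_nonpos[OF True] by simp
  define w where "w = 1 - lam t r"
  have w: "0 \<le> w" "u * w \<le> 1 + B / \<alpha>" using neg l(1) by (auto simp: w_def)
  have Ra: "R t powr (- \<alpha>) \<le> r powr (- \<alpha>)"
    using inside_iff[OF t, of r] True assms alpha by (intro powr_mono2') auto
  have Rp: "0 < R t" "R t \<le> M" using R_pos[OF t] R_le[OF t assms(2)] r0 by auto
  have 1: "\<bar>ps (R t)\<bar> \<le> ?P * r powr (- \<alpha>)"
    using ps_bound[OF Rp(1)] mult_left_mono[OF Ra, of ?P] alpha by simp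
  have "r\<^sup>2 * (w\<^sup>2 + B * w + B\<^sup>2 / 2) / (c * t)\<^sup>2 = (r\<^sup>2 / (c * t)\<^sup>2) * (w\<^sup>2 + B * w + B\<^sup>2 / 2)"
    by simp
  also have "\<dots> = ((u * w)\<^sup>2 + B * (u * (u * w)) + u\<^sup>2 * (B\<^sup>2 / 2)) * r powr (2 - 2 * \<alpha>)"
    unfolding sq(1) by (simp add: power2_eq_square algebra_simps)
  also have "\<dots> \<le> ?Q * (?M * r powr (- \<alpha>))"
  proof (rule mult_mono)
    show "(u * w)\<^sup>2 + B * (u * (u * w)) + u\<^sup>2 * (B\<^sup>2 / 2) \<le> ?Q"
    proof (intro add_mono)
      show "(u * w)\<^sup>2 \<le> (1 + B / \<alpha>)\<^sup>2" using w u by (intro power_mono) auto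
      have "u * (u * w) \<le> 1 * (1 + B / \<alpha>)" using u w by (intro mult_mono) auto
      then show "B * (u * (u * w)) \<le> B * (1 + B / \<alpha>)" using B_pos by simp
      have "u\<^sup>2 \<le> 1" using u by (simp add: power_le_one)
      then show "u\<^sup>2 * (B\<^sup>2 / 2) \<le> B\<^sup>2 / 2" using mult_right_mono[of "u\<^sup>2" 1 "B\<^sup>2 / 2"] by simp
    qed
  qed (use sq(2) B_pos alpha in auto)
  finally have 2: "r\<^sup>2 * (w\<^sup>2 + B * w + B\<^sup>2 / 2) / (c * t)\<^sup>2 \<le> ?Q * (?M * r powr (- \<alpha>))" .
  have "(R t)\<^sup>2 / (c * t)\<^sup>2 = (R t * R t powr (- \<alpha>))\<^sup>2"
    using R_powr[of t] t by (simp add: powr_minus power_mult_distrib divide_inverse power_inverse)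
  also have "\<dots> = (R t powr 1 * R t powr (- \<alpha>)) * (R t powr 1 * R t powr (- \<alpha>))"
    using Rp by (simp add: power2_eq_square)
  also have "\<dots> = R t powr (2 - 2 * \<alpha>)"
    by (simp only: powr_add[symmetric]) (simp add: algebra_simps)
  also have "\<dots> \<le> ?M * R t powr (- \<alpha>)" by (rule powr_le_M[OF Rp])
  also have "\<dots> \<le> ?M * r powr (- \<alpha>)" using Ra by (intro mult_left_mono) auto
  finally have "(R t)\<^sup>2 / (c * t)\<^sup>2 * ?E \<le> ?M * r powr (- \<alpha>) * ?E"
    using B_pos by (intro mult_right_mono) auto
  then have 3: "(R t)\<^sup>2 * ?E / (c * t)\<^sup>2 \<le> ?E * (?M * r powr (- \<alpha>))" by (simp add: mult_ac)
  have eq: "fan_p t r = ps (R t) + (r\<^sup>2 * (w\<^sup>2 + B * w + B\<^sup>2 / 2) / (c * t)\<^sup>2 - (R t)\<^sup>2 * ?E / (c * t)\<^sup>2) / 2"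
    using True by (simp add: fan_p_def w_def diff_divide_distrib mult.commute)
  have nn: "0 \<le> r\<^sup>2 * (w\<^sup>2 + B * w + B\<^sup>2 / 2) / (c * t)\<^sup>2" "0 \<le> (R t)\<^sup>2 * ?E / (c * t)\<^sup>2"
    using w B_pos by auto
  have gen: "\<bar>a + (x - y) / 2\<bar> \<le> A + X + Y"
    if "\<bar>a\<bar> \<le> A" "x \<le> X" "y \<le> Y" "0 \<le> x" "0 \<le> y" for a x y A X Y :: real
  proof -
    have "\<bar>(x - y) / 2\<bar> \<le> \<bar>x - y\<bar>" by simp
    also have "\<dots> \<le> X + Y" using that by linarith
    finally have "\<bar>(x - y) / 2\<bar> \<le> X + Y" .
    with abs_triangle_ineq[of a "(x - y) / 2"] that(1) show ?thesis by linarith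
  qed
  have "\<bar>fan_p t r\<bar> \<le> ?P * r powr (- \<alpha>) + ?Q * (?M * r powr (- \<alpha>)) + ?E * (?M * r powr (- \<alpha>))"
    unfolding eq by (rule gen[OF 1 2 3 nn])
  then show ?thesis by (simp add: algebra_simps)
next
  case False
  have "?P * r powr (- \<alpha>) \<le> (?P + ?M * (?Q + ?E)) * r powr (- \<alpha>)"
    using B_pos alpha by (intro mult_right_mono) auto
  then show ?thesis using False ps_bound[OF assms(1)] by (simp add: fan_p_def)
qed

lemma fan_deriv_bound:
  assumes "r > 0" "t \<le> T"
  shows "\<bar>fan_g' t r\<bar> * r \<le> (K + \<alpha> + B) * r powr (- \<alpha>)"
    and "\<bar>fan_b' t r\<bar> * r ^ 3 \<le> B * c * M powr (2 - \<alpha>) * r powr (- \<alpha>)"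
proof -
  show "\<bar>fan_g' t r\<bar> * r \<le> (K + \<alpha> + B) * r powr (- \<alpha>)"
  proof (cases "inside t r")
    case True
    note u = inside_ratio[OF True]
    have "\<bar>fan_g' t r\<bar> * r = B * (1 / (c * t))"
      using True inside_pos[OF True] c_pos assms B_pos by (simp add: fan_g'_def abs_mult field_simps)
    also have "\<dots> \<le> B * r powr (- \<alpha>)" using u(4) B_pos by (intro mult_left_mono) auto
    also have "\<dots> \<le> (K + \<alpha> + B) * r powr (- \<alpha>)" using K_nonneg alpha by (intro mult_right_mono) auto
    finally show ?thesis .
  next
    case False
    have "(K + \<alpha>) * r powr (- \<alpha>) \<le> (K + \<alpha> + B) * r powr (- \<alpha>)" using B_pos by (intro mult_right_mono) auto
    with False gs'_bound[OF assms(1)] show ?thesis by (simp add: fan_g'_def)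
  qed
  show "\<bar>fan_b' t r\<bar> * r ^ 3 \<le> B * c * M powr (2 - \<alpha>) * r powr (- \<alpha>)"
  proof (cases "inside t r")
    case True
    define u where "u = r powr \<alpha> / (c * t)"
    note u = inside_ratio[OF True, folded u_def]
    note sq = inside_square[OF True assms(2), folded u_def]
    have t: "0 < t" using inside_pos[OF True] by simp
    have "\<bar>fan_b' t r\<bar> * r ^ 3 = B * c / 4 * (r\<^sup>2 / (c * t)\<^sup>2)"
      using True t assms B_pos c_pos
      by (simp add: fan_b'_def abs_mult power2_eq_square power3_eq_cube field_simps)
    also have "\<dots> = (B * c / 4 * u\<^sup>2) * r powr (2 - 2 * \<alpha>)" unfolding sq(1) by simp
    also have "\<dots> \<le> (B * c * 1) * (M powr (2 - \<alpha>) * r powr (- \<alpha>))"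
      using u(1,2) sq(2) B_pos c_pos by (intro mult_mono) (auto simp: power_le_one)
    finally show ?thesis by (simp add: mult_ac)
  next
    case False
    then show ?thesis using B_pos c_pos by (simp add: fan_b'_def)
  qed
qed

lemma fan_measurable:
  "(\<lambda>z. fan_g (fst z) (snd z)) \<in> borel_measurable borel"
  "(\<lambda>z. fan_b (fst z) (snd z)) \<in> borel_measurable borel"
  "(\<lambda>z. fan_p (fst z) (snd z)) \<in> borel_measurable borel"
  "(\<lambda>z. fan_g' (fst z) (snd z)) \<in> borel_measurable borel"
  "(\<lambda>z. fan_b' (fst z) (snd z)) \<in> borel_measurable borel"
proof -
  let ?B = "borel :: (real \<times> real) measure"
  have f: "fst \<in> borel_measurable ?B" and s: "snd \<in> borel_measurable ?B"
    by (auto intro!: borel_measurable_continuous_onI continuous_intros)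
  have P: "{z \<in> space ?B. inside (fst z) (snd z)} \<in> sets ?B"
    unfolding inside_def by (rule measurable_power_region)
  have lam: "(\<lambda>z. lam (fst z) (snd z)) \<in> borel_measurable ?B"
    unfolding lam_def
    by (intro borel_measurable_diff borel_measurable_times borel_measurable_ln borel_measurable_const f s)
  have Rm: "(\<lambda>z. R (fst z)) \<in> borel_measurable ?B"
    unfolding R_def by (intro powr_real_measurable borel_measurable_times borel_measurable_const f)
  note gs = measurable_compose[OF s gs_measurable] and gs' = measurable_compose[OF s gs'_measurable]
    and ps = measurable_compose[OF s ps_measurable] and psR = measurable_compose[OF Rm ps_measurable]
  show "(\<lambda>z. fan_g (fst z) (snd z)) \<in> borel_measurable ?B"
    unfolding fan_g_def by (rule measurable_If[OF _ gs P]) (intro borel_measurable_diff borel_measurable_times borel_measurable_divide borel_measurable_const lam f s)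
  show "(\<lambda>z. fan_b (fst z) (snd z)) \<in> borel_measurable ?B"
    unfolding fan_b_def by (rule measurable_If[OF _ _ P]) (intro borel_measurable_uminus borel_measurable_power borel_measurable_times borel_measurable_divide borel_measurable_const lam f s)+
  show "(\<lambda>z. fan_p (fst z) (snd z)) \<in> borel_measurable ?B"
    unfolding fan_p_def by (rule measurable_If[OF _ ps P]) (intro borel_measurable_add borel_measurable_diff borel_measurable_power borel_measurable_times borel_measurable_divide borel_measurable_const lam psR Rm f s)
  show "(\<lambda>z. fan_g' (fst z) (snd z)) \<in> borel_measurable ?B"
    unfolding fan_g'_def by (rule measurable_If[OF _ gs' P]) (intro borel_measurable_uminus borel_measurable_times borel_measurable_divide borel_measurable_const f s)
  show "(\<lambda>z. fan_b' (fst z) (snd z)) \<in> borel_measurable ?B"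
    unfolding fan_b'_def by (rule measurable_If[OF _ _ P]) (intro borel_measurable_uminus borel_measurable_power borel_measurable_times borel_measurable_divide borel_measurable_const f s)+
qed

text \<open>
All constants are collected into one; the interface has a single point at each time and at each
radius.
\<close>

lemma fan_radial_flow:
  "\<exists>C. radial_flow \<alpha> M C T fan_g fan_g' fan_b fan_b' fan_p front"
proof -
  define C1 where "C1 = 1 + B / \<alpha>"
  define C2 where "C2 = c / 4 * (1 + B / \<alpha>) * M powr (2 - \<alpha>)"
  define C3 where "C3 = M powr (2 - \<alpha>) / \<alpha> + M powr (2 - \<alpha>) *
     ((1 + B / \<alpha>)\<^sup>2 + B * (1 + B / \<alpha>) + B\<^sup>2 / 2 + (1 + B + B\<^sup>2 / 2))"
  define C4 where "C4 = (B / 4 + 2 * (B / \<alpha>)) * c powr (1 / 2) * M powr (1 - \<alpha> / 2)"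
  define C where "C = Max {C1, C2, C3, C4}"
  have C: "C1 \<le> C" "C2 \<le> C" "C3 \<le> C" "C4 \<le> C"
    unfolding C_def by (intro Max_ge; simp)+
  have mono: "z \<le> C * r powr (- \<alpha>)" if "z \<le> k * r powr (- \<alpha>)" "k \<le> C" for z k r
    using that by (meson mult_right_mono order_trans powr_ge_zero)
  have "radial_flow \<alpha> M C T fan_g fan_g' fan_b fan_b' fan_p front"
  proof
    show "finite {r. (t, r) \<in> front}" for t
    proof (rule finite_subset)
      show "{r. (t, r) \<in> front} \<subseteq> {(c * t) powr (1 / \<alpha>)}"
      proof
        fix r assume "r \<in> {r. (t, r) \<in> front}"
        then have r: "0 < r" "c * t = r powr \<alpha>" by (auto simp: front_def)
        show "r \<in> {(c * t) powr (1 / \<alpha>)}" unfolding r(2) using r(1) alpha by (simp add: powr_powr)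
      qed
    qed simp
    show "finite {t. (t, r) \<in> front}" for r
    proof (rule finite_subset)
      show "{t. (t, r) \<in> front} \<subseteq> {r powr \<alpha> / c}"
        using c_pos by (auto simp: front_def field_simps)
    qed simp
    show "\<bar>fan_g t r\<bar> \<le> C * r powr - \<alpha>" if "t \<in> {0..T}" "r > 0" for t r
      by (rule mono[OF fan_g_bound[OF that(2)] C(1)[unfolded C1_def]])
    show "\<bar>fan_b t r\<bar> * r\<^sup>2 \<le> C * r powr - \<alpha>" if "t \<in> {0..T}" "r > 0" for t r
      by (rule mono[OF fan_b_bound[OF that(2)] C(2)[unfolded C2_def]]) (use that in simp)
    show "\<bar>fan_p t r\<bar> \<le> C * r powr - \<alpha>" if "t \<in> {0..T}" "r > 0" for t r
      by (rule mono[OF fan_p_bound[OF that(2)] C(3)[unfolded C3_def]]) (use that in simp)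
    show "\<bar>r * fan_b' t r + 4 * fan_b t r\<bar> * r \<le> C * r powr - \<alpha> * t powr (- 1 / 2)"
      if "t \<in> {0<..<T}" "r > 0" for t r
    proof -
      have "\<bar>r * fan_b' t r + 4 * fan_b t r\<bar> * r \<le> C4 * (r powr - \<alpha> * t powr (- 1 / 2))"
        using fan_source_bound[OF that(2), of t] that by (simp add: C4_def mult_ac)
      also have "\<dots> \<le> C * (r powr - \<alpha> * t powr (- 1 / 2))"
        using C(4) by (intro mult_right_mono) auto
      finally show ?thesis by (simp add: mult_ac)
    qed
    show "fan_g t r = 0 \<and> fan_b t r = 0 \<and> fan_p t r = 0" if "t \<in> {0..T}" "r > M" for t r
      using inside_le[of t r] that r0 chi_zero[of r] ps_zero[of r]
      by (auto simp: fan_g_def fan_b_def fan_p_def gs_def)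
    show "\<exists>C'. \<forall>r>0. \<bar>fan_g' t r\<bar> * r \<le> C' * r powr - \<alpha> \<and> \<bar>fan_b' t r\<bar> * r ^ 3 \<le> C' * r powr - \<alpha>"
      if "t \<in> {0..T}" for t
    proof (intro exI allI impI conjI)
      let ?C = "max (K + \<alpha> + B) (B * c * M powr (2 - \<alpha>))"
      fix r :: real assume "r > 0"
      show "\<bar>fan_g' t r\<bar> * r \<le> ?C * r powr - \<alpha>"
        using fan_deriv_bound(1)[OF \<open>r > 0\<close>, of t] that
        by (intro order_trans[OF fan_deriv_bound(1)[OF \<open>r > 0\<close>] mult_right_mono]) auto
      show "\<bar>fan_b' t r\<bar> * r ^ 3 \<le> ?C * r powr - \<alpha>"
        using that by (intro order_trans[OF fan_deriv_bound(2)[OF \<open>r > 0\<close>] mult_right_mono]) auto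
    qed
    show "0 < \<alpha>" "\<alpha> < 2" "0 < M" "0 < T"
      by (fact alpha M_pos T_pos)+
    show "continuous_on {0<..} (fan_g t)" "continuous_on {0<..} (fan_b t)" "continuous_on {0<..} (fan_p t)"
      if "t \<in> {0..T}" for t
      by (fact fan_cont_r[OF that])+
    show "continuous_on {0..T} (\<lambda>t. fan_g t r)" "continuous_on {0..T} (\<lambda>t. fan_b t r)"
      "continuous_on {0..T} (\<lambda>t. fan_p t r)" if "r > 0" for r
      by (fact fan_cont_t[OF that])+
    show "(fan_g t has_real_derivative fan_g' t r) (at r)" "(fan_b t has_real_derivative fan_b' t r) (at r)"
      "(fan_p t has_real_derivative r * (fan_g t r)\<^sup>2) (at r)"
      if "t \<in> {0..T}" "r > 0" "(t, r) \<notin> front" for t r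
      by (fact fan_deriv_r[OF that(2,3)])+
    show "((\<lambda>t. fan_g t r) has_real_derivative - (r * fan_b' t r + 4 * fan_b t r)) (at t)"
      if "t \<in> {0<..<T}" "r > 0" "(t, r) \<notin> front" for t r
      by (fact fan_deriv_t[OF that(2,3)])
  qed (fact fan_measurable)+
  then show ?thesis by blast
qed

lemma fan_initial: "fan_g 0 = gs"
  by (auto simp: fan_g_def not_inside_0)

end

section \<open>Energy\<close>

text \<open>
By Cayley-Hamilton the square of such a matrix is \<open>p\<^sup>2 + q\<^sup>2\<close> times the identity. An eigenvector for
the positive root is \<open>(p + s, q)\<close>, unless this vector is zero.
\<close>

lemma lambda_max_symmetric_traceless:
  fixes A :: "real^2^2"
  assumes A: "A $ 1 $ 2 = A $ 2 $ 1" "A $ 2 $ 2 = - A $ 1 $ 1"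
  shows "lambda_max A = sqrt ((A $ 1 $ 1)\<^sup>2 + (A $ 1 $ 2)\<^sup>2)"
proof -
  define p q s where "p = A $ 1 $ 1" and "q = A $ 1 $ 2" and "s = sqrt (p\<^sup>2 + q\<^sup>2)"
  have s2: "s\<^sup>2 = p\<^sup>2 + q\<^sup>2" and s0: "0 \<le> s" by (auto simp: s_def)
  have mult: "A *v x = l *\<^sub>R x \<longleftrightarrow> p * x $ 1 + q * x $ 2 = l * x $ 1 \<and> q * x $ 1 - p * x $ 2 = l * x $ 2" for x l
    using A by (simp add: vec_eq_iff forall_2 matrix_vector_mult_def sum_2 p_def q_def)
  let ?S = "{l. \<exists>x. x \<noteq> 0 \<and> A *v x = l *\<^sub>R x}"
  have sub: "?S \<subseteq> {s, - s}"
  proof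
    fix l assume "l \<in> ?S"
    then obtain x where x: "x \<noteq> 0" "A *v x = l *\<^sub>R x" by blast
    then have e: "p * x $ 1 + q * x $ 2 = l * x $ 1" "q * x $ 1 - p * x $ 2 = l * x $ 2"
      by (simp_all add: mult)
    have "(l\<^sup>2 - (p\<^sup>2 + q\<^sup>2)) * x $ 1 = 0" "(l\<^sup>2 - (p\<^sup>2 + q\<^sup>2)) * x $ 2 = 0"
      using e by algebra+
    moreover have "x $ 1 \<noteq> 0 \<or> x $ 2 \<noteq> 0"
      using x(1) by (auto simp: vec_eq_iff forall_2)
    ultimately have "l\<^sup>2 = s\<^sup>2" using s2 by auto
    then show "l \<in> {s, - s}" by (auto simp: power2_eq_iff)
  qed
  have "s \<in> ?S"
  proof (cases "p + s = 0 \<and> q = 0")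
    case True
    have "A *v axis 2 1 = s *\<^sub>R axis 2 1"
      using True by (simp add: mult axis_def)
    then show ?thesis by (auto intro!: exI[of _ "axis 2 1"])
  next
    case False
    let ?x = "vector [p + s, q] :: real^2"
    have "?x \<noteq> 0" using False by (auto simp: vec_eq_iff forall_2)
    moreover have "A *v ?x = s *\<^sub>R ?x"
      using s2 by (simp add: mult algebra_simps power2_eq_square)
    ultimately show ?thesis by blast
  qed
  then have "Max ?S = s"
    using sub s0 finite_subset[OF sub] by (intro Max_eqI) auto
  then show ?thesis by (simp add: lambda_max_def s_def p_def q_def)
qed

lemma radial_energy_density:
  "energy_density (radial_velocity g x) (radial_stress g b x)
   = (g (norm x))\<^sup>2 * (norm x)\<^sup>2 / 2 + \<bar>b (norm x)\<bar> * (norm x)\<^sup>2"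
proof -
  let ?A = "traceless_square (radial_velocity g x) - radial_stress g b x"
  define \<beta> where "\<beta> = b (norm x)"
  have A: "?A $ 1 $ 1 = 2 * \<beta> * (x $ 1 * x $ 2)" "?A $ 1 $ 2 = - \<beta> * ((x $ 1)\<^sup>2 - (x $ 2)\<^sup>2)"
    "?A $ 2 $ 1 = - \<beta> * ((x $ 1)\<^sup>2 - (x $ 2)\<^sup>2)" "?A $ 2 $ 2 = - (2 * \<beta> * (x $ 1 * x $ 2))"
    by (simp_all add: radial_stress_def outer_def \<beta>_def power2_eq_square algebra_simps)
  have "lambda_max ?A = sqrt ((2 * \<beta> * (x $ 1 * x $ 2))\<^sup>2 + (- \<beta> * ((x $ 1)\<^sup>2 - (x $ 2)\<^sup>2))\<^sup>2)"
    using lambda_max_symmetric_traceless[of ?A] by (simp only: A)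
  also have "(2 * \<beta> * (x $ 1 * x $ 2))\<^sup>2 + (- \<beta> * ((x $ 1)\<^sup>2 - (x $ 2)\<^sup>2))\<^sup>2 = (\<beta> * (norm x)\<^sup>2)\<^sup>2"
    unfolding norm_sq_2 by (simp add: power2_eq_square algebra_simps)
  finally have "lambda_max ?A = \<bar>\<beta>\<bar> * (norm x)\<^sup>2"
    by (simp add: abs_mult)
  then show ?thesis
    by (simp add: energy_density_def radial_velocity_def power_mult_distrib \<beta>_def)
qed

lemma fourth_power_log_tendsto_0:
  "((\<lambda>r::real. r ^ 4 * ln r) \<longlongrightarrow> 0) (at_right 0)" "((\<lambda>r::real. r ^ 4 * (ln r)\<^sup>2) \<longlongrightarrow> 0) (at_right 0)"
  "((\<lambda>r::real. r ^ 4) \<longlongrightarrow> 0) (at_right 0)"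
  by real_asymp+

context truncated_vortex
begin

text \<open>
Up to the factor \<open>\<pi> R\<^sup>4 / (c t)\<^sup>2\<close>, the energy of the relaxed disc.
\<close>

definition energy_const :: real where
  "energy_const = 1 / 4 + B / 8 + B * c / 32 + B\<^sup>2 / 32"

text \<open>
The integrand is \<open>2 \<pi> r\<close> times the energy density. Its antiderivative is \<open>r ^ 4\<close> times a quadratic
polynomial in \<open>lam\<close>, whose coefficients are found by comparison with \<open>lam' = B / r\<close>; it tends to \<open>0\<close> at
the origin, and \<open>lam = 0\<close> at the front.
\<close>

lemma fan_core_energy:
  assumes t: "0 < t"
  defines "f \<equiv> (\<lambda>r. pi / (c * t)\<^sup>2 * r ^ 3 * ((1 - lam t r)\<^sup>2 - c / 2 * lam t r))"
  shows "has_bochner_integral lborel (\<lambda>r. indicator {0<..<R t} r * f r) (pi * energy_const * (R t) ^ 4 / (c * t)\<^sup>2)"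
proof -
  \<comment> \<open>The coefficient of \<open>lam\<close> in the antiderivative; that of \<open>lam\<^sup>2\<close> is \<open>1/4\<close>.\<close>
  define a1 where "a1 = - (1 / 2) - c / 8 - B / 8"
  define F where "F = (\<lambda>r. pi / (c * t)\<^sup>2 * (r ^ 4 * (energy_const + a1 * lam t r + (lam t r)\<^sup>2 / 4)))"
  define k where "k = B / \<alpha> * ln (c * t)"
  have lamk: "lam t r = B * ln r - k" for r by (simp add: lam_def k_def)
  have ct: "0 < c * t" using t c_pos by simp
  have Rp: "0 < R t" by (rule R_pos[OF t])
  have lamR: "lam t (R t) = 0"
    using lam_front[of t "R t"] Rp R_powr[of t] t by (simp add: front_def)
  have "has_bochner_integral lborel (\<lambda>r. indicator {0<..<R t} r * f r) (F (R t) - 0)"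
  proof (rule has_bochner_integral_FTC_nonneg_open[where F = F])
    show "0 < R t" by (rule Rp)
    show "DERIV F r :> f r" if r: "0 < r" for r
    proof -
      let ?l = "lam t r"
      have "((\<lambda>r. r ^ 4 * (energy_const + a1 * lam t r + (lam t r)\<^sup>2 / 4)) has_real_derivative
          4 * r ^ 3 * (energy_const + a1 * ?l + ?l\<^sup>2 / 4) + r ^ 4 * (a1 * (B / r) + 2 * ?l * (B / r) / 4)) (at r)"
        by (auto intro!: derivative_eq_intros lam_deriv_r[OF r])
      from DERIV_cmult[OF this, of "pi / (c * t)\<^sup>2"]
      have "(F has_real_derivative pi / (c * t)\<^sup>2 * (4 * r ^ 3 * (energy_const + a1 * ?l + ?l\<^sup>2 / 4)
          + r ^ 4 * (a1 * (B / r) + 2 * ?l * (B / r) / 4))) (at r)"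
        unfolding F_def .
      also have "4 * r ^ 3 * (energy_const + a1 * ?l + ?l\<^sup>2 / 4) + r ^ 4 * (a1 * (B / r) + 2 * ?l * (B / r) / 4)
        = r ^ 3 * ((4 * energy_const + a1 * B) + (4 * a1 + B / 2) * ?l + ?l\<^sup>2)"
        using r by (simp add: field_simps power2_eq_square power3_eq_cube power4_eq_xxxx)
      also have "4 * energy_const + a1 * B = 1"
        by (simp add: energy_const_def a1_def field_simps power2_eq_square)
      also have "4 * a1 + B / 2 = - 2 - c / 2"
        by (simp add: a1_def)
      also have "1 + (- 2 - c / 2) * ?l + ?l\<^sup>2 = (1 - ?l)\<^sup>2 - c / 2 * ?l"
        by (simp add: power2_eq_square algebra_simps)
      finally show ?thesis by (simp add: f_def mult.assoc)
    qed
    show "isCont f r" if "0 < r" for r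
      using that t c_pos unfolding f_def lam_def by (auto intro!: continuous_intros)
    show "0 \<le> f r" if r: "0 < r" "r < R t" for r
    proof -
      have "inside t r" using inside_iff[OF t, of r] r by simp
      from lam_nonpos[OF this] have "0 \<le> (1 - lam t r)\<^sup>2 - c / 2 * lam t r"
        using c_pos mult_nonneg_nonpos[of "c / 2" "lam t r"] zero_le_power2[of "1 - lam t r"] by linarith
      then show ?thesis using r unfolding f_def by (intro mult_nonneg_nonneg) auto
    qed
    have "r ^ 4 * (energy_const + a1 * lam t r + (lam t r)\<^sup>2 / 4) = (energy_const - a1 * k + k\<^sup>2 / 4) * r ^ 4
        + (a1 * B - B * k / 2) * (r ^ 4 * ln r) + B\<^sup>2 / 4 * (r ^ 4 * (ln r)\<^sup>2)" for r
      by (simp add: lamk power2_eq_square field_simps)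
    then have "F = (\<lambda>r. pi / (c * t)\<^sup>2 * ((energy_const - a1 * k + k\<^sup>2 / 4) * r ^ 4
        + (a1 * B - B * k / 2) * (r ^ 4 * ln r) + B\<^sup>2 / 4 * (r ^ 4 * (ln r)\<^sup>2)))"
      by (simp only: F_def)
    moreover have "((\<lambda>r. pi / (c * t)\<^sup>2 * ((energy_const - a1 * k + k\<^sup>2 / 4) * r ^ 4
        + (a1 * B - B * k / 2) * (r ^ 4 * ln r) + B\<^sup>2 / 4 * (r ^ 4 * (ln r)\<^sup>2)))
       \<longlongrightarrow> pi / (c * t)\<^sup>2 * ((energy_const - a1 * k + k\<^sup>2 / 4) * 0 + (a1 * B - B * k / 2) * 0 + B\<^sup>2 / 4 * 0)) (at_right 0)"
      by (intro tendsto_mult tendsto_add tendsto_const fourth_power_log_tendsto_0)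
    ultimately show "(F \<longlongrightarrow> 0) (at_right 0)" by simp
    have "isCont F (R t)"
      unfolding F_def lam_def using Rp t c_pos by (auto intro!: continuous_intros)
    then show "(F \<longlongrightarrow> F (R t)) (at_left (R t))"
      by (simp add: isCont_def filterlim_at_split)
  qed
  then show ?thesis by (simp add: F_def lamR mult_ac)
qed

lemma steady_energy_integrable:
  "integrable lborel (\<lambda>r. indicator {0<..} r * (2 * pi * r * ((gs r)\<^sup>2 * r\<^sup>2 / 2)))"
proof -
  interpret S: radial_flow \<alpha> M "Max {1, M powr (2 - \<alpha>) / \<alpha>}" T "\<lambda>_. gs" "\<lambda>_. gs'" "\<lambda>_ _. 0" "\<lambda>_ _. 0" "\<lambda>_. ps" "{}"
    by (rule steady_radial_flow)
  let ?C = "(Max {1, M powr (2 - \<alpha>) / \<alpha>})\<^sup>2 * M powr (2 - \<alpha>)"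
  have m: "(\<lambda>r. (gs r)\<^sup>2 * r\<^sup>2 / 2) \<in> borel_measurable borel"
    using gs_measurable by simp
  have "integrable lborel (\<lambda>x::real^2. (gs (norm x))\<^sup>2 * (norm x)\<^sup>2 / 2)"
  proof (rule integrable_norm_powr_bound[OF alpha(2) M_pos])
    show "norm ((gs (norm x))\<^sup>2 * (norm x)\<^sup>2 / 2) \<le> ?C * norm x powr - \<alpha>" if "x \<noteq> 0" for x :: "real^2"
      using S.g_bounds(2)[of 0 "norm x"] T_pos that
      by (intro order_trans[OF _ S.g_bounds(2)[of 0 "norm x"]]) auto
    show "(gs (norm x))\<^sup>2 * (norm x)\<^sup>2 / 2 = 0" if "M < norm x" for x :: "real^2"
      using S.support[of 0 "norm x"] T_pos that by simp
    show "(\<lambda>x::real^2. (gs (norm x))\<^sup>2 * (norm x)\<^sup>2 / 2) \<in> borel_measurable borel"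
      by (rule measurable_compose[OF _ m]) simp
  qed
  then show ?thesis
    using integrable_radial_iff[OF m] by simp
qed

definition fan_energy :: "real \<Rightarrow> real" where
  "fan_energy = energy (\<lambda>t. radial_velocity (fan_g t)) (\<lambda>t. radial_stress (fan_g t) (fan_b t))"

definition steady_energy :: real where
  "steady_energy = (LINT r|lborel. indicator {0<..} r * (2 * pi * r * ((gs r)\<^sup>2 * r\<^sup>2 / 2)))"

text \<open>
The fan differs from the steady vortex only inside the front, where the steady energy is
\<open>\<pi> \<integral> r powr (3 - 2 \<alpha>) dr\<close>. Both \<open>R\<^sup>4 / (c t)\<^sup>2\<close> and \<open>R powr (4 - 2 \<alpha>)\<close> equal
\<open>(c t) powr (4/\<alpha> - 2)\<close>.
\<close>

lemma fan_energy_eq: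
  assumes t: "0 < t" "t \<le> T"
  shows "fan_energy t = steady_energy + pi * (energy_const - 1 / (4 - 2 * \<alpha>)) * (c * t) powr (4 / \<alpha> - 2)"
proof -
  let ?e = "\<lambda>r. (fan_g t r)\<^sup>2 * r\<^sup>2 / 2 + \<bar>fan_b t r\<bar> * r\<^sup>2"
  let ?f = "\<lambda>r. pi / (c * t)\<^sup>2 * r ^ 3 * ((1 - lam t r)\<^sup>2 - c / 2 * lam t r)"
  let ?s = "\<lambda>r. indicator {0<..} r * (2 * pi * r * ((gs r)\<^sup>2 * r\<^sup>2 / 2))"
  have ct: "0 < c * t" using t c_pos by simp
  have Rp: "0 < R t" by (rule R_pos[OF t(1)])
  obtain C where "radial_flow \<alpha> M C T fan_g fan_g' fan_b fan_b' fan_p front"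
    using fan_radial_flow by blast
  then interpret S: radial_flow \<alpha> M C T fan_g fan_g' fan_b fan_b' fan_p front .
  have m: "?e \<in> borel_measurable borel"
    using S.meas_r(1,2)[of t] by simp
  have "fan_energy t = (LINT x|lborel. ?e (norm (x::real^2)))"
    by (simp add: fan_energy_def energy_def radial_energy_density)
  also have "\<dots> = (LINT r|lborel. indicator {0<..} r * (2 * pi * r * ?e r))"
    using integral_radial[OF m] by (simp add: set_lebesgue_integral_def)
  also have "\<dots> = (LINT r|lborel. ?s r + (indicator {0<..<R t} r * ?f r - pi * (indicator {0<..<R t} r * r powr (3 - 2 * \<alpha>))))"
  proof (rule integral_cong_AE)
    show "(\<lambda>r. indicator {0<..} r * (2 * pi * r * ?e r)) \<in> borel_measurable lborel"
      using m by (intro borel_measurable_times) auto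
    show "(\<lambda>r. ?s r + (indicator {0<..<R t} r * ?f r - pi * (indicator {0<..<R t} r * r powr (3 - 2 * \<alpha>)))) \<in> borel_measurable lborel"
      by (rule borel_measurable_add[OF borel_measurable_integrable[OF steady_energy_integrable] borel_measurable_diff
            [OF borel_measurable_has_bochner_integral[OF fan_core_energy[OF t(1)]]]]) simp
    show "AE r in lborel. indicator {0<..} r * (2 * pi * r * ?e r) =
       ?s r + (indicator {0<..<R t} r * ?f r - pi * (indicator {0<..<R t} r * r powr (3 - 2 * \<alpha>)))"
    proof (rule eventually_mono[OF AE_lborel_singleton[of "R t"]])
      fix r assume "r \<noteq> R t"
      show "indicator {0<..} r * (2 * pi * r * ?e r) =
       ?s r + (indicator {0<..<R t} r * ?f r - pi * (indicator {0<..<R t} r * r powr (3 - 2 * \<alpha>)))"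
      proof (cases "0 < r \<and> r < R t")
        case True
        then have i: "inside t r" using inside_iff[OF t(1), of r] by simp
        have g: "gs r = r powr (- \<alpha>)" using gs_inner[of r] inside_le[OF i t(2)] True by simp
        have "2 * pi * r * ((gs r)\<^sup>2 * r\<^sup>2 / 2) = pi * (r powr 3 * (r powr (- \<alpha>) * r powr (- \<alpha>)))"
          using True by (simp add: g power2_eq_square power3_eq_cube powr_numeral)
        also have "\<dots> = pi * r powr (3 - 2 * \<alpha>)"
          by (simp only: powr_add[symmetric]) (simp add: algebra_simps)
        finally have 1: "2 * pi * r * ((gs r)\<^sup>2 * r\<^sup>2 / 2) = pi * r powr (3 - 2 * \<alpha>)" .
        have b: "\<bar>fan_b t r\<bar> = - lam t r / (4 * c * t\<^sup>2)"
          using i lam_nonpos[OF i] c_pos by (simp add: fan_b_def divide_nonneg_nonneg)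
        have 2: "2 * pi * r * ?e r = ?f r"
          unfolding b using i t c_pos by (simp add: fan_g_def field_simps power2_eq_square power3_eq_cube)
        show ?thesis using 1 2 True by simp
      next
        case False
        then show ?thesis
          using inside_iff[OF t(1), of r] \<open>r \<noteq> R t\<close> by (auto simp: indicator_def fan_g_def fan_b_def)
      qed
    qed
  qed
  also have "\<dots> = steady_energy + (pi * energy_const * (R t) ^ 4 / (c * t)\<^sup>2 - pi * ((R t) powr (4 - 2 * \<alpha>) / (4 - 2 * \<alpha>)))"
    using steady_energy_integrable fan_core_energy[OF t(1)] has_bochner_integral_powr_near_0[of "3 - 2 * \<alpha>" "R t"]
      alpha Rp
    by (simp add: steady_energy_def has_bochner_integral_iff)
  also have "(R t) ^ 4 = (c * t) powr (4 / \<alpha>)"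
    using Rp ct by (simp add: R_def powr_powr flip: powr_numeral)
  also have "pi * energy_const * (c * t) powr (4 / \<alpha>) / (c * t)\<^sup>2 = pi * energy_const * (c * t) powr (4 / \<alpha> - 2)"
    using ct by (simp add: powr_diff powr_numeral)
  also have "(R t) powr (4 - 2 * \<alpha>) = (c * t) powr (4 / \<alpha> - 2)"
    using alpha by (simp add: R_def powr_powr diff_divide_distrib)
  finally show ?thesis by (simp add: algebra_simps)
qed

text \<open>
After clearing denominators with \<open>d = 4 - \<alpha>\<close>, all powers of \<open>\<alpha>\<close> below the fourth cancel.
\<close>

lemma energy_rate_const:
  "(energy_const - 1 / (4 - 2 * \<alpha>)) * (4 / \<alpha> - 2) = - (1 / 16) * (2 * \<alpha> / (4 - \<alpha>)) ^ 3"
proof -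
  define d where "d = 4 - \<alpha>"
  have d: "d \<noteq> 0" "4 - \<alpha> = d" using alpha by (auto simp: d_def)
  have e: "2 - \<alpha> \<noteq> 0" "\<alpha> \<noteq> 0" "4 - 2 * \<alpha> = 2 * (2 - \<alpha>)" using alpha by auto
  have ec: "energy_const = (d ^ 3 + 2 * \<alpha> * d\<^sup>2 + 2 * \<alpha>\<^sup>2 * d + 2 * \<alpha> ^ 3) / (4 * d ^ 3)"
    using d(1) unfolding energy_const_def B_def c_def d(2)
    by (simp add: field_simps power2_eq_square power3_eq_cube)
  have k: "4 / \<alpha> - 2 = 2 * (2 - \<alpha>) / \<alpha>" using e by (simp add: field_simps)
  have key: "(2 - \<alpha>) * (d ^ 3 + 2 * \<alpha> * d\<^sup>2 + 2 * \<alpha>\<^sup>2 * d + 2 * \<alpha> ^ 3) - 2 * d ^ 3 = - (\<alpha> ^ 4)"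
    unfolding d_def by (simp add: algebra_simps power2_eq_square power3_eq_cube power4_eq_xxxx)
  have "(energy_const - 1 / (4 - 2 * \<alpha>)) * (4 / \<alpha> - 2)
     = ((2 - \<alpha>) * (d ^ 3 + 2 * \<alpha> * d\<^sup>2 + 2 * \<alpha>\<^sup>2 * d + 2 * \<alpha> ^ 3) - 2 * d ^ 3) / (2 * \<alpha> * d ^ 3)"
    unfolding ec k e(3) using d(1) e(1,2) by (simp add: divide_simps)
  also have "\<dots> = - (1 / 16) * (2 * \<alpha> / d) ^ 3"
    unfolding key using d(1) e(2) by (simp add: field_simps power3_eq_cube power4_eq_xxxx)
  finally show ?thesis by (simp add: d_def)
qed

lemma fan_energy_deriv:
  assumes t: "0 < t" "t \<le> T"
  shows "(fan_energy has_real_derivative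
    - (pi / 16) * c powr ((8 - \<alpha>) / (2 * \<alpha>)) * t powr ((4 - 3 * \<alpha>) / \<alpha>)) (at t within {0..T})"
proof -
  let ?L = "pi * (energy_const - 1 / (4 - 2 * \<alpha>))" and ?k = "4 / \<alpha> - 2"
  have ct: "0 < c * t" using t c_pos by simp
  have "((\<lambda>t. steady_energy + ?L * (c * t) powr ?k) has_real_derivative ?L * (?k * (c * t) powr (?k - 1) * c)) (at t)"
    using ct by (auto intro!: derivative_eq_intros)
  then have "((\<lambda>t. steady_energy + ?L * (c * t) powr ?k) has_real_derivative ?L * (?k * (c * t) powr (?k - 1) * c)) (at t within {0..T})"
    by (rule has_field_derivative_at_within)
  then have "(fan_energy has_real_derivative ?L * (?k * (c * t) powr (?k - 1) * c)) (at t within {0..T})"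
  proof (rule has_field_derivative_transform_within[where d = t])
    show "steady_energy + ?L * (c * s) powr ?k = fan_energy s" if "s \<in> {0..T}" "dist s t < t" for s
      using that fan_energy_eq[of s] by (auto simp: dist_real_def)
  qed (use t in auto)
  also have "?L * (?k * (c * t) powr (?k - 1) * c) = pi * ((energy_const - 1 / (4 - 2 * \<alpha>)) * ?k) * ((c * t) powr (?k - 1) * c)"
    by simp
  also have "\<dots> = pi * (- (1 / 16) * (2 * \<alpha> / (4 - \<alpha>)) ^ 3) * ((c * t) powr (?k - 1) * c)"
    unfolding energy_rate_const ..
  also have "(2 * \<alpha> / (4 - \<alpha>)) ^ 3 = c powr (3 / 2)"
  proof -
    have p: "0 < 2 * \<alpha> / (4 - \<alpha>)" using alpha by simp
    have "c powr (3 / 2) = ((2 * \<alpha> / (4 - \<alpha>)) powr 2) powr (3 / 2)"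
      using p by (simp add: c_def powr_numeral)
    also have "\<dots> = (2 * \<alpha> / (4 - \<alpha>)) powr 3" by (simp add: powr_powr)
    finally show ?thesis using p by (simp add: powr_numeral)
  qed
  also have "(c * t) powr (?k - 1) * c = c powr ?k * t powr ((4 - 3 * \<alpha>) / \<alpha>)"
  proof -
    have "?k - 1 = (4 - 3 * \<alpha>) / \<alpha>" using alpha by (simp add: field_simps)
    moreover have "c powr (?k - 1) * c = c powr ?k"
    proof -
      have "c powr (?k - 1) * c powr 1 = c powr ?k"
        by (simp only: powr_add[symmetric]) simp
      then show ?thesis using c_pos by simp
    qed
    ultimately show ?thesis using c_pos t by (simp add: powr_mult mult_ac)
  qed
  also have "pi * (- (1 / 16) * c powr (3 / 2)) * (c powr ?k * t powr ((4 - 3 * \<alpha>) / \<alpha>))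
     = - (pi / 16) * (c powr (3 / 2) * c powr ?k) * t powr ((4 - 3 * \<alpha>) / \<alpha>)"
    by simp
  also have "c powr (3 / 2) * c powr ?k = c powr ((8 - \<alpha>) / (2 * \<alpha>))"
  proof -
    have "3 / 2 + ?k = (8 - \<alpha>) / (2 * \<alpha>)" using alpha by (simp add: field_simps)
    then show ?thesis by (metis powr_add)
  qed
  finally show ?thesis .
qed

text \<open>
The rate is a negative multiple of \<open>t powr m\<close> with \<open>m = (4 - 3 \<alpha>)/\<alpha>\<close>, whose limit at \<open>0\<close> is zero,
finite and negative, or \<open>- \<infinity>\<close> according to the sign of \<open>m\<close>.
\<close>

lemma fan_initial_energy_rate:
  "\<exists>L. initial_energy_rate fan_energy L \<and> (L = 0 \<longleftrightarrow> \<alpha> < 4 / 3)"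
proof -
  define Q where "Q = pi / 16 * c powr ((8 - \<alpha>) / (2 * \<alpha>))"
  define m where "m = (4 - 3 * \<alpha>) / \<alpha>"
  have Q: "0 < Q" using c_pos by (simp add: Q_def)
  have ev: "eventually (\<lambda>t. ereal (- Q * t powr m) = ereal (deriv fan_energy t)) (at_right 0)"
    unfolding eventually_at_right[OF T_pos]
  proof (intro exI[of _ T] conjI allI impI T_pos)
    fix t assume t: "0 < t" "t < T"
    then have "at t within {0..T} = at t"
      by (intro at_within_interior) auto
    then have "DERIV fan_energy t :> - Q * t powr m"
      using fan_energy_deriv[of t] t by (simp add: Q_def m_def)
    then show "ereal (- Q * t powr m) = ereal (deriv fan_energy t)"
      by (simp add: DERIV_imp_deriv)
  qed
  have *: "initial_energy_rate fan_energy L" if "((\<lambda>t. ereal (- Q * t powr m)) \<longlongrightarrow> L) (at_right 0)" for L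
    unfolding initial_energy_rate_def using tendsto_cong[OF ev] that by simp
  consider "\<alpha> < 4 / 3" | "\<alpha> = 4 / 3" | "\<alpha> > 4 / 3" by linarith
  then show ?thesis
  proof cases
    case 1
    then have m: "0 < m" using alpha by (simp add: m_def)
    have "((\<lambda>t::real. t powr m) \<longlongrightarrow> 0) (at_right 0)" using m by real_asymp
    from tendsto_mult[OF tendsto_const[of "- Q"] this]
    have "((\<lambda>t. ereal (- Q * t powr m)) \<longlongrightarrow> ereal 0) (at_right 0)"
      by (intro tendsto_ereal) simp
    from *[OF this] 1 show ?thesis by (intro exI[of _ "ereal 0"]) simp
  next
    case 2
    then have "m = 0" by (simp add: m_def)
    have "eventually (\<lambda>t. ereal (- Q) = ereal (- Q * t powr m)) (at_right 0)"
      by (rule eventually_at_rightI[of 0 1]) (simp_all add: \<open>m = 0\<close>)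
    then have "((\<lambda>t. ereal (- Q * t powr m)) \<longlongrightarrow> ereal (- Q)) (at_right 0)"
      by (rule Lim_transform_eventually[OF tendsto_const])
    moreover have "\<not> \<alpha> < 4 / 3" using 2 by simp
    ultimately show ?thesis using *[of "ereal (- Q)"] Q by (intro exI[of _ "ereal (- Q)"]) simp
  next
    case 3
    then have m: "m < 0" using alpha by (simp add: m_def divide_neg_pos)
    have "filterlim (\<lambda>t::real. t powr m) at_top (at_right 0)" using m by real_asymp
    then have "filterlim (\<lambda>t. - Q * t powr m) at_bot (at_right 0)"
      using Q by (intro filterlim_tendsto_neg_mult_at_bot[OF tendsto_const]) auto
    then have "((\<lambda>t. ereal (- Q * t powr m)) \<longlongrightarrow> - \<infinity>) (at_right 0)"
      unfolding tendsto_MInfty by (simp add: filterlim_at_bot_dense)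
    from *[OF this] 3 show ?thesis by (intro exI[of _ "- \<infinity>"]) simp
  qed
qed

section \<open>Vorticity\<close>

text \<open>
The classical vorticity \<open>r g' + 2 g\<close> of the field \<open>g x\<^sup>\<bottom>\<close>.
\<close>

definition vorticity :: "real^2 \<Rightarrow> real" where
  "vorticity x = norm x * gs' (norm x) + 2 * gs (norm x)"

lemma gs_zero: "r > M \<Longrightarrow> gs r = 0" "r > M \<Longrightarrow> gs' r = 0"
proof -
  assume r: "r > M"
  then show "gs r = 0" using chi_zero[of r] by (simp add: gs_def)
  have "(gs has_real_derivative 0) (at r)"
    by (rule has_field_derivative_transform_within_open[where f = "\<lambda>_. 0" and S = "{M<..}"])
      (use r chi_zero in \<open>auto simp: gs_def\<close>)
  then show "gs' r = 0"
    using gs_deriv[of r] r M_pos DERIV_unique by force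
qed

lemma vorticity_measurable: "vorticity \<in> borel_measurable borel"
proof -
  have m: "(\<lambda>r. r * gs' r + 2 * gs r) \<in> borel_measurable borel"
    by (intro borel_measurable_add borel_measurable_times borel_measurable_const measurable_ident
        gs_measurable gs'_measurable) simp
  show ?thesis unfolding vorticity_def[abs_def] by (rule measurable_compose[OF _ m]) simp
qed

lemma vorticity_bound:
  assumes "x \<noteq> 0"
  shows "\<bar>vorticity x\<bar> \<le> (K + \<alpha> + 2) * norm x powr (- \<alpha>)"
proof -
  have r: "0 < norm x" using assms by simp
  have "\<bar>vorticity x\<bar> \<le> \<bar>gs' (norm x)\<bar> * norm x + 2 * \<bar>gs (norm x)\<bar>"
    unfolding vorticity_def by (rule order_trans[OF abs_triangle_ineq]) (simp add: abs_mult)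
  also have "\<dots> \<le> (K + \<alpha>) * norm x powr (- \<alpha>) + 2 * norm x powr (- \<alpha>)"
    by (intro add_mono gs'_bound[OF r] mult_left_mono gs_bound[OF r]) simp
  finally show ?thesis by (simp add: distrib_right)
qed

lemma vorticity_zero: "norm x > M \<Longrightarrow> vorticity x = 0"
  by (simp add: vorticity_def gs_zero)

text \<open>
Rotating by a right angle turns the distributional rotation of \<open>g x\<^sup>\<bottom>\<close> into the divergence of \<open>g x\<close>.
The vorticity is \<open>O(r powr (- \<alpha>))\<close> with \<open>\<alpha> < 2\<close>, so the origin contributes nothing.
\<close>

lemma vorticity_is_rot: "is_rot (radial_velocity gs) vorticity"
  unfolding is_rot_def
proof (intro conjI allI impI)
  show "vorticity \<in> borel_measurable lborel" using vorticity_measurable by simp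
  have int: "integrable lborel vorticity"
    by (rule integrable_norm_powr_bound[OF alpha(2) M_pos vorticity_measurable])
      (use vorticity_bound vorticity_zero in auto)
  show "set_integrable lborel C vorticity" if "compact C" for C
    unfolding set_integrable_def
    by (intro integrable_mult_indicator int) (use that in \<open>auto intro: borel_compact\<close>)
  fix \<phi> :: "real^2 \<Rightarrow> real" and D assume test: "C1_test UNIV \<phi> D"
  obtain L where L: "L > 0" "\<And>x. \<bar>\<phi> x\<bar> \<le> L"
    using C1_test_UNIV_bounds[OF test] by (metis real_norm_def)
  define C where "C = (M + K + \<alpha> + 1) * (1 + L)"
  have C: "k * r powr (- \<alpha>) \<le> C * r powr (- \<alpha>)" "k * r powr (- \<alpha>) * L \<le> C * r powr (- \<alpha>)"
    if "0 \<le> k" "k \<le> M + K + \<alpha> + 1" for k r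
  proof -
    have "k * 1 \<le> C" "k * L \<le> C"
      unfolding C_def by (rule mult_mono; use that L M_pos K_nonneg alpha in simp)+
    then show "k * r powr (- \<alpha>) \<le> C * r powr (- \<alpha>)" "k * r powr (- \<alpha>) * L \<le> C * r powr (- \<alpha>)"
      using mult_right_mono[of "k * L" C "r powr (- \<alpha>)"] by (auto intro!: mult_right_mono simp: mult_ac)
  qed
  have parts: "(LINT x|lborel. gs (norm x) * (\<Sum>j\<in>UNIV. x $ j * D x (axis j 1)))
       = - (LINT x|lborel. (gs' (norm x) / norm x * (x \<bullet> x)
            + gs (norm x) * (\<Sum>j\<in>UNIV. (axis j 1 :: real^2) $ j)) * \<phi> x)"
  proof (rule radial_integration_by_parts(3)[where P = "\<lambda>x. x" and P' = "\<lambda>_ y. y" and N = "{}" and a = \<alpha> and C = C])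
    show "\<bar>gs (norm x)\<bar> * norm x \<le> C * norm x powr - \<alpha>" if "x \<noteq> 0" for x :: "real^2"
    proof (cases "norm x \<le> M")
      case True
      then have "\<bar>gs (norm x)\<bar> * norm x \<le> norm x powr - \<alpha> * M"
        using gs_bound[of "norm x"] that by (intro mult_mono) auto
      then show ?thesis using C(1)[of M "norm x"] M_pos K_nonneg alpha by (simp add: mult_ac)
    next
      case False
      then show ?thesis using C(1)[of 0 "norm x"] M_pos K_nonneg alpha by (simp add: gs_zero)
    qed
    show "\<bar>gs' (norm x)\<bar> * norm x * \<bar>\<phi> x\<bar> \<le> C * norm x powr - \<alpha>" if "x \<noteq> 0" for x :: "real^2"
    proof -
      have "\<bar>gs' (norm x)\<bar> * norm x * \<bar>\<phi> x\<bar> \<le> (K + \<alpha>) * norm x powr - \<alpha> * L"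
        by (rule mult_mono) (use gs'_bound[of "norm x"] that L K_nonneg alpha in auto)
      also have "\<dots> \<le> C * norm x powr - \<alpha>" using C(2)[of "K + \<alpha>" "norm x"] M_pos K_nonneg alpha by simp
      finally show ?thesis .
    qed
    show "\<bar>gs (norm x)\<bar> * norm (axis j 1 :: real^2) * \<bar>\<phi> x\<bar> \<le> C * norm x powr - \<alpha>" if "x \<noteq> 0" for x :: "real^2" and j
    proof -
      have "\<bar>gs (norm x)\<bar> * norm (axis j 1 :: real^2) * \<bar>\<phi> x\<bar> \<le> 1 * norm x powr - \<alpha> * L"
        using gs_bound[of "norm x"] that L by (simp add: mult_mono)
      also have "\<dots> \<le> C * norm x powr - \<alpha>" using C(2)[of 1 "norm x"] M_pos K_nonneg alpha by simp
      finally show ?thesis .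
    qed
  qed (use gs_cont gs_deriv gs_measurable gs'_measurable test alpha in \<open>simp_all add: has_derivative_ident\<close>)
  have w: "(gs' (norm x) / norm x * (x \<bullet> x) + gs (norm x) * (\<Sum>j\<in>UNIV. (axis j 1 :: real^2) $ j)) * \<phi> x = vorticity x * \<phi> x" for x :: "real^2"
    by (simp add: vorticity_def sum_2 axis_def power2_norm_eq_inner[symmetric] power2_eq_square)
  have v: "gs (norm x) * (\<Sum>j\<in>UNIV. x $ j * D x (axis j 1))
      = radial_velocity gs x $ 2 * D x (axis 1 1) - radial_velocity gs x $ 1 * D x (axis 2 1)" for x
    by (simp add: radial_velocity_def sum_2 algebra_simps)
  show "(LINT x|lborel. vorticity x * \<phi> x) =
        - (LINT x|lborel. radial_velocity gs x $ 2 * D x (axis 1 1) - radial_velocity gs x $ 1 * D x (axis 2 1))"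
    using parts unfolding w v by simp
qed

lemma vorticity_in_Lp:
  assumes "\<alpha> < 4 / 3"
  shows "in_Lp (3 / 2) vorticity"
  unfolding in_Lp_def
proof
  show "vorticity \<in> borel_measurable lborel" using vorticity_measurable by simp
  show "integrable lborel (\<lambda>x. norm (vorticity x) powr (3 / 2))"
  proof (rule integrable_norm_powr_bound[where a = "3 / 2 * \<alpha>" and M = M and C = "(K + \<alpha> + 2) powr (3 / 2)"])
    show "norm (norm (vorticity x) powr (3 / 2)) \<le> (K + \<alpha> + 2) powr (3 / 2) * norm x powr - (3 / 2 * \<alpha>)"
      if "x \<noteq> 0" for x
    proof -
      have "\<bar>vorticity x\<bar> powr (3 / 2) \<le> ((K + \<alpha> + 2) * norm x powr (- \<alpha>)) powr (3 / 2)"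
        using vorticity_bound[OF that] by (intro powr_mono2) auto
      also have "\<dots> = (K + \<alpha> + 2) powr (3 / 2) * norm x powr - (3 / 2 * \<alpha>)"
        using K_nonneg alpha by (simp add: powr_mult powr_powr mult_ac)
      finally show ?thesis by simp
    qed
    show "(\<lambda>x. norm (vorticity x) powr (3 / 2)) \<in> borel_measurable borel"
      by (rule powr_real_measurable[OF measurable_compose[OF vorticity_measurable borel_measurable_norm]]) simp
  qed (use assms M_pos vorticity_zero in auto)
qed

end

definition bump :: "real \<Rightarrow> real \<Rightarrow> real^2 \<Rightarrow> real" where
  "bump m l x = m * (max 0 (1 - (norm x / l)\<^sup>2))\<^sup>2"

text \<open>
The square of the positive part is continuously differentiable, so that \<open>bump\<close> is a test function.
\<close>

lemma C1_test_bump: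
  assumes "0 < l"
  shows "C1_test UNIV (bump m l) (\<lambda>x. (- (4 * m / l\<^sup>2) * max 0 (1 - (norm x / l)\<^sup>2)) *\<^sub>R blinfun_inner_left x)"
    (is "C1_test UNIV _ ?D")
proof -
  have sq: "((\<lambda>u::real. (max 0 u)\<^sup>2) has_real_derivative 2 * max 0 u) (at u)" for u
  proof (cases u "0::real" rule: linorder_cases)
    case less
    have "((\<lambda>u::real. 0) has_real_derivative 2 * max 0 u) (at u)" using less by simp
    then show ?thesis
      by (rule has_field_derivative_transform_within_open[where S = "{..<0}"]) (use less in auto)
  next
    case greater
    have "((\<lambda>u::real. u\<^sup>2) has_real_derivative 2 * max 0 u) (at u)"
      using greater by (auto intro!: derivative_eq_intros)
    then show ?thesis
      by (rule has_field_derivative_transform_within_open[where S = "{0<..}"]) (use greater in auto)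
  next
    case equal
    have "((\<lambda>h::real. (max 0 h)\<^sup>2 / h) \<longlongrightarrow> 0) (at 0)"
    proof (rule Lim_null_comparison[where g = "\<lambda>h. \<bar>h\<bar>"])
      show "eventually (\<lambda>h::real. norm ((max 0 h)\<^sup>2 / h) \<le> \<bar>h\<bar>) (at 0)"
        by (auto intro!: always_eventually simp: max_def power2_eq_square)
    qed (auto intro!: tendsto_eq_intros)
    then show ?thesis using equal by (simp add: DERIV_def)
  qed
  have "(bump m l has_derivative blinfun_apply (?D x)) (at x)" for x
  proof -
    have "((\<lambda>x. 1 - (1 / l\<^sup>2) * (x \<bullet> x)) has_derivative (\<lambda>y. 0 - (1 / l\<^sup>2) * (x \<bullet> y + y \<bullet> x))) (at x)"
      by (intro has_derivative_diff has_derivative_const has_derivative_mult_right has_derivative_inner has_derivative_ident)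
    then have "((\<lambda>x. 1 - (x \<bullet> x) / l\<^sup>2) has_derivative (\<lambda>y. - (2 * (x \<bullet> y)) / l\<^sup>2)) (at x)"
      by (simp add: inner_commute)
    from has_derivative_compose[OF this, of "\<lambda>u. (max 0 u)\<^sup>2" "\<lambda>h. 2 * max 0 (1 - (x \<bullet> x) / l\<^sup>2) * h"]
    have "((\<lambda>x. (max 0 (1 - (x \<bullet> x) / l\<^sup>2))\<^sup>2) has_derivative
       (\<lambda>y. 2 * max 0 (1 - (x \<bullet> x) / l\<^sup>2) * (- (2 * (x \<bullet> y)) / l\<^sup>2))) (at x)"
      using sq by (simp add: has_field_derivative_def)
    from has_derivative_mult_right[OF this, of m]
    have "((\<lambda>x. m * (max 0 (1 - (x \<bullet> x) / l\<^sup>2))\<^sup>2) has_derivative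
       (\<lambda>y. m * (2 * max 0 (1 - (x \<bullet> x) / l\<^sup>2) * (- (2 * (x \<bullet> y)) / l\<^sup>2)))) (at x)" .
    moreover have "(\<lambda>x. m * (max 0 (1 - (x \<bullet> x) / l\<^sup>2))\<^sup>2) = bump m l"
      by (auto simp: bump_def fun_eq_iff power_divide power2_norm_eq_inner)
    moreover have "(\<lambda>y. m * (2 * max 0 (1 - (x \<bullet> x) / l\<^sup>2) * (- (2 * (x \<bullet> y)) / l\<^sup>2))) = blinfun_apply (?D x)"
      by (auto simp: fun_eq_iff blinfun.scaleR_left blinfun.minus_left power_divide power2_norm_eq_inner inner_commute)
    ultimately show ?thesis by simp
  qed
  moreover have "continuous_on UNIV ?D"
    by (intro continuous_intros bounded_linear.continuous_on[OF bounded_linear_blinfun_inner_left]) (use assms in auto)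
  moreover have "bump m l x = 0" if "x \<notin> cball 0 l" for x
  proof -
    have "1 \<le> norm x / l" using that assms by simp
    then have "1 \<le> (norm x / l)\<^sup>2" by (simp add: one_le_power)
    then show ?thesis by (simp add: bump_def)
  qed
  ultimately show ?thesis
    unfolding C1_test_def by (auto intro!: exI[of _ "cball 0 l"])
qed

text \<open>
A crude form of Young's inequality for the exponents \<open>3/2\<close> and \<open>3\<close>.
\<close>

lemma young_three_halves:
  fixes a b :: real
  assumes "0 \<le> a" "0 \<le> b"
  shows "a * b \<le> a powr (3 / 2) + b ^ 3"
proof (cases "b\<^sup>2 \<le> a")
  case True
  then have "b \<le> sqrt a" using assms by (simp add: real_le_rsqrt)
  then have "a * b \<le> a * sqrt a" using assms by (intro mult_left_mono)
  also have "a * sqrt a = a powr 1 * a powr (1 / 2)"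
    using assms by (simp add: powr_half_sqrt)
  also have "\<dots> = a powr (3 / 2)"
    by (simp only: powr_add[symmetric]) simp
  finally show ?thesis using assms by (simp add: add_increasing2)
next
  case False
  then have "a * b \<le> b\<^sup>2 * b" using assms by (intro mult_right_mono) auto
  also have "\<dots> = b ^ 3" by (simp add: power2_eq_square power3_eq_cube)
  finally show ?thesis by (simp add: add_increasing)
qed

context truncated_vortex
begin

text \<open>
The gradient of \<open>bump\<close> is radial, so the pairing with the velocity is an explicit radial integral; it
scales like \<open>m l powr (2 - \<alpha>)\<close>.
\<close>

lemma bump_circulation:
  assumes l: "0 < l" "l \<le> r0"
  shows "(LINT x|lborel. gs (norm (x::real^2)) * (4 * m / l\<^sup>2) * max 0 (1 - (norm x / l)\<^sup>2) * (norm x)\<^sup>2)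
    = 16 * pi / ((4 - \<alpha>) * (6 - \<alpha>)) * m * l powr (2 - \<alpha>)"
proof -
  let ?f = "\<lambda>r. gs r * (4 * m / l\<^sup>2) * max 0 (1 - (r / l)\<^sup>2) * r\<^sup>2"
  have "(\<lambda>r::real. max 0 (1 - (r / l)\<^sup>2)) \<in> borel_measurable borel" by measurable
  then have mf: "?f \<in> borel_measurable borel"
    by (intro borel_measurable_times gs_measurable borel_measurable_const) auto
  have eq: "indicator {0<..} r * (2 * pi * r * ?f r) =
      8 * pi * m / l\<^sup>2 * (indicator {0<..<l} r * r powr (3 - \<alpha>)) - 8 * pi * m / l ^ 4 * (indicator {0<..<l} r * r powr (5 - \<alpha>))" for r
  proof (cases "0 < r \<and> r < l")
    case True
    then have g: "gs r = r powr (- \<alpha>)" using gs_inner[of r] l by simp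
    have "(r / l)\<^sup>2 \<le> 1" using True by (simp add: power_le_one)
    then have mx: "max 0 (1 - (r / l)\<^sup>2) = 1 - (r / l)\<^sup>2" by simp
    have p: "r powr (3 - \<alpha>) = r powr (- \<alpha>) * r ^ 3" "r powr (5 - \<alpha>) = r powr (- \<alpha>) * r ^ 5"
    proof -
      have "r powr (- \<alpha>) * r powr 3 = r powr (3 - \<alpha>)" "r powr (- \<alpha>) * r powr 5 = r powr (5 - \<alpha>)"
        by (simp_all only: powr_add[symmetric]) simp_all
      then show "r powr (3 - \<alpha>) = r powr (- \<alpha>) * r ^ 3" "r powr (5 - \<alpha>) = r powr (- \<alpha>) * r ^ 5"
        using True by (simp_all add: powr_numeral)
    qed
    show ?thesis
      using True l unfolding g mx p
      by (simp add: field_simps power2_eq_square power3_eq_cube eval_nat_numeral)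
  next
    case False
    have "1 \<le> (r / l)\<^sup>2" if "l \<le> r" using that l by (simp add: one_le_power)
    then show ?thesis using False by (auto simp: indicator_def)
  qed
  have p1: "has_bochner_integral lborel (\<lambda>r. indicator {0<..<l} r * r powr (3 - \<alpha>)) (l powr (4 - \<alpha>) / (4 - \<alpha>))"
    and p2: "has_bochner_integral lborel (\<lambda>r. indicator {0<..<l} r * r powr (5 - \<alpha>)) (l powr (6 - \<alpha>) / (6 - \<alpha>))"
    using has_bochner_integral_powr_near_0[of "3 - \<alpha>" l] has_bochner_integral_powr_near_0[of "5 - \<alpha>" l] l alpha by simp_all
  have "(LINT x|lborel. ?f (norm (x::real^2))) = (LINT r|lborel. indicator {0<..} r * (2 * pi * r * ?f r))"
    using integral_radial[OF mf] unfolding set_lebesgue_integral_def real_scaleR_def .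
  also have "\<dots> = 8 * pi * m / l\<^sup>2 * (l powr (4 - \<alpha>) / (4 - \<alpha>)) - 8 * pi * m / l ^ 4 * (l powr (6 - \<alpha>) / (6 - \<alpha>))"
    unfolding eq
    by (rule has_bochner_integral_integral_eq)
      (intro has_bochner_integral_diff has_bochner_integral_mult_right p1 p2)
  also have "l powr (4 - \<alpha>) = l powr (2 - \<alpha>) * l\<^sup>2"
  proof -
    have "l powr (2 - \<alpha>) * l powr 2 = l powr (4 - \<alpha>)"
      by (simp only: powr_add[symmetric]) simp
    then show ?thesis using l by (simp add: powr_numeral)
  qed
  also have "l powr (6 - \<alpha>) = l powr (2 - \<alpha>) * l ^ 4"
  proof -
    have "l powr (2 - \<alpha>) * l powr 4 = l powr (6 - \<alpha>)"
      by (simp only: powr_add[symmetric]) simp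
    then show ?thesis using l by (simp add: powr_numeral)
  qed
  also have "8 * pi * m / l\<^sup>2 * (l powr (2 - \<alpha>) * l\<^sup>2 / (4 - \<alpha>)) - 8 * pi * m / l ^ 4 * (l powr (2 - \<alpha>) * l ^ 4 / (6 - \<alpha>))
    = 8 * pi * m * l powr (2 - \<alpha>) * (1 / (4 - \<alpha>) - 1 / (6 - \<alpha>))"
    using l by (simp add: right_diff_distrib)
  also have "1 / (4 - \<alpha>) - 1 / (6 - \<alpha>) = 2 / ((4 - \<alpha>) * (6 - \<alpha>))"
    using alpha by (simp add: diff_frac_eq)
  finally show ?thesis by simp
qed

text \<open>
With the height \<open>m = l powr (-2/3) / 2\<close>, the cubic term of Young's inequality is \<open>\<pi> / 8\<close> for every
\<open>l\<close>, while the circulation is at least \<open>\<pi> / 3\<close> because \<open>l powr (4/3 - \<alpha>) \<ge> 1\<close>. The difference must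
be supplied by \<open>\<integral> |w| powr (3/2)\<close> over the disc of radius \<open>l\<close>, which tends to \<open>0\<close> with \<open>l\<close>.
\<close>

lemma vorticity_not_in_L32:
  assumes a43: "4 / 3 \<le> \<alpha>" and rot: "is_rot (radial_velocity gs) w" and Lp: "in_Lp (3 / 2) w"
  shows False
proof -
  define W where "W x = norm (w x) powr (3 / 2)" for x
  have wm: "w \<in> borel_measurable borel" and W: "integrable lborel W"
    using Lp by (auto simp: in_Lp_def W_def[abs_def])
  have W0: "0 \<le> W x" for x by (simp add: W_def)
  have lower: "5 * pi / 24 \<le> (LINT x|lborel. indicator (cball 0 l) x * W x)" if l: "0 < l" "l \<le> r0" "l \<le> 1" for l
  proof -
    define m where "m = l powr (- 2 / 3) / 2"
    have m: "0 < m" using l by (simp add: m_def)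
    let ?D = "\<lambda>x::real^2. (- (4 * m / l\<^sup>2) * max 0 (1 - (norm x / l)\<^sup>2)) *\<^sub>R blinfun_inner_left x"
    have test: "C1_test UNIV (bump m l) ?D" by (rule C1_test_bump[OF l(1)])
    have "(LINT x|lborel. w x * bump m l x) =
        - (LINT x|lborel. radial_velocity gs x $ 2 * ?D x (axis 1 1) - radial_velocity gs x $ 1 * ?D x (axis 2 1))"
      using rot test unfolding is_rot_def by blast
    also have "\<dots> = (LINT x|lborel. - (radial_velocity gs x $ 2 * ?D x (axis 1 1) - radial_velocity gs x $ 1 * ?D x (axis 2 1)))"
      by (rule integral_minus[symmetric])
    also have "\<dots> = (LINT x|lborel. gs (norm (x::real^2)) * (4 * m / l\<^sup>2) * max 0 (1 - (norm x / l)\<^sup>2) * (norm x)\<^sup>2)"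
      unfolding norm_sq_2
      by (rule Bochner_Integration.integral_cong[OF refl])
        (simp add: radial_velocity_def blinfun.scaleR_left blinfun.minus_left inner_axis inner_axis' add_divide_distrib power2_eq_square[of "_ $ _"] algebra_simps)
    also have "\<dots> = 16 * pi / ((4 - \<alpha>) * (6 - \<alpha>)) * m * l powr (2 - \<alpha>)"
      by (rule bump_circulation[OF l(1,2)])
    finally have circ: "(LINT x|lborel. w x * bump m l x) = 16 * pi / ((4 - \<alpha>) * (6 - \<alpha>)) * m * l powr (2 - \<alpha>)" .
    have "has_bochner_integral lborel (indicator (cball (0::real^2) l)) (measure lborel (cball (0::real^2) l))"
      by (rule has_bochner_integral_real_indicator) (use l in \<open>auto simp: emeasure_cball\<close>)
    from has_bochner_integral_mult_left[OF this, of "m ^ 3"]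
    have ball: "integrable lborel (\<lambda>x::real^2. indicator (cball 0 l) x * m ^ 3)"
      "(LINT x|lborel. indicator (cball (0::real^2) l) x * m ^ 3) = m ^ 3 * (pi * l\<^sup>2)"
      using l by (auto simp: has_bochner_integral_iff content_cball unit_ball_vol_2)
    have IW: "integrable lborel (\<lambda>x. indicator (cball 0 l) x * W x)"
      using integrable_mult_indicator[OF _ W, of "cball 0 l"] by simp
    have bp: "bump m l x \<le> m * indicator (cball 0 l) x" "0 \<le> bump m l x" for x
    proof -
      show "0 \<le> bump m l x" using m by (simp add: bump_def)
      show "bump m l x \<le> m * indicator (cball 0 l) x"
      proof (cases "norm x \<le> l")
        case True
        have "(max 0 (1 - (norm x / l)\<^sup>2))\<^sup>2 \<le> 1"
          by (intro power_le_one) auto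
        then show ?thesis using True m by (simp add: bump_def mult_left_le)
      next
        case False
        then have "1 \<le> (norm x / l)\<^sup>2" using l by (simp add: one_le_power)
        then show ?thesis using False by (simp add: bump_def)
      qed
    qed
    have pt: "\<bar>w x * bump m l x\<bar> \<le> indicator (cball 0 l) x * W x + indicator (cball 0 l) x * m ^ 3" for x
    proof (cases "x \<in> cball 0 l")
      case True
      have "\<bar>w x * bump m l x\<bar> \<le> \<bar>w x\<bar> * m"
        using bp[of x] True by (simp add: abs_mult mult_left_mono)
      also have "\<dots> \<le> W x + m ^ 3"
        using young_three_halves[of "\<bar>w x\<bar>" m] m by (simp add: W_def)
      finally show ?thesis using True by simp
    next
      case False
      then show ?thesis using bp[of x] by simp
    qed
    have "(LINT x|lborel. w x * bump m l x) \<le> (LINT x|lborel. indicator (cball 0 l) x * W x + indicator (cball 0 l) x * m ^ 3)"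
    proof (rule integral_mono)
      have "bump m l \<in> borel_measurable borel" by (rule C1_test_measurable(1)[OF test])
      then have "(\<lambda>x. w x * bump m l x) \<in> borel_measurable lborel" using wm by simp
      then show "integrable lborel (\<lambda>x. w x * bump m l x)"
        by (rule Bochner_Integration.integrable_bound[OF Bochner_Integration.integrable_add[OF IW ball(1)]])
          (use pt in \<open>auto intro!: always_eventually intro: order_trans[OF _ abs_ge_self]\<close>)
      show "integrable lborel (\<lambda>x. indicator (cball 0 l) x * W x + indicator (cball 0 l) x * m ^ 3)"
        by (intro Bochner_Integration.integrable_add IW ball)
      show "w x * bump m l x \<le> indicator (cball 0 l) x * W x + indicator (cball 0 l) x * m ^ 3" for x
        using pt[of x] by linarith
    qed
    also have "\<dots> = (LINT x|lborel. indicator (cball 0 l) x * W x) + m ^ 3 * (pi * l\<^sup>2)"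
      using Bochner_Integration.integral_add[OF IW ball(1)] ball(2) by simp
    finally have main: "16 * pi / ((4 - \<alpha>) * (6 - \<alpha>)) * m * l powr (2 - \<alpha>) \<le> (LINT x|lborel. indicator (cball 0 l) x * W x) + m ^ 3 * (pi * l\<^sup>2)"
      unfolding circ .
    have "m ^ 3 * (pi * l\<^sup>2) = pi / 8"
    proof -
      have "(l powr (- 2 / 3)) ^ 3 = l powr (- 2)"
        using l by (simp add: powr_powr flip: powr_numeral)
      then have "m ^ 3 = l powr (- 2) / 8" by (simp add: m_def power_divide)
      then show ?thesis using l by (simp add: powr_minus_divide powr_numeral)
    qed
    moreover have "pi / 3 \<le> 16 * pi / ((4 - \<alpha>) * (6 - \<alpha>)) * m * l powr (2 - \<alpha>)"
    proof -
      have "(4 - \<alpha>) * (6 - \<alpha>) \<le> 4 * 6" using alpha by (intro mult_mono) auto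
      then have 1: "16 * pi / (4 * 6) \<le> 16 * pi / ((4 - \<alpha>) * (6 - \<alpha>))"
        using alpha by (intro divide_left_mono) auto
      have "l powr (- 2 / 3) * l powr (2 - \<alpha>) = l powr (4 / 3 - \<alpha>)"
        by (simp only: powr_add[symmetric]) simp
      moreover have "1 \<le> l powr (4 / 3 - \<alpha>)"
        using powr_mono2'[of "4 / 3 - \<alpha>" l 1] l a43 by simp
      ultimately have 2: "1 / 2 \<le> m * l powr (2 - \<alpha>)" by (simp add: m_def)
      have "16 * pi / (4 * 6) * (1 / 2) \<le> 16 * pi / ((4 - \<alpha>) * (6 - \<alpha>)) * (m * l powr (2 - \<alpha>))"
        using alpha by (intro mult_mono[OF 1 2]) auto
      then show ?thesis by simp
    qed
    ultimately show ?thesis using main by linarith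
  qed
  define ls where "ls n = min 1 r0 / real (Suc n)" for n
  have ls: "0 < ls n" "ls n \<le> r0" "ls n \<le> 1" for n
  proof -
    have "ls n \<le> min 1 r0 / 1" unfolding ls_def using r0 by (intro divide_left_mono) auto
    then show "0 < ls n" "ls n \<le> r0" "ls n \<le> 1" using r0 by (auto simp: ls_def)
  qed
  have ls0: "ls \<longlonglongrightarrow> 0"
    unfolding ls_def[abs_def] using LIMSEQ_Suc[OF lim_const_over_n[of "min 1 r0"]] by simp
  have "(\<lambda>n. LINT x|lborel. indicator (cball 0 (ls n)) x * W x) \<longlonglongrightarrow> (LINT x|(lborel :: (real^2) measure). 0)"
  proof (rule integral_dominated_convergence[OF _ _ W])
    show "AE x in lborel. (\<lambda>n. indicator (cball 0 (ls n)) x * W x) \<longlonglongrightarrow> 0"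
    proof (rule eventually_mono[OF AE_lborel_singleton[of 0]])
      fix x :: "real^2" assume "x \<noteq> 0"
      then have "eventually (\<lambda>n. ls n < norm x) sequentially"
        using order_tendstoD(2)[OF ls0, of "norm x"] by simp
      then have "eventually (\<lambda>n. 0 = indicator (cball 0 (ls n)) x * W x) sequentially"
        by (rule eventually_mono) simp
      then show "(\<lambda>n. indicator (cball 0 (ls n)) x * W x) \<longlonglongrightarrow> 0"
        by (rule Lim_transform_eventually[OF tendsto_const])
    qed
    show "AE x in lborel. norm (indicator (cball 0 (ls n)) x * W x) \<le> W x" for n
      using W0 by (auto simp: indicator_def)
    show "(\<lambda>x. indicator (cball 0 (ls n)) x * W x) \<in> borel_measurable lborel" for n
      using borel_measurable_integrable[OF integrable_mult_indicator[OF _ W, of "cball 0 (ls n)"]] by simp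
  qed simp
  then have "(\<lambda>n. LINT x|lborel. indicator (cball 0 (ls n)) x * W x) \<longlonglongrightarrow> 0" by simp
  from LIMSEQ_le_const[OF this] lower[OF ls] have "5 * pi / 24 \<le> 0" by blast
  then show False using pi_gt_zero by simp
qed

end

section \<open>The subsolution\<close>

text \<open>
Smoothness up to the boundary of the half-line gives a bounded derivative of the cutoff. The steady
pressure is an antiderivative of \<open>r g\<^sup>2\<close>, which is constant beyond the support of the cutoff.
\<close>

lemma truncated_vortex_exists:
  fixes \<alpha> r0 :: real and chi :: "real \<Rightarrow> real"
  assumes alpha: "0 < \<alpha>" "\<alpha> < 2" and r0: "r0 > 0"
    and smooth: "smooth_halfline chi"
    and range: "\<And>r. r \<ge> 0 \<Longrightarrow> chi r \<in> {0..1}"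
    and supp: "compact (closure {r. r \<ge> 0 \<and> chi r \<noteq> 0})"
    and one: "\<And>r. r \<in> {0..r0} \<Longrightarrow> chi r = 1"
  shows "\<exists>M K chi' ps. truncated_vortex \<alpha> r0 M K chi chi' ps"
proof -
  from smooth obtain d where d0: "\<And>r. r \<ge> 0 \<Longrightarrow> d 0 r = chi r"
    and dd: "\<And>n r. r \<ge> 0 \<Longrightarrow> (d n has_real_derivative d (Suc n) r) (at r within {0..})"
    unfolding smooth_halfline_def by metis
  define chi' where "chi' = d (Suc 0)"
  have dpos: "(d n has_real_derivative d (Suc n) r) (at r)" if "r > 0" for n r
  proof -
    have "at r within {0..} = at r"
      using that by (intro at_within_interior) auto
    then show ?thesis using dd[of r n] that by simp
  qed
  have chi_deriv: "(chi has_real_derivative chi' r) (at r)" if "r > 0" for r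
    unfolding chi'_def
    by (rule has_field_derivative_transform_within_open[OF dpos[OF that] open_greaterThan[of 0]]) (use that d0 in auto)
  have chi'_cont: "continuous_on {0..} chi'"
    unfolding chi'_def continuous_on_eq_continuous_within
    using dd by (auto intro: DERIV_continuous)
  have chi_cont: "continuous_on {0<..} chi"
    by (intro continuous_at_imp_continuous_on ballI DERIV_isCont[OF chi_deriv]) simp
  have "bounded {r. r \<ge> 0 \<and> chi r \<noteq> 0}"
    using compact_imp_bounded[OF supp] bounded_subset closure_subset by blast
  then obtain M0 where M0: "\<And>r. r \<ge> 0 \<Longrightarrow> chi r \<noteq> 0 \<Longrightarrow> \<bar>r\<bar> \<le> M0"
    by (auto simp: bounded_iff)
  define M where "M = max r0 (\<bar>M0\<bar> + 1)"
  have M: "r0 \<le> M" "0 < M" using r0 by (auto simp: M_def)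
  have zero: "chi r = 0" if "r \<ge> M" for r
    using M0[of r] that M by (force simp: M_def)
  have "compact (chi' ` {0..M})"
    by (intro compact_continuous_image continuous_on_subset[OF chi'_cont]) auto
  then obtain L where L: "L > 0" "\<forall>y\<in>chi' ` {0..M}. norm y \<le> L"
    using compact_imp_bounded bounded_pos by metis
  have chi'_zero: "chi' r = 0" if "r > M" for r
  proof -
    have "(chi has_real_derivative 0) (at r)"
      by (rule has_field_derivative_transform_within_open[where f = "\<lambda>_. 0" and S = "{M<..}"])
        (use that zero in auto)
    then show ?thesis using chi_deriv[of r] that M DERIV_unique by force
  qed
  have chi'_bound: "\<bar>chi' r\<bar> * r \<le> L * M" if "r > 0" for r
  proof (cases "r \<le> M")
    case True
    then show ?thesis using L that by (intro mult_mono) auto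
  next
    case False
    then show ?thesis using chi'_zero[of r] L M by simp
  qed
  define k where "k r = r * (chi r * r powr (- \<alpha>))\<^sup>2" for r
  have "continuous_on {0<..} k"
    unfolding k_def by (intro continuous_intros chi_cont) auto
  then have "isCont k r" if "0 < r" for r
    using that by (auto simp: continuous_on_eq_continuous_at)
  then obtain P where "\<And>r. ereal 0 < ereal r \<Longrightarrow> ereal r < \<infinity> \<Longrightarrow> (P has_vector_derivative k r) (at r)"
    using einterval_antiderivative[of "ereal 0" \<infinity> k] by auto
  then have P: "(P has_real_derivative k r) (at r)" if "r > 0" for r
    using that by (auto simp: has_real_derivative_iff_has_vector_derivative)
  define ps where "ps r = (if 0 < r then P r - P M else 0)" for r
  have ps_deriv: "(ps has_real_derivative k r) (at r)" if "r > 0" for r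
  proof -
    have "((\<lambda>r. P r - P M) has_real_derivative k r) (at r)"
      using P[OF that] by (auto intro!: derivative_eq_intros)
    then show ?thesis
      by (rule has_field_derivative_transform_within_open[OF _ open_greaterThan[of 0]]) (use that in \<open>auto simp: ps_def\<close>)
  qed
  have ps_zero: "ps r = 0" if "r \<ge> M \<or> r \<le> 0" for r
  proof (cases "r \<le> 0")
    case False
    then have r: "M \<le> r" using that by simp
    have "P r = P M"
    proof (rule antisym)
      have D: "\<exists>y. DERIV P x :> y \<and> 0 \<le> y \<and> y \<le> 0" if "M \<le> x" for x
        using P[of x] zero[of x] that M by (intro exI[of _ "k x"]) (simp add: k_def)
      show "P M \<le> P r" by (rule DERIV_nonneg_imp_nondecreasing[OF r]) (use D in blast)
      show "P r \<le> P M" by (rule DERIV_nonpos_imp_nonincreasing[OF r]) (use D in blast)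
    qed
    then show ?thesis by (simp add: ps_def)
  qed (simp add: ps_def)
  have "truncated_vortex \<alpha> r0 M (L * M) chi chi' ps"
  proof
    show "continuous_on {0<..} chi'" by (rule continuous_on_subset[OF chi'_cont]) auto
    show "0 \<le> chi r \<and> chi r \<le> 1" if "r > 0" for r using range[of r] that by simp
    show "(ps has_real_derivative r * (chi r * r powr - \<alpha>)\<^sup>2) (at r)" if "r > 0" for r
      using ps_deriv[OF that] by (simp add: k_def)
    show "chi r = 1" if "0 < r" "r \<le> r0" for r using one[of r] that by simp
  qed (fact alpha r0 M(1) chi_deriv zero chi'_bound ps_zero)+
  then show ?thesis by blast
qed

context truncated_vortex
begin

lemma steady_solution:
  "steady_euler_solution T (radial_velocity gs) (radial_bernoulli gs ps)"
proof -
  interpret S: radial_flow \<alpha> M "Max {1, M powr (2 - \<alpha>) / \<alpha>}" T "\<lambda>_. gs" "\<lambda>_. gs'" "\<lambda>_ _. 0" "\<lambda>_ _. 0" "\<lambda>_. ps" "{}"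
    by (rule steady_radial_flow)
  have "radial_stress gs (\<lambda>_. 0) = (\<lambda>x. traceless_square (radial_velocity gs x))"
    by (simp add: radial_stress_def fun_eq_iff)
  then show ?thesis
    using S.subsolution by (simp add: steady_euler_solution_def euler_weak_solution_def)
qed

lemma fan_subsolution:
  "subsolution T (radial_velocity gs) (\<lambda>t. radial_velocity (fan_g t))
     (\<lambda>t. radial_stress (fan_g t) (fan_b t)) (\<lambda>t. radial_bernoulli (fan_g t) (fan_p t))"
proof -
  obtain C where "radial_flow \<alpha> M C T fan_g fan_g' fan_b fan_b' fan_p front"
    using fan_radial_flow by blast
  then interpret S: radial_flow \<alpha> M C T fan_g fan_g' fan_b fan_b' fan_p front .
  show ?thesis using S.subsolution by (simp add: fan_initial)
qed

lemma fan_outside: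
  assumes "0 \<le> t" "norm x > (c * t) powr (1 / \<alpha>)"
  shows "radial_velocity (fan_g t) x = radial_velocity gs x"
    and "radial_stress (fan_g t) (fan_b t) x = traceless_square (radial_velocity gs x)"
    and "radial_bernoulli (fan_g t) (fan_p t) x = radial_bernoulli gs ps x"
proof -
  have "\<not> inside t (norm x)"
    using assms inside_iff[of t "norm x"] not_inside_0 by (cases "t = 0") (auto simp: R_def)
  then show "radial_velocity (fan_g t) x = radial_velocity gs x"
    "radial_stress (fan_g t) (fan_b t) x = traceless_square (radial_velocity gs x)"
    "radial_bernoulli (fan_g t) (fan_p t) x = radial_bernoulli gs ps x"
    by (simp_all add: radial_velocity_def radial_stress_def radial_bernoulli_def fan_g_def fan_b_def fan_p_def)
qed

lemma radial_velocity_gs: "radial_velocity gs = (\<lambda>x. (chi (norm x) * norm x powr (- \<alpha>)) *\<^sub>R perp x)"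
proof
  fix x show "radial_velocity gs x = (chi (norm x) * norm x powr (- \<alpha>)) *\<^sub>R perp x"
    by (cases "x = 0") (simp_all add: radial_velocity_def gs_def)
qed

end

theorem theorem1p5:
  fixes \<alpha> r0 c T :: real and chi :: "real \<Rightarrow> real" and vs :: "real^2 \<Rightarrow> real^2"
  assumes "0 < \<alpha>" and "\<alpha> < 2" and "r0 > 0"
    and "smooth_halfline chi"
    and "\<And>r. r \<ge> 0 \<Longrightarrow> chi r \<in> {0..1}"
    and "compact (closure {r. r \<ge> 0 \<and> chi r \<noteq> 0})"
    and "\<And>r. r \<in> {0..r0} \<Longrightarrow> chi r = 1"
    and "vs = (\<lambda>x. (chi (norm x) * norm x powr (- \<alpha>)) *\<^sub>R perp x)"
    and "c = (2 * \<alpha> / (4 - \<alpha>))\<^sup>2"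
    and "T = r0 powr \<alpha> / c"
  shows "\<exists>qs. steady_euler_solution T vs qs \<and>
    (\<exists>v \<sigma> q. subsolution T vs v \<sigma> q \<and>
       (\<forall>t\<in>{0..T}. \<forall>x. norm x > (c * t) powr (1 / \<alpha>) \<longrightarrow>
          v t x = vs x \<and> \<sigma> t x = traceless_square (vs x) \<and> q t x = qs x) \<and>
       (\<forall>t\<in>{0<..T}. (energy v \<sigma> has_real_derivative
          - (pi / 16) * c powr ((8 - \<alpha>) / (2 * \<alpha>)) * t powr ((4 - 3 * \<alpha>) / \<alpha>))
          (at t within {0..T})) \<and>
       (\<exists>L. initial_energy_rate (energy v \<sigma>) L \<and> (L = 0 \<longleftrightarrow> \<alpha> < 4 / 3)) \<and>
       (\<alpha> < 4 / 3 \<longleftrightarrow> (\<exists>\<omega>. is_rot vs \<omega> \<and> in_Lp (3 / 2) \<omega>)))"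
proof -
  obtain M K chi' ps where "truncated_vortex \<alpha> r0 M K chi chi' ps"
    using truncated_vortex_exists[OF assms(1-7)] by blast
  then interpret V: truncated_vortex \<alpha> r0 M K chi chi' ps .
  have c: "c = V.c" and T: "T = V.T" and vs: "vs = radial_velocity V.gs"
    using assms(8-10) by (simp_all add: V.c_def V.T_def V.radial_velocity_gs)
  let ?v = "\<lambda>t. radial_velocity (V.fan_g t)" and ?\<sigma> = "\<lambda>t. radial_stress (V.fan_g t) (V.fan_b t)"
  let ?q = "\<lambda>t. radial_bernoulli (V.fan_g t) (V.fan_p t)"
  have E: "energy ?v ?\<sigma> = V.fan_energy"
    by (simp add: V.fan_energy_def)
  have rot: "\<alpha> < 4 / 3 \<longleftrightarrow> (\<exists>\<omega>. is_rot vs \<omega> \<and> in_Lp (3 / 2) \<omega>)"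
    using V.vorticity_is_rot V.vorticity_in_Lp V.vorticity_not_in_L32 unfolding vs by (meson not_le)
  show ?thesis
  proof (intro exI[of _ "radial_bernoulli V.gs ps"] conjI)
    show "steady_euler_solution T vs (radial_bernoulli V.gs ps)"
      unfolding T vs by (rule V.steady_solution)
    show "\<exists>v \<sigma> q. subsolution T vs v \<sigma> q \<and>
       (\<forall>t\<in>{0..T}. \<forall>x. norm x > (c * t) powr (1 / \<alpha>) \<longrightarrow>
          v t x = vs x \<and> \<sigma> t x = traceless_square (vs x) \<and> q t x = radial_bernoulli V.gs ps x) \<and>
       (\<forall>t\<in>{0<..T}. (energy v \<sigma> has_real_derivative
          - (pi / 16) * c powr ((8 - \<alpha>) / (2 * \<alpha>)) * t powr ((4 - 3 * \<alpha>) / \<alpha>))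
          (at t within {0..T})) \<and>
       (\<exists>L. initial_energy_rate (energy v \<sigma>) L \<and> (L = 0 \<longleftrightarrow> \<alpha> < 4 / 3)) \<and>
       (\<alpha> < 4 / 3 \<longleftrightarrow> (\<exists>\<omega>. is_rot vs \<omega> \<and> in_Lp (3 / 2) \<omega>))"
    proof (intro exI[of _ ?v] exI[of _ ?\<sigma>] exI[of _ ?q] conjI)
      show "subsolution T vs ?v ?\<sigma> ?q"
        unfolding T vs by (rule V.fan_subsolution)
      show "\<forall>t\<in>{0..T}. \<forall>x. norm x > (c * t) powr (1 / \<alpha>) \<longrightarrow>
          ?v t x = vs x \<and> ?\<sigma> t x = traceless_square (vs x) \<and> ?q t x = radial_bernoulli V.gs ps x"
        unfolding c vs using V.fan_outside by simp
      show "\<forall>t\<in>{0<..T}. (energy ?v ?\<sigma> has_real_derivative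
          - (pi / 16) * c powr ((8 - \<alpha>) / (2 * \<alpha>)) * t powr ((4 - 3 * \<alpha>) / \<alpha>))
          (at t within {0..T})"
        unfolding E c T using V.fan_energy_deriv by simp
      show "\<exists>L. initial_energy_rate (energy ?v ?\<sigma>) L \<and> (L = 0 \<longleftrightarrow> \<alpha> < 4 / 3)"
        unfolding E by (rule V.fan_initial_energy_rate)
    qed (rule rot)
  qed
qed

end
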